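(* Let $(A,b)\in\mathcal B$ (setting $\mathcal B$) and $F\in L^2_{\mathrm{per}}(Y;\mathbb{R}^n)$. Let $\gamma:=\frac{\mathrm{tr}(A)}{|A|^2+|b|^2}$, $\tilde A:=\gamma A$, $\tilde b:=\gamma b$, and let $\tilde r\in L^2_{\mathrm{per}}(Y)$ denote the unique solution in $L^2_{\mathrm{per}}(Y)$ to $-D^2:(\tilde A\tilde r)+\nabla\cdot(\tilde b\tilde r)=0$ in $Y$, $\tilde r$ $Y$-periodic, $\int_Y\tilde r=1$. Let $B_2:H^1_{\mathrm{per},0}(Y;\mathbb{R}^n)\times H^1_{\mathrm{per},0}(Y;\mathbb{R}^n)\to\mathbb{R}$ be given by $$B_2(v,w):=\int_Y(\nabla\cdot v)(\tilde A:Dw+\tilde b\cdot w)+\frac12\int_Y(Dv-(Dv)^{\mathrm T}):(Dw-(Dw)^{\mathrm T}).$$ Then the following assertions hold. (i) There exists a unique $\tilde\rho_0\in H^1_{\mathrm{per},0}(Y;\mathbb{R}^n)$ such that $B_2(\tilde\rho_0,w)=-\int_Y F\cdot w$ for all $w\in H^1_{\mathrm{per},0}(Y;\mathbb{R}^n)$. (ii) The function $\tilde u_0:=-\nabla\cdot\tilde\rho_0$ is the unique solution in $L^2_{\mathrm{per}}(Y)$ to $$-D^2:(\tilde A\tilde u_0)+\nabla\cdot(\tilde b\tilde u_0)=\nabla\cdot F\ \text{ in }Y,\qquad\tilde u_0\text{ is }Y\text{-periodic},\qquad\int_Y\tilde u_0=0.$$ (iii) A function $\tilde u\in L^2_{\mathrm{per}}(Y)$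 is a solution to $$-D^2:(\tilde A\tilde u)+\nabla\cdot(\tilde b\tilde u)=\nabla\cdot F\ \text{ in }Y,\qquad\tilde u\text{ is }Y\text{-periodic},$$ if and only if $\tilde u=\tilde u_0+c\tilde r$ for some constant $c\in\mathbb{R}$.
   Context: $Y:=(0,1)^n\subset\mathbb{R}^n$. The subscript "per" denotes spaces of $Y$-periodic functions on $\mathbb{R}^n$ with the indicated (local) regularity; the additional subscript $0$ means that (each component of) the function has mean zero over $Y$. $|A|:=\sqrt{A:A}$ is the Frobenius norm, $|b|$ the Euclidean norm, $M:N=\sum_{ij}M_{ij}N_{ij}$, and $Dw$ is the Jacobian of $w$. Setting $\mathcal B$: $(A,b)\in\mathcal B$ means that $A\in L^\infty_{\mathrm{per}}(Y;\mathbb{R}^{n\times n}_{\mathrm{sym}})$, $b\in L^\infty_{\mathrm{per}}(Y;\mathbb{R}^n)$; $A$ is uniformly elliptic, i.e. there are $\lambda,\Lambda>0$ with $\lambda I_n\le A\le\Lambda I_n$ a.e. in $\mathbb{R}^n$; and the Cordes-type condition holds: there exists $\delta\in\left(\frac{n}{n+\pi^2},1\right]$ such that $\frac{|A|^2+|b|^2}{(\mathrm{tr}(A))^2}\le\frac{1}{n-1+\delta}$ a.e. in $\mathbb{R}^n$. $D^2:(\tilde A u):=\sum_{i,j}\partial^2_{ij}(\tilde a_{ij}u)$. Solutions $\tilde u\in L^2_{\mathrm{per}}(Y)$ of $-D^2:(\tilde A\tilde u)+\nabla\cdot(\tilde b\tilde u)=\nabla\cdot F$ in $Y$, $\tilde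 u$ $Y$-periodic, are understood in the very weak sense: $\int_Y\tilde u\,(\tilde A:D^2\varphi+\tilde b\cdot\nabla\varphi)=\int_Y F\cdot\nabla\varphi$ for all $\varphi\in H^2_{\mathrm{per}}(Y)$. Existence and uniqueness of $\tilde r$ (the case $F=0$ with unit mean) is established in the paper. *)

theory Defs
  imports "HOL-Analysis.Analysis"
begin

text \<open>
  Functions on \<open>\<real>\<^sup>n\<close> are represented by arbitrary representatives of their almost-everywhere
  classes: periodicity, symmetry, bounds and uniqueness are all understood up to Lebesgue null sets.
  For matrices of type \<open>real ^ 'n ^ 'n\<close> the library's \<open>norm\<close> is the Frobenius norm and the
  library's \<open>M \<bullet> N\<close> is the Frobenius product \<open>M : N\<close>.
\<close>

definition unit_cell :: "(real ^ 'n) set" where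
  "unit_cell = box 0 1"

definition Y_periodic :: "(real ^ 'n \<Rightarrow> 'b) \<Rightarrow> bool" where
  "Y_periodic f \<longleftrightarrow> (\<forall>k. AE x in lebesgue. f (x + axis k 1) = f x)"

definition cell_integral :: "(real ^ 'n \<Rightarrow> real) \<Rightarrow> real" where
  "cell_integral f = (LINT x:unit_cell|lebesgue. f x)"


subsection \<open>Test functions and weak derivatives\<close>

primrec C_k :: "nat \<Rightarrow> (real ^ 'n \<Rightarrow> real) \<Rightarrow> bool" where
  "C_k 0 f \<longleftrightarrow> continuous_on UNIV f"
| "C_k (Suc k) f \<longleftrightarrow>
     (\<forall>x. f differentiable (at x)) \<and>
     (\<forall>i. C_k k (\<lambda>x. frechet_derivative f (at x) (axis i 1)))"

definition test_function :: "(real ^ 'n \<Rightarrow> real) \<Rightarrow> bool" where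
  "test_function \<phi> \<longleftrightarrow> (\<forall>k. C_k k \<phi>) \<and> bounded {x. \<phi> x \<noteq> 0}"

definition locally_integrable :: "(real ^ 'n \<Rightarrow> real) \<Rightarrow> bool" where
  "locally_integrable f \<longleftrightarrow> (\<forall>K. compact K \<longrightarrow> set_integrable lebesgue K f)"

definition has_weak_partial ::
    "'n \<Rightarrow> (real ^ 'n \<Rightarrow> real) \<Rightarrow> (real ^ 'n \<Rightarrow> real) \<Rightarrow> bool" where
  "has_weak_partial i f g \<longleftrightarrow>
     locally_integrable f \<and> locally_integrable g \<and>
     (\<forall>\<phi>. test_function \<phi> \<longrightarrow>
        (LINT x|lebesgue. f x * frechet_derivative \<phi> (at x) (axis i 1))
          = - (LINT x|lebesgue. g x * \<phi> x))"

text \<open>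
  Weak derivatives are unique only up to null sets; the following picks a representative, and is
  unspecified if no weak derivative exists.
\<close>

definition weak_partial :: "'n \<Rightarrow> (real ^ 'n \<Rightarrow> real) \<Rightarrow> real ^ 'n \<Rightarrow> real" where
  "weak_partial i f = (SOME g. has_weak_partial i f g)"

definition weak_grad :: "(real ^ 'n \<Rightarrow> real) \<Rightarrow> real ^ 'n \<Rightarrow> real ^ 'n" where
  "weak_grad f x = (\<chi> i. weak_partial i f x)"

definition weak_hessian :: "(real ^ 'n \<Rightarrow> real) \<Rightarrow> real ^ 'n \<Rightarrow> real ^ 'n ^ 'n" where
  "weak_hessian f x = (\<chi> i j. weak_partial i (weak_partial j f) x)"

definition weak_jacobian :: "(real ^ 'n \<Rightarrow> real ^ 'n) \<Rightarrow> real ^ 'n \<Rightarrow> real ^ 'n ^ 'n" where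
  "weak_jacobian w x = (\<chi> i j. weak_partial j (\<lambda>y. w y $ i) x)"

definition weak_div :: "(real ^ 'n \<Rightarrow> real ^ 'n) \<Rightarrow> real ^ 'n \<Rightarrow> real" where
  "weak_div w x = (\<Sum>i\<in>UNIV. weak_partial i (\<lambda>y. w y $ i) x)"


subsection \<open>Periodic function spaces\<close>

definition Linf_per :: "(real ^ 'n \<Rightarrow> 'b::euclidean_space) set" where
  "Linf_per = {f. f \<in> borel_measurable lebesgue \<and> Y_periodic f \<and>
                  (\<exists>M. AE x in lebesgue. norm (f x) \<le> M)}"

definition L2_loc :: "(real ^ 'n \<Rightarrow> 'b::euclidean_space) set" where
  "L2_loc = {f. f \<in> borel_measurable lebesgue \<and>
                (\<forall>K. compact K \<longrightarrow> set_integrable lebesgue K (\<lambda>x. (norm (f x))\<^sup>2))}"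

definition L2_per :: "(real ^ 'n \<Rightarrow> 'b::euclidean_space) set" where
  "L2_per = {f \<in> L2_loc. Y_periodic f}"

primrec H_loc :: "nat \<Rightarrow> (real ^ 'n \<Rightarrow> real) set" where
  "H_loc 0 = L2_loc"
| "H_loc (Suc k) = {f \<in> L2_loc. \<forall>i. \<exists>g \<in> H_loc k. has_weak_partial i f g}"

definition H_per :: "nat \<Rightarrow> (real ^ 'n \<Rightarrow> real) set" where
  "H_per k = {f \<in> H_loc k. Y_periodic f}"

definition H1_per0_vec :: "(real ^ 'n \<Rightarrow> real ^ 'n) set" where
  "H1_per0_vec =
     {w. \<forall>i. (\<lambda>x. w x $ i) \<in> H_per 1 \<and> cell_integral (\<lambda>x. w x $ i) = 0}"


subsection \<open>Coefficients\<close>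

definition setting_B :: "(real ^ 'n \<Rightarrow> real ^ 'n ^ 'n) \<Rightarrow> (real ^ 'n \<Rightarrow> real ^ 'n) \<Rightarrow> bool" where
  "setting_B A b \<longleftrightarrow>
     A \<in> Linf_per \<and> (AE x in lebesgue. transpose (A x) = A x) \<and>
     b \<in> Linf_per \<and>
     (\<exists>l L. 0 < l \<and> 0 < L \<and>
        (AE x in lebesgue. \<forall>\<xi>. l * (\<xi> \<bullet> \<xi>) \<le> \<xi> \<bullet> (A x *v \<xi>) \<and>
                               \<xi> \<bullet> (A x *v \<xi>) \<le> L * (\<xi> \<bullet> \<xi>))) \<and>
     (\<exists>\<delta>. real CARD('n) / (real CARD('n) + pi\<^sup>2) < \<delta> \<and> \<delta> \<le> 1 \<and>
        (AE x in lebesgue. ((norm (A x))\<^sup>2 + (norm (b x))\<^sup>2) / (trace (A x))\<^sup>2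
                             \<le> 1 / (real CARD('n) - 1 + \<delta>)))"

definition gamma_fun ::
    "(real ^ 'n \<Rightarrow> real ^ 'n ^ 'n) \<Rightarrow> (real ^ 'n \<Rightarrow> real ^ 'n) \<Rightarrow> real ^ 'n \<Rightarrow> real" where
  "gamma_fun A b x = trace (A x) / ((norm (A x))\<^sup>2 + (norm (b x))\<^sup>2)"

definition A_tilde ::
    "(real ^ 'n \<Rightarrow> real ^ 'n ^ 'n) \<Rightarrow> (real ^ 'n \<Rightarrow> real ^ 'n) \<Rightarrow> real ^ 'n \<Rightarrow> real ^ 'n ^ 'n" where
  "A_tilde A b x = gamma_fun A b x *\<^sub>R A x"

definition b_tilde ::
    "(real ^ 'n \<Rightarrow> real ^ 'n ^ 'n) \<Rightarrow> (real ^ 'n \<Rightarrow> real ^ 'n) \<Rightarrow> real ^ 'n \<Rightarrow> real ^ 'n" where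
  "b_tilde A b x = gamma_fun A b x *\<^sub>R b x"


subsection \<open>The two problems\<close>

text \<open>
  Very weak periodic \<open>L\<^sup>2\<close> solutions of \<open>- D\<^sup>2 : (a u) + \<nabla> \<cdot> (\<beta> u) = \<nabla> \<cdot> F\<close>.
\<close>

definition very_weak_solution ::
    "(real ^ 'n \<Rightarrow> real ^ 'n ^ 'n) \<Rightarrow> (real ^ 'n \<Rightarrow> real ^ 'n) \<Rightarrow> (real ^ 'n \<Rightarrow> real ^ 'n) \<Rightarrow>
     (real ^ 'n \<Rightarrow> real) \<Rightarrow> bool" where
  "very_weak_solution a \<beta> F u \<longleftrightarrow>
     u \<in> L2_per \<and>
     (\<forall>\<phi> \<in> H_per 2.
        cell_integral (\<lambda>x. u x * (a x \<bullet> weak_hessian \<phi> x + \<beta> x \<bullet> weak_grad \<phi> x))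
          = cell_integral (\<lambda>x. F x \<bullet> weak_grad \<phi> x))"

definition B2 ::
    "(real ^ 'n \<Rightarrow> real ^ 'n ^ 'n) \<Rightarrow> (real ^ 'n \<Rightarrow> real ^ 'n) \<Rightarrow>
     (real ^ 'n \<Rightarrow> real ^ 'n) \<Rightarrow> (real ^ 'n \<Rightarrow> real ^ 'n) \<Rightarrow> real" where
  "B2 a \<beta> v w =
     cell_integral (\<lambda>x. weak_div v x * (a x \<bullet> weak_jacobian w x + \<beta> x \<bullet> w x))
     + 1/2 * cell_integral (\<lambda>x.
         (weak_jacobian v x - transpose (weak_jacobian v x))
           \<bullet> (weak_jacobian w x - transpose (weak_jacobian w x)))"

definition solves_B2 ::
    "(real ^ 'n \<Rightarrow> real ^ 'n ^ 'n) \<Rightarrow> (real ^ 'n \<Rightarrow> real ^ 'n) \<Rightarrow> (real ^ 'n \<Rightarrow> real ^ 'n) \<Rightarrow>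
     (real ^ 'n \<Rightarrow> real ^ 'n) \<Rightarrow> bool" where
  "solves_B2 a \<beta> F \<rho> \<longleftrightarrow>
     \<rho> \<in> H1_per0_vec \<and>
     (\<forall>w \<in> H1_per0_vec. B2 a \<beta> \<rho> w = - cell_integral (\<lambda>x. F x \<bullet> w x))"

end

theory Submission
  imports Defs
begin

text \<open>
  The Cordes condition makes \<open>w \<mapsto> A~ : Dw + b~ \<cdot> w\<close> a perturbation of the divergence. Since
  \<open>\<integral> \<partial>\<^sub>i w\<^sub>j \<partial>\<^sub>j w\<^sub>i = \<integral> \<partial>\<^sub>i w\<^sub>i \<partial>\<^sub>j w\<^sub>j\<close> for periodic fields, the curl term completes \<open>|div w|\<^sup>2\<close> to \<open>|Dw|\<^sup>2\<close>, and a
  Poincare inequality with constant \<open>5n/64 < n/\<pi>\<^sup>2\<close> turns \<open>B\<^sub>2\<close> into a coercive form, so (i) is Lax-Milgram. Testing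
  with gradients gives (ii). For uniqueness, an \<open>L\<^sup>2\<close> function of mean zero is approximated by Laplacians of smooth
  periodic \<open>q\<close>, and coercivity at \<open>\<nabla>q\<close> shows that a solution of the homogeneous problem vanishes; (iii) follows by
  linearity.

  Density of smooth functions, in \<open>L\<^sup>2\<close> and in the graph of the weak gradient, uses neither Fourier series nor
  approximate identities: if \<open>f\<close> is orthogonal to the double convolution \<open>(f * \<eta>) * \<eta>'\<close>, where \<open>\<eta>'\<close> is the
  reflection of the test function \<open>\<eta>\<close>, then \<open>f * \<eta> = 0\<close>. The Poincare inequality comes from averaging
  \<open>\<parallel>p(\<cdot> + t) - p\<parallel> \<le> |t| \<parallel>Dp\<parallel>\<close> over \<open>t\<close> in a cell centred at the origin.
\<close>

subsection \<open>Hilbert spaces\<close>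

text \<open>The condition delta > n/(n + pi^2) is the same as (1 - delta) (1 + n/pi^2) < 1, and this
  is what coercivity needs: gamma minimises |gamma A - I|^2 + |gamma b|^2 and leaves at most 1 -
  delta, while a Poincare constant n/pi^2 bounds |w|^2 + |Dw|^2 by (1 + n/pi^2) |Dw|^2 in the mean.
  The sharp constant on the torus is 1/(4 pi^2), so there is ample room for an elementary argument;
  all that is asked of pi is pi^2 < 64/5. The main obstacle is that the objects of the statement are
  functions up to null sets, with derivatives picked by choice. They are therefore replaced by
  points of a Hilbert space: \<open>'n l2\<close> is the quotient by null sets, and a field together
  with its Jacobian is a point of a product of copies of it. The Sobolev space becomes a closed
  subspace of such a product, identities for smooth functions extend by density, and
  \<open>represents\<close> leads back to the functions of the statement. Uniqueness does without
  solving the Poisson equation in \<open>H_per 2\<close>: Laplacians of smooth functions need only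
  be dense.\<close>

lemma riesz_on_closed_subspace:
  fixes S :: "'a::{real_inner,complete_space} set"
  assumes S: "subspace S" "closed S" and l: "bounded_linear l"
  shows "\<exists>r\<in>S. \<forall>v\<in>S. r \<bullet> v = l v"
proof -
  interpret l: bounded_linear l by fact
  obtain K where K: "\<And>v. norm (l v) \<le> norm v * K" using l.bounded by blast
  \<comment> \<open>The representing vector is the minimiser of this energy on \<open>S\<close>. The
    subspace is carried as a set because the later solution space is not a type of its own.\<close>
  define J where "J v = v \<bullet> v - 2 * l v" for v
  have lower: "- K\<^sup>2 \<le> J v" for v
  proof -
    have "l v \<le> norm v * K" using K[of v] by simp
    moreover have "0 \<le> (norm v - K)\<^sup>2" by simp
    ultimately show ?thesis
      by (simp add: J_def power2_eq_square dot_square_norm algebra_simps)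
  qed
  define m where "m = Inf (J ` S)"
  have S0: "0 \<in> S" using S subspace_0 by blast
  have bdd: "bdd_below (J ` S)" using lower by (meson bdd_belowI2)
  have m_le: "m \<le> J v" if "v \<in> S" for v
    unfolding m_def using bdd that by (simp add: cInf_lower)
  have "\<exists>v\<in>S. J v < m + 1 / real (Suc n)" for n
  proof -
    have "Inf (J ` S) < m + 1 / real (Suc n)" by (simp add: m_def)
    then show ?thesis using cInf_lessD[of "J ` S"] S0 by blast
  qed
  then obtain v where v: "\<And>n. v n \<in> S" "\<And>n. J (v n) < m + 1 / real (Suc n)" by metis
  \<comment> \<open>Parallelogram identity: the midpoint stays in \<open>S\<close>, so points of
    almost minimal energy are close to each other.\<close>
  have par: "(norm (x - y))\<^sup>2 \<le> 2 * (J x - m) + 2 * (J y - m)" if "x \<in> S" "y \<in> S" for x y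
  proof -
    have "(1/2) *\<^sub>R (x + y) \<in> S" using S that by (simp add: subspace_add subspace_scale)
    from m_le[OF this] have "4 * m \<le> 4 * J ((1/2) *\<^sub>R (x + y))" by simp
    moreover have "(norm (x - y))\<^sup>2 = 2 * J x + 2 * J y - 4 * J ((1/2) *\<^sub>R (x + y))"
      by (simp add: J_def power2_norm_eq_inner l.scaleR l.add algebra_simps inner_commute)
    ultimately show ?thesis by simp
  qed
  have "Cauchy v"
  proof (rule metric_CauchyI)
    fix e :: real assume e: "0 < e"
    obtain N where N: "4 / e\<^sup>2 < real N" using reals_Archimedean2 by blast
    have small: "2 * (J (v n) - m) < e\<^sup>2 / 2" if "n \<ge> N" for n
    proof -
      have "4 / e\<^sup>2 < real (Suc n)" using N that by simp
      then have "1 / real (Suc n) < e\<^sup>2 / 4" using e by (simp add: field_simps)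
      then show ?thesis using v(2)[of n] by simp
    qed
    show "\<exists>N. \<forall>m\<ge>N. \<forall>n\<ge>N. dist (v m) (v n) < e"
    proof (intro exI allI impI)
      fix k n assume "k \<ge> N" "n \<ge> N"
      then have "(norm (v k - v n))\<^sup>2 < e\<^sup>2"
        using par[OF v(1)[of k] v(1)[of n]] small[of k] small[of n] by simp
      then show "dist (v k) (v n) < e" using e by (simp add: dist_norm power_less_imp_less_base)
    qed
  qed
  then obtain r where r: "v \<longlonglongrightarrow> r" using Cauchy_convergent convergent_def by blast
  have rS: "r \<in> S" using S(2) r v(1) closed_sequentially by blast
  have "(\<lambda>n. J (v n)) \<longlonglongrightarrow> J r" unfolding J_def
    by (intro tendsto_intros r l.tendsto)
  moreover have "(\<lambda>n. m + 1 / real (Suc n)) \<longlonglongrightarrow> m"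
    using LIMSEQ_inverse_real_of_nat_add[of m] by (simp add: inverse_eq_divide)
  ultimately have "J r \<le> m"
    by (rule LIMSEQ_le) (use v(2) less_imp_le in blast)
  then have min: "J r \<le> J w" if "w \<in> S" for w using m_le[OF that] by simp
  have "r \<bullet> w = l w" if w: "w \<in> S" for w
  proof -
    define d where "d = r \<bullet> w - l w"
    \<comment> \<open>The exact minimiser along \<open>w\<close> would divide by
      \<open>w \<bullet> w\<close>; adding 1 keeps the quotient defined for \<open>w = 0\<close> and
      still lowers the energy by a multiple of the square of \<open>d\<close>.\<close>
    define t where "t = - d / (1 + w \<bullet> w)"
    have "J r \<le> J (r + t *\<^sub>R w)" using min rS w S by (simp add: subspace_add subspace_scale)
    then have "0 \<le> 2 * t * d + t * t * (w \<bullet> w)"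
      by (simp add: J_def d_def inner_add_left inner_add_right l.add l.scaleR inner_commute algebra_simps)
    also have "\<dots> \<le> 2 * t * d + t * t * (1 + w \<bullet> w)" by (simp add: mult_left_mono)
    also have "\<dots> = - (d\<^sup>2 / (1 + w \<bullet> w))"
    proof -
      have "2 * (- d / s) * d + (- d / s) * (- d / s) * s = - (d\<^sup>2 / s)" if "s \<noteq> 0" for s
        using that by (simp add: power2_eq_square)
      moreover have "1 + w \<bullet> w \<noteq> 0" using inner_ge_zero[of w] by linarith
      ultimately show ?thesis unfolding t_def by blast
    qed
    finally have "d\<^sup>2 / (1 + w \<bullet> w) \<le> 0" by simp
    moreover have "0 < 1 + w \<bullet> w" using inner_ge_zero[of w] by linarith
    ultimately have "d\<^sup>2 \<le> 0" by (simp add: divide_le_0_iff)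
    then show ?thesis by (simp add: d_def)
  qed
  then show ?thesis using rS by blast
qed

text \<open>Obtained by representing the functional \<open>v \<mapsto> z \<bullet> v\<close> on the
  closure of \<open>R\<close>. It serves density proofs: once the residual \<open>z - p\<close> is
  shown to vanish, \<open>z\<close> lies in the closure.\<close>

lemma orthogonal_projection_closure:
  fixes R :: "'a::{real_inner,complete_space} set"
  assumes "subspace R"
  obtains p where "p \<in> closure R" "\<And>r. r \<in> R \<Longrightarrow> (z - p) \<bullet> r = 0"
proof -
  have "subspace (closure R)"
  proof (rule subspaceI)
    show "0 \<in> closure R" using assms closure_subset subspace_0 by blast
    show "x + y \<in> closure R" if xy: "x \<in> closure R" "y \<in> closure R" for x y
    proof -
      obtain f g where "\<And>n. f n \<in> R" "f \<longlonglongrightarrow> x" "\<And>n. g n \<in> R" "g \<longlonglongrightarrow> y"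
        using xy unfolding closure_sequential by metis
      then show ?thesis unfolding closure_sequential
        using assms tendsto_add by (intro exI[of _ "\<lambda>n. f n + g n"]) (auto simp: subspace_add intro: tendsto_add)
    qed
    show "c *\<^sub>R x \<in> closure R" if x: "x \<in> closure R" for c x
    proof -
      obtain f where "\<And>n. f n \<in> R" "f \<longlonglongrightarrow> x"
        using x unfolding closure_sequential by metis
      then show ?thesis unfolding closure_sequential
        using assms by (intro exI[of _ "\<lambda>n. c *\<^sub>R f n"]) (auto simp: subspace_scale intro: tendsto_scaleR)
    qed
  qed
  moreover have "bounded_linear (\<lambda>v. z \<bullet> v)" by (rule bounded_linear_inner_right)
  ultimately obtain p where p: "p \<in> closure R" "\<forall>v\<in>closure R. p \<bullet> v = z \<bullet> v"
    using riesz_on_closed_subspace[of "closure R" "\<lambda>v. z \<bullet> v"] by auto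
  then have "(z - p) \<bullet> r = 0" if "r \<in> R" for r
    using that closure_subset[of R] by (auto simp: inner_diff_left)
  then show ?thesis using that p(1) by blast
qed

text \<open>\<open>B\<close> need not be symmetric, so no energy is minimised here. With
  \<open>T u\<close> the Riesz vector of \<open>B u\<close>, the equation reads
  \<open>T u = r\<close>, which is the fixed point equation of the contraction
  \<open>\<Phi>\<close>.\<close>

theorem lax_milgram:
  fixes S :: "'a::{real_inner,complete_space} set"
  assumes S: "subspace S" "closed S" and B: "bounded_bilinear B" and l: "bounded_linear l"
    and \<alpha>: "0 < \<alpha>" "\<And>v. v \<in> S \<Longrightarrow> \<alpha> * (v \<bullet> v) \<le> B v v"
  shows "\<exists>!u. u \<in> S \<and> (\<forall>v\<in>S. B u v = l v)"
proof -
  interpret B: bounded_bilinear B by fact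
  obtain K0 where K0: "0 < K0" "\<And>u v. norm (B u v) \<le> norm u * norm v * K0" using B.pos_bounded by blast
  \<comment> \<open>Enlarging the bound so that \<open>\<alpha> \<le> K\<close> makes
    \<open>q\<close> nonnegative, so that its square root can serve as contraction constant.\<close>
  define K where "K = K0 + \<alpha>"
  have "norm u * norm v * K0 \<le> norm u * norm v * K" for u v
    unfolding K_def using \<alpha>(1) by (intro mult_left_mono) auto
  then have K: "\<And>u v. norm (B u v) \<le> norm u * norm v * K"
    using order_trans[OF K0(2)] by blast
  have K1: "0 < K" "\<alpha> \<le> K" using K0(1) \<alpha>(1) by (auto simp: K_def)
  have "\<exists>T. T \<in> S \<and> (\<forall>v\<in>S. T \<bullet> v = B u v)" for u
    using riesz_on_closed_subspace[OF S B.bounded_linear_right[of u]] by blast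
  then obtain T where T: "\<And>u. T u \<in> S" "\<And>u v. v \<in> S \<Longrightarrow> T u \<bullet> v = B u v" by metis
  obtain r where r: "r \<in> S" "\<And>v. v \<in> S \<Longrightarrow> r \<bullet> v = l v"
    using riesz_on_closed_subspace[OF S l] by blast
  have diffS: "x - y \<in> S" if "x \<in> S" "y \<in> S" for x y using S that by (simp add: subspace_diff)
  have eqI: "x = y" if "x \<in> S" "y \<in> S" "\<And>v. v \<in> S \<Longrightarrow> x \<bullet> v = y \<bullet> v" for x y
    using that(3)[OF diffS[OF that(1,2)]] by (metis eq_iff_diff_eq_0 inner_diff_left inner_eq_zero_iff)
  have Tdiff: "T u - T w = T (u - w)" for u w
    by (rule eqI) (auto intro: T(1) diffS simp: T(2) inner_diff_left B.diff_left)
  have Tn: "norm (T u) \<le> K * norm u" for u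
  proof -
    have "norm (T u) * norm (T u) = B u (T u)" using T by (simp add: dot_square_norm[symmetric] power2_eq_square[symmetric])
    also have "\<dots> \<le> (K * norm u) * norm (T u)" using K[of u "T u"] by (simp add: algebra_simps)
    finally show ?thesis using K1(1)
      by (metis mult_le_cancel_right_pos mult_nonneg_nonneg norm_ge_zero less_eq_real_def norm_le_zero_iff)
  qed
  \<comment> \<open>The factor \<open>q\<close> is below 1 for every step size between 0 and
    \<open>2 * \<alpha> / K\<^sup>2\<close>; this one stays below half of that bound.\<close>
  define \<rho> where "\<rho> = \<alpha> / (K\<^sup>2 + \<alpha>\<^sup>2)"
  have pos: "0 < K\<^sup>2 + \<alpha>\<^sup>2" using K1 \<alpha> by (simp add: add_pos_pos)
  have \<rho>: "0 < \<rho>" using \<alpha> pos by (simp add: \<rho>_def)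
  define q where "q = 1 - 2 * \<rho> * \<alpha> + \<rho>\<^sup>2 * K\<^sup>2"
  have q1: "q < 1"
  proof -
    have "\<rho> * K\<^sup>2 < \<alpha> * 1" unfolding \<rho>_def using pos \<alpha> K1 by (simp add: field_simps)
    then have "\<rho> * (\<rho> * K\<^sup>2) < \<rho> * (2 * \<alpha>)" using \<rho> \<alpha> by (intro mult_strict_left_mono) auto
    then show ?thesis by (simp add: q_def power2_eq_square algebra_simps)
  qed
  have q0: "0 \<le> q"
  proof -
    have "q = (1 - \<rho> * \<alpha>)\<^sup>2 + \<rho>\<^sup>2 * (K\<^sup>2 - \<alpha>\<^sup>2)" by (simp add: q_def power2_eq_square algebra_simps)
    moreover have "\<alpha>\<^sup>2 \<le> K\<^sup>2" using \<alpha>(1) K1(2) by (simp add: power_mono)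
    ultimately show ?thesis by simp
  qed
  define \<Phi> where "\<Phi> u = u - \<rho> *\<^sub>R (T u - r)" for u
  have contr: "dist (\<Phi> u) (\<Phi> w) \<le> sqrt q * dist u w" if "u \<in> S" "w \<in> S" for u w
  proof -
    let ?d = "u - w"
    have dS: "?d \<in> S" using that diffS by blast
    have \<Phi>_diff: "\<Phi> u - \<Phi> w = ?d - \<rho> *\<^sub>R T ?d" by (simp add: \<Phi>_def Tdiff[symmetric] algebra_simps)
    have "(norm (\<Phi> u - \<Phi> w))\<^sup>2 = (norm ?d)\<^sup>2 - 2 * \<rho> * B ?d ?d + \<rho>\<^sup>2 * (norm (T ?d))\<^sup>2"
    proof -
      have "(norm (x - \<rho> *\<^sub>R y))\<^sup>2 = (norm x)\<^sup>2 - 2 * \<rho> * (y \<bullet> x) + \<rho>\<^sup>2 * (norm y)\<^sup>2" for x y :: 'a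
        unfolding power2_norm_eq_inner
        by (simp add: inner_diff_left inner_diff_right inner_commute power2_eq_square algebra_simps)
      from this[of ?d "T ?d"] show ?thesis
        using T(2)[OF dS, of ?d] \<Phi>_diff by simp
    qed
    also have "\<dots> \<le> (norm ?d)\<^sup>2 - 2 * \<rho> * (\<alpha> * (norm ?d)\<^sup>2) + \<rho>\<^sup>2 * (K * norm ?d)\<^sup>2"
      using \<alpha>(2)[OF dS] \<rho> Tn[of ?d]
      by (intro add_mono diff_mono mult_left_mono power_mono) (auto simp: dot_square_norm)
    also have "\<dots> = q * (norm ?d)\<^sup>2" by (simp add: q_def algebra_simps)
    also have "\<dots> = (sqrt q * norm ?d)\<^sup>2" using q0 by (simp add: power_mult_distrib)
    finally show ?thesis unfolding dist_norm
      by (rule power2_le_imp_le) (use q0 in auto)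
  qed
  have \<Phi>S: "\<Phi> ` S \<subseteq> S"
    unfolding \<Phi>_def using S T(1) r(1) by (auto intro!: subspace_diff subspace_scale)
  have "S \<noteq> {}" using S subspace_0 by blast
  then have "\<exists>!u\<in>S. \<Phi> u = u"
    using Banach_fix[of S "sqrt q" \<Phi>] q0 q1 \<Phi>S contr S(2) by (auto simp: complete_eq_closed)
  then obtain u where u: "u \<in> S" "\<Phi> u = u" by blast
  then have "T u = r" using \<rho> by (simp add: \<Phi>_def)
  then have ex: "u \<in> S \<and> (\<forall>v\<in>S. B u v = l v)" using u T(2) r(2) by metis
  moreover have "w = u" if "w \<in> S \<and> (\<forall>v\<in>S. B w v = l v)" for w
  proof -
    have "w - u \<in> S" using that u diffS by blast
    then have "B (w - u) (w - u) = 0" using that ex by (simp add: B.diff_left)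
    then have "\<alpha> * ((w - u) \<bullet> (w - u)) \<le> 0" using \<alpha>(2)[OF \<open>w - u \<in> S\<close>] by simp
    then show ?thesis using \<alpha>(1) inner_ge_zero[of "w - u"]
      by (simp add: mult_le_0_iff)
  qed
  ultimately show ?thesis by blast
qed

subsection \<open>Smooth functions\<close>

abbreviation pd :: "'n \<Rightarrow> (real ^ 'n \<Rightarrow> real) \<Rightarrow> real ^ 'n \<Rightarrow> real" where
  "pd i f \<equiv> \<lambda>x. frechet_derivative f (at x) (axis i 1)"

definition smooth :: "(real ^ 'n \<Rightarrow> real) \<Rightarrow> bool" where
  "smooth f \<longleftrightarrow> (\<forall>k. C_k k f)"

lemma pd_eqI: "(f has_derivative f') (at x) \<Longrightarrow> pd i f x = f' (axis i 1)"
  using frechet_derivative_at by metis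

lemma C_k_SucD: "C_k (Suc k) f \<Longrightarrow> C_k k f"
proof (induction k arbitrary: f)
  case 0
  then show ?case
    by (simp add: continuous_at_imp_continuous_on differentiable_imp_continuous_within)
next
  case (Suc k)
  have "C_k k (pd i f)" for i
    using Suc.prems Suc.IH[of "pd i f"] by (metis C_k.simps(2))
  then show ?case using Suc.prems by (metis C_k.simps(2))
qed

lemma smooth_differentiable: "smooth f \<Longrightarrow> f differentiable (at x)"
  unfolding smooth_def by (metis C_k.simps(2))

lemma smooth_continuous_on: "smooth f \<Longrightarrow> continuous_on S f"
  by (simp add: continuous_at_imp_continuous_on differentiable_imp_continuous_within
      smooth_differentiable)

lemma smooth_has_derivative: "smooth f \<Longrightarrow> (f has_derivative frechet_derivative f (at x)) (at x)"
  using frechet_derivative_works smooth_differentiable by blast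

lemma smooth_pd: "smooth f \<Longrightarrow> smooth (pd i f)"
  unfolding smooth_def by (metis C_k.simps(2))

text \<open>Replaces inductions over the order of differentiability: a smoothness proof exhibits a
  class, such as all affine substitutions or all convolutions with test functions, that
  \<open>pd\<close> does not leave.\<close>

lemma smooth_coinduct:
  assumes "P f" and "\<And>g x. P g \<Longrightarrow> g differentiable (at x)" and "\<And>g i. P g \<Longrightarrow> P (pd i g)"
  shows "smooth f"
proof -
  have "C_k k g" if "P g" for k g
    using that
  proof (induction k arbitrary: g)
    case 0
    then show ?case
      using assms(2) by (simp add: continuous_at_imp_continuous_on differentiable_imp_continuous_within)
  next
    case (Suc k)
    then show ?case using assms(2,3) by simp
  qed
  then show ?thesis using assms(1) by (simp add: smooth_def)
qed

lemma pd_linear_combination: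
  assumes "f differentiable (at x)" "g differentiable (at x)"
  shows "pd i (\<lambda>x. f x + c * g x) x = pd i f x + c * pd i g x"
proof -
  have "((\<lambda>x. f x + c * g x) has_derivative
      (\<lambda>h. frechet_derivative f (at x) h + c * frechet_derivative g (at x) h)) (at x)"
    by (intro derivative_intros has_derivative_mult_right)
       (use assms frechet_derivative_works in blast)+
  from pd_eqI[OF this] show ?thesis .
qed

lemma smooth_linear_combination:
  assumes "smooth f" "smooth g" shows "smooth (\<lambda>x. f x + c * g x)"
proof (rule smooth_coinduct[of "\<lambda>h. \<exists>f g. smooth f \<and> smooth g \<and> h = (\<lambda>x. f x + c * g x)"])
  show "\<exists>f' g'. smooth f' \<and> smooth g' \<and> (\<lambda>x. f x + c * g x) = (\<lambda>x. f' x + c * g' x)"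
    using assms by blast
next
  fix h x assume "\<exists>f g. smooth f \<and> smooth g \<and> h = (\<lambda>x. f x + c * g x)"
  then obtain f g where fg: "smooth f" "smooth g" and h: "h = (\<lambda>x. f x + c * g x)" by blast
  show "h differentiable (at x)" unfolding h
    by (intro differentiable_add differentiable_mult differentiable_const smooth_differentiable fg)
next
  fix h i assume "\<exists>f g. smooth f \<and> smooth g \<and> h = (\<lambda>x. f x + c * g x)"
  then obtain f g where fg: "smooth f" "smooth g" and h: "h = (\<lambda>x. f x + c * g x)" by blast
  have "pd i h = (\<lambda>x. pd i f x + c * pd i g x)"
    unfolding h using fg by (intro ext pd_linear_combination) (auto intro: smooth_differentiable)
  then show "\<exists>f g. smooth f \<and> smooth g \<and> pd i h = (\<lambda>x. f x + c * g x)"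
    using fg smooth_pd by blast
qed

lemma pd_const: "pd i (\<lambda>x. c) x = 0"
  by (simp add: frechet_derivative_const)

lemma smooth_const: "smooth (\<lambda>x. c)"
proof (rule smooth_coinduct[of "\<lambda>h. \<exists>c. h = (\<lambda>x. c)"])
  show "\<exists>c. pd i g = (\<lambda>x. c)" if "\<exists>c. g = (\<lambda>x. c)" for g :: "real ^ 'n \<Rightarrow> real" and i
  proof -
    obtain c where "g = (\<lambda>x. c)" using \<open>\<exists>c. g = (\<lambda>x. c)\<close> by blast
    then have "pd i g = (\<lambda>x. 0)" using pd_const by blast
    then show ?thesis by blast
  qed
qed auto

lemma smooth_add: "smooth f \<Longrightarrow> smooth g \<Longrightarrow> smooth (\<lambda>x. f x + g x)"
  using smooth_linear_combination[of f g 1] by simp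

lemma smooth_cmult: "smooth f \<Longrightarrow> smooth (\<lambda>x. c * f x)"
  using smooth_linear_combination[OF smooth_const[of 0], of f c] by simp

lemma smooth_sum: "(\<And>i. i \<in> I \<Longrightarrow> smooth (f i)) \<Longrightarrow> smooth (\<lambda>x. \<Sum>i\<in>I. f i x)"
  by (induction I rule: infinite_finite_induct) (auto intro: smooth_const smooth_add)

lemma pd_affine:
  assumes "f differentiable (at (a + s *\<^sub>R x))"
  shows "pd i (\<lambda>x. f (a + s *\<^sub>R x)) x = s * pd i f (a + s *\<^sub>R x)"
proof -
  let ?D = "frechet_derivative f (at (a + s *\<^sub>R x))"
  have D: "(f has_derivative ?D) (at (a + s *\<^sub>R x))" using assms frechet_derivative_works by blast
  have "((\<lambda>x. a + s *\<^sub>R x) has_derivative (\<lambda>h. s *\<^sub>R h)) (at x)"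
    by (auto intro!: derivative_eq_intros)
  from has_derivative_compose[OF this D]
  have "((\<lambda>x. f (a + s *\<^sub>R x)) has_derivative (\<lambda>h. ?D (s *\<^sub>R h))) (at x)" .
  from pd_eqI[OF this, of i] show ?thesis
    using D by (simp add: has_derivative_linear linear_cmul)
qed

lemma smooth_affine:
  assumes "smooth f" shows "smooth (\<lambda>x. f (a + s *\<^sub>R x))"
proof (rule smooth_coinduct[of "\<lambda>h. \<exists>f. smooth f \<and> h = (\<lambda>x. f (a + s *\<^sub>R x))"])
  show "\<exists>f'. smooth f' \<and> (\<lambda>x. f (a + s *\<^sub>R x)) = (\<lambda>x. f' (a + s *\<^sub>R x))"
    using assms by blast
next
  fix h x assume "\<exists>f. smooth f \<and> h = (\<lambda>x. f (a + s *\<^sub>R x))"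
  then obtain f where f: "smooth f" and h: "h = (\<lambda>x. f (a + s *\<^sub>R x))" by blast
  have "(\<lambda>x. a + s *\<^sub>R x) differentiable (at x)"
    by (intro differentiable_add differentiable_scaleR) auto
  from differentiable_compose[OF smooth_differentiable[OF f] this]
  show "h differentiable (at x)" unfolding h .
next
  fix h i assume "\<exists>f. smooth f \<and> h = (\<lambda>x. f (a + s *\<^sub>R x))"
  then obtain f where f: "smooth f" and h: "h = (\<lambda>x. f (a + s *\<^sub>R x))" by blast
  have "pd i h = (\<lambda>x. s * pd i f (a + s *\<^sub>R x))"
    unfolding h using f by (intro ext pd_affine) (auto intro: smooth_differentiable)
  then show "\<exists>f. smooth f \<and> pd i h = (\<lambda>x. f (a + s *\<^sub>R x))"
    by (intro exI[of _ "\<lambda>x. s * pd i f x"] conjI smooth_cmult smooth_pd f)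
qed

lemma pd_mult:
  assumes "f differentiable (at x)" "g differentiable (at x)"
  shows "pd i (\<lambda>x. f x * g x) x = f x * pd i g x + pd i f x * g x"
proof -
  have "((\<lambda>x. f x * g x) has_derivative
      (\<lambda>h. f x * frechet_derivative g (at x) h + frechet_derivative f (at x) h * g x)) (at x)"
    by (intro has_derivative_mult) (use assms frechet_derivative_works in blast)+
  from pd_eqI[OF this] show ?thesis .
qed

lemma C_k_add: "C_k k f \<Longrightarrow> C_k k g \<Longrightarrow> C_k k (\<lambda>x. f x + g x)"
proof (induction k arbitrary: f g)
  case 0
  then show ?case by (auto intro: continuous_on_add)
next
  case (Suc k)
  have "pd i (\<lambda>x. f x + g x) = (\<lambda>x. pd i f x + pd i g x)" for i
    using Suc.prems by (intro ext pd_linear_combination[where c = 1, simplified]) auto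
  then show ?case using Suc by (auto intro: differentiable_add)
qed

text \<open>\<open>pd\<close> leads from a product to a sum of products, so the class of products is
  not stable under it and coinduction does not apply directly. The induction over the order absorbs
  the sum by \<open>C_k_add\<close>.\<close>

lemma C_k_mult: "C_k k f \<Longrightarrow> C_k k g \<Longrightarrow> C_k k (\<lambda>x. f x * g x)"
proof (induction k arbitrary: f g)
  case 0
  then show ?case by (auto intro: continuous_on_mult)
next
  case (Suc k)
  have "pd i (\<lambda>x. f x * g x) = (\<lambda>x. f x * pd i g x + pd i f x * g x)" for i
    using Suc.prems by (intro ext pd_mult) auto
  then show ?case
    using Suc.prems Suc.IH C_k_SucD[OF Suc.prems(1)] C_k_SucD[OF Suc.prems(2)]
    by (auto intro!: differentiable_mult C_k_add)
qed

lemma smooth_mult: "smooth f \<Longrightarrow> smooth g \<Longrightarrow> smooth (\<lambda>x. f x * g x)"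
  by (simp add: smooth_def C_k_mult)

lemma smooth_prod: "(\<And>i. i \<in> I \<Longrightarrow> smooth (f i)) \<Longrightarrow> smooth (\<lambda>x. \<Prod>i\<in>I. f i x)"
  by (induction I rule: infinite_finite_induct) (auto intro: smooth_const smooth_mult)

subsection \<open>Test functions\<close>

text \<open>The classical function \<open>exp (- 1 / t)\<close>, with a polynomial in
  \<open>1 / t\<close> in front so that the family is closed under differentiation.\<close>

definition flat_exp :: "real poly \<Rightarrow> real \<Rightarrow> real" where
  "flat_exp p t = (if t > 0 then poly p (1 / t) * exp (- (1 / t)) else 0)"

lemma flat_exp_tendsto_0: "(flat_exp p \<longlongrightarrow> 0) (at 0)"
proof -
  have "((\<lambda>s. poly p s / exp s) \<longlongrightarrow> 0) at_top"
  proof -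
    have "((\<lambda>s. \<Sum>i\<le>degree p. coeff p i * (s ^ i / exp s)) \<longlongrightarrow> (\<Sum>i\<le>degree p. coeff p i * 0)) at_top"
      by (intro tendsto_intros tendsto_power_div_exp_0)
    then show ?thesis by (simp add: poly_altdef sum_divide_distrib)
  qed
  then have "((\<lambda>t. poly p (inverse t) / exp (inverse t)) \<longlongrightarrow> 0) (at_right 0)"
    using filterlim_inverse_at_top_right filterlim_compose by blast
  then have "(flat_exp p \<longlongrightarrow> 0) (at_right 0)"
    by (rule Lim_transform_eventually)
       (auto simp: flat_exp_def exp_minus divide_simps eventually_at_filter)
  moreover have "(flat_exp p \<longlongrightarrow> 0) (at_left 0)"
    by (rule tendsto_eventually) (auto simp: flat_exp_def eventually_at_filter)
  ultimately show ?thesis by (simp add: filterlim_at_split)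
qed

text \<open>With s = 1/t, differentiation in t is -s^2 times differentiation in s, which produces
  the new polynomial. At 0 the difference quotient is itself a \<open>flat_exp\<close> and tends to
  0.\<close>

lemma flat_exp_has_derivative:
  "(flat_exp p has_real_derivative flat_exp ([:0, 0, 1:] * (p - pderiv p)) t) (at t)"
proof -
  consider "t > 0" | "t < 0" | "t = 0" by linarith
  then show ?thesis
  proof cases
    case 1
    have "((\<lambda>t. poly p (1 / t) * exp (- (1 / t))) has_real_derivative
        flat_exp ([:0, 0, 1:] * (p - pderiv p)) t) (at t)"
      unfolding flat_exp_def using 1
      by (auto intro!: derivative_eq_intros simp: field_simps power2_eq_square)
    then show ?thesis
      by (rule has_field_derivative_transform_within_open[of _ _ _ "{0<..}"])
         (use 1 in \<open>auto simp: flat_exp_def\<close>)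
  next
    case 2
    have "((\<lambda>t. 0) has_real_derivative 0) (at t)" by simp
    then have "(flat_exp p has_real_derivative 0) (at t)"
      by (rule has_field_derivative_transform_within_open[of _ _ _ "{..<0}"])
         (use 2 in \<open>auto simp: flat_exp_def\<close>)
    then show ?thesis using 2 by (simp add: flat_exp_def)
  next
    case 3
    have "(\<lambda>h. (flat_exp p (0 + h) - flat_exp p 0) / h) = flat_exp ([:0, 1:] * p)"
      by (auto simp: flat_exp_def fun_eq_iff)
    then show ?thesis using flat_exp_tendsto_0[of "[:0, 1:] * p"] 3
      by (simp add: DERIV_def flat_exp_def)
  qed
qed

lemma smooth_flat_exp: "smooth (\<lambda>x :: real ^ 'n. flat_exp p (c * x $ i + d))"
proof -
  let ?P = "\<lambda>h. \<exists>k p. h = (\<lambda>x :: real ^ 'n. k * flat_exp p (c * x $ i + d))"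
  have der: "((\<lambda>x. k * flat_exp p (c * x $ i + d)) has_derivative
      (\<lambda>h. k * (flat_exp ([:0, 0, 1:] * (p - pderiv p)) (c * x $ i + d) * (c * h $ i)))) (at x)"
    for k p and x :: "real ^ 'n"
  proof -
    have "((\<lambda>x. c * x $ i + d) has_derivative (\<lambda>h. c * h $ i)) (at x)"
      by (auto intro!: derivative_eq_intros bounded_linear_imp_has_derivative bounded_linear_vec_nth)
    from has_derivative_compose[OF this flat_exp_has_derivative[unfolded has_field_derivative_def]]
    show ?thesis by (rule has_derivative_mult_right)
  qed
  show ?thesis
  proof (rule smooth_coinduct[of ?P])
    show "?P (\<lambda>x. flat_exp p (c * x $ i + d))" by (intro exI[of _ 1] exI[of _ p]) simp
  next
    fix g x assume "?P g"
    then show "g differentiable (at x)" using der unfolding differentiable_def by blast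
  next
    fix g j assume "?P g"
    then obtain k p where g: "g = (\<lambda>x. k * flat_exp p (c * x $ i + d))" by blast
    have "pd j g = (\<lambda>x. (k * c * axis j 1 $ i) * flat_exp ([:0, 0, 1:] * (p - pderiv p)) (c * x $ i + d))"
      unfolding g using pd_eqI[OF der] by (auto simp: fun_eq_iff)
    then show "?P (pd j g)" by blast
  qed
qed

lemma test_functionD:
  assumes "test_function \<phi>"
  shows "smooth \<phi>" "bounded {x. \<phi> x \<noteq> 0}"
  using assms by (auto simp: test_function_def smooth_def)

lemma test_function_affine:
  assumes "test_function \<phi>" "s \<noteq> 0"
  shows "test_function (\<lambda>x. \<phi> (a + s *\<^sub>R x))"
proof -
  obtain M where M: "\<And>x. \<phi> x \<noteq> 0 \<Longrightarrow> norm x \<le> M"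
    using test_functionD(2)[OF assms(1)] by (auto simp: bounded_iff)
  have "norm x \<le> (M + norm a) / \<bar>s\<bar>" if "\<phi> (a + s *\<^sub>R x) \<noteq> 0" for x
  proof -
    have "norm (s *\<^sub>R x) \<le> norm (a + s *\<^sub>R x) + norm a"
      by (metis add.commute add_diff_cancel_left' norm_triangle_ineq4)
    then have "\<bar>s\<bar> * norm x \<le> M + norm a" using M[OF that] by simp
    then show ?thesis using assms(2) by (simp add: field_simps)
  qed
  then have "bounded {x. \<phi> (a + s *\<^sub>R x) \<noteq> 0}" by (auto simp: bounded_iff)
  then show ?thesis
    using smooth_affine[OF test_functionD(1)[OF assms(1)]] by (simp add: test_function_def smooth_def)
qed

lemma pd_eq_0_outside_closure:
  assumes "x \<notin> closure {x. f x \<noteq> 0}" shows "pd i f x = 0"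
proof -
  have "((\<lambda>x. 0::real) has_derivative (\<lambda>h. 0)) (at x)" by simp
  then have "(f has_derivative (\<lambda>h. 0)) (at x)"
    by (rule has_derivative_transform_within_open[of _ _ _ _ "- closure {x. f x \<noteq> 0}"])
       (use assms closure_subset[of "{x. f x \<noteq> 0}"] in auto)
  then show ?thesis by (rule pd_eqI)
qed

lemma test_function_pd:
  assumes "test_function \<phi>" shows "test_function (pd i \<phi>)"
proof -
  have "{x. pd i \<phi> x \<noteq> 0} \<subseteq> closure {x. \<phi> x \<noteq> 0}" using pd_eq_0_outside_closure by blast
  then have "bounded {x. pd i \<phi> x \<noteq> 0}"
    using test_functionD(2)[OF assms] by (meson bounded_closure bounded_subset)
  then show ?thesis using smooth_pd[OF test_functionD(1)[OF assms]]
    by (simp add: test_function_def smooth_def)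
qed

text \<open>\<open>flat_exp 1\<close> at n t tends to 1 for t > 0 and is 0 for t \<le> 0, so these
  test functions converge boundedly to the indicator of the box.\<close>

definition box_bump :: "real ^ 'n \<Rightarrow> real ^ 'n \<Rightarrow> nat \<Rightarrow> real ^ 'n \<Rightarrow> real" where
  "box_bump a b n x = (\<Prod>i\<in>UNIV. flat_exp 1 (real n * (x $ i - a $ i)) * flat_exp 1 (real n * (b $ i - x $ i)))"

lemma flat_exp_1_bounds: "0 \<le> flat_exp 1 t" "flat_exp 1 t \<le> 1"
  by (auto simp: flat_exp_def)

lemma box_bump_bounds: "0 \<le> box_bump a b n x" "box_bump a b n x \<le> 1"
  unfolding box_bump_def
  by (auto intro!: prod_nonneg prod_le_1 mult_le_one simp: flat_exp_1_bounds)

lemma box_bump_eq_0: "x \<notin> box a b \<Longrightarrow> box_bump a b n x = 0"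
proof -
  assume "x \<notin> box a b"
  then obtain i where "\<not> (a $ i < x $ i \<and> x $ i < b $ i)" by (auto simp: mem_box_cart)
  then have "flat_exp 1 (real n * (x $ i - a $ i)) * flat_exp 1 (real n * (b $ i - x $ i)) = 0"
    by (auto simp: flat_exp_def zero_less_mult_iff)
  then show ?thesis unfolding box_bump_def by (meson UNIV_I finite prod_zero)
qed

lemma test_function_box_bump: "test_function (box_bump a b n)"
proof -
  have "smooth (\<lambda>x. flat_exp 1 (real n * (x $ i - a $ i)) * flat_exp 1 (real n * (b $ i - x $ i)))" for i
    using smooth_mult[OF smooth_flat_exp[of 1 "real n" i "- real n * a $ i"]
        smooth_flat_exp[of 1 "- real n" i "real n * b $ i"]]
    by (simp add: algebra_simps)
  then have "smooth (box_bump a b n)" unfolding box_bump_def by (intro smooth_prod)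
  moreover have "bounded {x. box_bump a b n x \<noteq> 0}"
    using box_bump_eq_0 by (intro bounded_subset[OF bounded_box[of a b]]) blast
  ultimately show ?thesis by (simp add: test_function_def smooth_def)
qed

lemma box_bump_tendsto: "(\<lambda>n. box_bump a b n x) \<longlonglongrightarrow> indicator (box a b) x"
proof (cases "x \<in> box a b")
  case True
  have lim: "(\<lambda>n. flat_exp 1 (real n * t)) \<longlonglongrightarrow> 1" if "t > 0" for t
  proof -
    have "(\<lambda>n. exp (- (1 / t) * inverse (real n))) \<longlonglongrightarrow> exp (- (1 / t) * 0)"
      by (intro tendsto_intros lim_inverse_n)
    moreover have "\<forall>\<^sub>F n in sequentially. exp (- (1 / t) * inverse (real n)) = flat_exp 1 (real n * t)"
      by (rule eventually_sequentiallyI[of 1])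
         (use that in \<open>auto simp: flat_exp_def zero_less_mult_iff divide_inverse\<close>)
    ultimately show ?thesis using Lim_transform_eventually by fastforce
  qed
  have "(\<lambda>n. box_bump a b n x) \<longlonglongrightarrow> (\<Prod>i\<in>(UNIV :: 'a set). 1 * 1)"
    unfolding box_bump_def by (intro tendsto_prod tendsto_mult lim) (use True in \<open>auto simp: mem_box_cart\<close>)
  then show ?thesis using True by simp
qed (simp add: box_bump_eq_0)

subsection \<open>Periodic functions and cells\<close>

lemma AE_lborel_translate: "AE x in lborel. P x \<Longrightarrow> AE x in lborel. P (a + x :: 'a :: euclidean_space)"
proof -
  assume "AE x in lborel. P x"
  then have "AE x in distr lborel borel ((+) a). P x" unfolding lborel_distr_plus .
  from AE_distrD[OF _ this] show ?thesis by simp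
qed

lemma nn_integral_lborel_translate:
  fixes h :: "'a :: euclidean_space \<Rightarrow> ennreal"
  assumes [measurable]: "h \<in> borel_measurable borel"
  shows "(\<integral>\<^sup>+x. h (a + x) \<partial>lborel) = (\<integral>\<^sup>+x. h x \<partial>lborel)"
proof -
  have "(\<integral>\<^sup>+x. h x \<partial>distr lborel borel ((+) a)) = (\<integral>\<^sup>+x. h (a + x) \<partial>lborel)"
    by (rule nn_integral_distr) auto
  then show ?thesis by (simp add: lborel_distr_plus)
qed

lemma integral_lborel_translate:
  fixes h :: "'a :: euclidean_space \<Rightarrow> real"
  assumes [measurable]: "h \<in> borel_measurable borel"
  shows "(LINT x|lborel. h (a + x)) = (LINT x|lborel. h x)"
proof -
  have "(LINT x|distr lborel borel ((+) a). h x) = (LINT x|lborel. h (a + x))"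
    by (rule integral_distr) auto
  then show ?thesis by (simp add: lborel_distr_plus)
qed

lemma lborel_distr_reflect: "distr lborel borel (\<lambda>x. a - x) = (lborel :: 'a :: euclidean_space measure)"
  using lborel_affine[of "-1" a] by (simp add: density_1)

lemma integral_lborel_reflect:
  fixes h :: "'a :: euclidean_space \<Rightarrow> real"
  assumes [measurable]: "h \<in> borel_measurable borel"
  shows "(LINT x|lborel. h (a - x)) = (LINT x|lborel. h x)"
proof -
  have "(LINT x|distr lborel borel (\<lambda>x. a - x). h x) = (LINT x|lborel. h (a - x))"
    by (rule integral_distr) auto
  then show ?thesis by (simp add: lborel_distr_reflect)
qed

lemma AE_lborel_coordinate_neq: "AE x in lborel. (x :: real ^ 'n) $ k \<noteq> s"
proof -
  have "{x :: real ^ 'n. x $ k = s} \<in> null_sets lebesgue"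
    using negligible_standard_hyperplane[of "axis k 1 :: real ^ 'n" s]
    by (auto simp: negligible_iff_null_sets cart_eq_inner_axis Basis_vec_def)
  from AE_not_in[OF this] show ?thesis by (simp add: AE_completion_iff)
qed

definition periodic :: "(real ^ 'n \<Rightarrow> 'b) \<Rightarrow> bool" where
  "periodic f \<longleftrightarrow> (\<forall>k. AE x in lborel. f (x + axis k 1) = f x)"

lemma Y_periodic_iff: "Y_periodic f \<longleftrightarrow> periodic f"
  by (simp add: Y_periodic_def periodic_def AE_completion_iff)

lemma periodic_compose: "periodic f \<Longrightarrow> periodic (\<lambda>x. g (f x))"
  using eventually_mono[of "\<lambda>x. f (x + axis k 1) = f x" "ae_filter lborel" "\<lambda>x. g (f (x + axis k 1)) = g (f x)" for k]
  by (simp add: periodic_def)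

lemma periodic_compose2: "periodic f \<Longrightarrow> periodic g \<Longrightarrow> periodic (\<lambda>x. h (f x) (g x))"
  unfolding periodic_def
proof
  fix k assume "\<forall>k. AE x in lborel. f (x + axis k 1) = f x" "\<forall>k. AE x in lborel. g (x + axis k 1) = g x"
  then have "AE x in lborel. f (x + axis k 1) = f x" "AE x in lborel. g (x + axis k 1) = g x" by auto
  then show "AE x in lborel. h (f (x + axis k 1)) (g (x + axis k 1)) = h (f x) (g x)"
    by eventually_elim simp
qed

lemma periodic_translate:
  assumes "periodic f" shows "periodic (\<lambda>x. f (a + x))"
  using assms AE_lborel_translate[of "\<lambda>x. f (x + axis k 1) = f x" a for k]
  by (auto simp: periodic_def add.assoc)

lemma periodic_AE_cong:
  assumes "periodic f" and fg: "AE x in lborel. f x = g x" shows "periodic g"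
  unfolding periodic_def
proof
  fix k
  have "AE x in lborel. f (x + axis k 1) = f x" using assms by (simp add: periodic_def)
  moreover have "AE x in lborel. f (x + axis k 1) = g (x + axis k 1)"
    using AE_lborel_translate[OF fg, of "axis k 1"] by (simp add: add.commute)
  ultimately show "AE x in lborel. g (x + axis k 1) = g x"
    using fg by eventually_elim simp
qed

section \<open>Invariance of cell integrals under translation\<close>

definition cell :: "real ^ 'n \<Rightarrow> (real ^ 'n) set" where
  "cell c = box c (c + 1)"

lemma unit_cell_eq_cell: "unit_cell = cell 0"
  by (simp add: unit_cell_def cell_def)

lemma mem_cell: "x \<in> cell c \<longleftrightarrow> (\<forall>i. c $ i < x $ i \<and> x $ i < c $ i + 1)"
  by (simp add: cell_def mem_box_cart)

lemma cell_borel [measurable]: "cell c \<in> sets borel"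
  by (simp add: cell_def)

lemma emeasure_cell: "emeasure lborel (cell c) = 1"
proof -
  have "emeasure lborel (cell c) = (\<Prod>b\<in>Basis. (c + 1 - c) \<bullet> b)"
    unfolding cell_def
    by (rule emeasure_lborel_box) (auto simp: Basis_vec_def inner_axis)
  also have "(\<Prod>b\<in>Basis. (c + 1 - c) \<bullet> b) = 1"
    by (intro prod.neutral) (auto simp: Basis_vec_def inner_axis)
  finally show ?thesis by simp
qed

text \<open>Cut \<open>cell c\<close> by a hyperplane orthogonal to the k-th axis. Moving the lower
  slab \<open>L\<close> up by one period turns the cell into the shifted one, up to null sets, and
  periodicity makes the integral over the moved slab equal to that over \<open>L\<close>.\<close>

lemma nn_integral_cell_shift_aux:
  fixes h :: "real ^ 'n \<Rightarrow> ennreal"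
  assumes [measurable]: "h \<in> borel_measurable borel" and per: "periodic h" and t: "0 \<le> t" "t \<le> 1"
  shows "(\<integral>\<^sup>+x\<in>cell (c + t *\<^sub>R axis k 1). h x \<partial>lborel) = (\<integral>\<^sup>+x\<in>cell c. h x \<partial>lborel)"
proof -
  define L where "L = {x \<in> cell c. x $ k < c $ k + t}"
  define R where "R = {x \<in> cell c. c $ k + t < x $ k}"
  have cm: "(\<lambda>x :: real ^ 'n. x $ k) \<in> borel_measurable borel"
    by (intro borel_measurable_continuous_onI continuous_intros)
  have [measurable]: "L \<in> sets borel" "R \<in> sets borel"
    unfolding L_def R_def using cm by measurable
  let ?e = "axis k 1 :: real ^ 'n"
  let ?L' = "\<lambda>x. indicator L (- ?e + x) :: ennreal"
  have cell0: "AE x in lborel. indicator (cell c) x = indicator L x + (indicator R x :: ennreal)"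
    using AE_lborel_coordinate_neq[of k "c $ k + t"]
    by eventually_elim (auto simp: L_def R_def indicator_def)
  have cell1: "AE x in lborel. indicator (cell (c + t *\<^sub>R ?e)) x = indicator R x + ?L' x"
    using AE_lborel_coordinate_neq[of k "c $ k + 1"]
  proof eventually_elim
    fix x :: "real ^ 'n" assume x: "x $ k \<noteq> c $ k + 1"
    define Q where "Q = (\<forall>i. i \<noteq> k \<longrightarrow> c $ i < x $ i \<and> x $ i < c $ i + 1)"
    have split: "y \<in> cell d \<longleftrightarrow> (d $ k < y $ k \<and> y $ k < d $ k + 1) \<and>
        (\<forall>i. i \<noteq> k \<longrightarrow> d $ i < y $ i \<and> y $ i < d $ i + 1)" for y d :: "real ^ 'n"
      unfolding mem_cell by metis
    have 1: "x \<in> cell (c + t *\<^sub>R ?e) \<longleftrightarrow> Q \<and> c $ k + t < x $ k \<and> x $ k < c $ k + t + 1"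
      unfolding split Q_def by (auto simp: axis_def)
    have 2: "x \<in> R \<longleftrightarrow> Q \<and> c $ k + t < x $ k \<and> x $ k < c $ k + 1"
      unfolding R_def mem_Collect_eq split Q_def using t by auto
    have 3: "- ?e + x \<in> L \<longleftrightarrow> Q \<and> c $ k + 1 < x $ k \<and> x $ k < c $ k + t + 1"
      unfolding L_def mem_Collect_eq split Q_def using t by (auto simp: axis_def)
    show "indicator (cell (c + t *\<^sub>R ?e)) x = indicator R x + ?L' x"
      using x t unfolding indicator_def 1 2 3 by auto
  qed
  have "(\<integral>\<^sup>+x\<in>cell (c + t *\<^sub>R ?e). h x \<partial>lborel) = (\<integral>\<^sup>+x. h x * indicator R x + h x * ?L' x \<partial>lborel)"
  proof (rule nn_integral_cong_AE)
    show "AE x in lborel. h x * indicator (cell (c + t *\<^sub>R ?e)) x = h x * indicator R x + h x * ?L' x"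
      using cell1 by eventually_elim (simp add: distrib_left)
  qed
  also have "\<dots> = (\<integral>\<^sup>+x. h x * indicator R x \<partial>lborel) + (\<integral>\<^sup>+x. h x * ?L' x \<partial>lborel)"
    by (rule nn_integral_add) auto
  also have "(\<integral>\<^sup>+x. h x * ?L' x \<partial>lborel) = (\<integral>\<^sup>+x. h (?e + x) * indicator L x \<partial>lborel)"
    using nn_integral_lborel_translate[of "\<lambda>x. h x * ?L' x" ?e] by simp
  also have "\<dots> = (\<integral>\<^sup>+x. h x * indicator L x \<partial>lborel)"
  proof (rule nn_integral_cong_AE)
    have "AE x in lborel. h (x + ?e) = h x" using per by (simp add: periodic_def)
    then show "AE x in lborel. h (?e + x) * indicator L x = h x * indicator L x"
      by eventually_elim (simp add: add.commute)
  qed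
  also have "(\<integral>\<^sup>+x. h x * indicator R x \<partial>lborel) + (\<integral>\<^sup>+x. h x * indicator L x \<partial>lborel)
      = (\<integral>\<^sup>+x. h x * indicator R x + h x * indicator L x \<partial>lborel)"
    by (rule nn_integral_add[symmetric]) auto
  also have "\<dots> = (\<integral>\<^sup>+x\<in>cell c. h x \<partial>lborel)"
  proof (rule nn_integral_cong_AE)
    show "AE x in lborel. h x * indicator R x + h x * indicator L x = h x * indicator (cell c) x"
      using cell0 by eventually_elim (simp add: distrib_left add.commute)
  qed
  finally show ?thesis .
qed

text \<open>Any translation is a sum of translations along the axes, each divided into steps of
  length at most 1, to which the cutting argument applies.\<close>

lemma nn_integral_cell_shift:
  fixes h :: "real ^ 'n \<Rightarrow> ennreal"
  assumes h: "h \<in> borel_measurable borel" "periodic h"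
  shows "(\<integral>\<^sup>+x\<in>cell (c + a). h x \<partial>lborel) = (\<integral>\<^sup>+x\<in>cell c. h x \<partial>lborel)"
proof -
  define \<Phi> where "\<Phi> c = (\<integral>\<^sup>+x\<in>cell c. h x \<partial>lborel)" for c
  have small: "\<Phi> (c + t *\<^sub>R axis k 1) = \<Phi> c" if "\<bar>t\<bar> \<le> 1" for c t k
  proof (cases "t \<ge> 0")
    case True
    then show ?thesis unfolding \<Phi>_def using that by (intro nn_integral_cell_shift_aux h) auto
  next
    case False
    have "\<Phi> ((c + t *\<^sub>R axis k 1) + (- t) *\<^sub>R axis k 1) = \<Phi> (c + t *\<^sub>R axis k 1)"
      unfolding \<Phi>_def using False that by (intro nn_integral_cell_shift_aux h) auto
    then show ?thesis by simp
  qed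
  have step: "\<Phi> (c + (real m * s) *\<^sub>R axis k 1) = \<Phi> c" if "\<bar>s\<bar> \<le> 1" for c s k m
  proof (induction m)
    case (Suc m)
    then show ?case using small[OF that, of "c + (real m * s) *\<^sub>R axis k 1" k]
      by (simp add: algebra_simps)
  qed simp
  have coord: "\<Phi> (c + t *\<^sub>R axis k 1) = \<Phi> c" for c t k
  proof -
    obtain m where m: "\<bar>t\<bar> < real m" using reals_Archimedean2 by blast
    then show ?thesis using step[of "t / real m" c m k] by simp
  qed
  have "\<Phi> (c + (\<Sum>k\<in>K. (a $ k) *\<^sub>R axis k 1)) = \<Phi> c" for K
  proof (induction K rule: infinite_finite_induct)
    case (insert k K)
    then show ?case
      using coord[of "c + (\<Sum>k\<in>K. (a $ k) *\<^sub>R axis k 1)" "a $ k" k] by (simp add: algebra_simps)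
  qed auto
  moreover have "(\<Sum>k\<in>UNIV. (a $ k) *\<^sub>R axis k 1) = a"
    by (simp add: vec_eq_iff axis_def if_distrib cong: if_cong)
  ultimately have "\<Phi> (c + a) = \<Phi> c" by metis
  then show ?thesis by (simp add: \<Phi>_def)
qed

text \<open>Finitely many cells cover \<open>K\<close>, and all of them carry the same integral. The
  number \<open>N\<close> depends on \<open>K\<close> alone, which later makes local integrals
  continuous with respect to the norm of \<open>'n l2\<close>.\<close>

lemma nn_integral_compact_le_cell:
  fixes K :: "(real ^ 'n) set"
  assumes "compact K"
  shows "\<exists>N::nat. \<forall>h :: real ^ 'n \<Rightarrow> ennreal. h \<in> borel_measurable borel \<longrightarrow> periodic h \<longrightarrow>
      (\<integral>\<^sup>+x\<in>K. h x \<partial>lborel) \<le> of_nat N * (\<integral>\<^sup>+x\<in>cell 0. h x \<partial>lborel)"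
proof -
  have cover: "K \<subseteq> (\<Union>x\<in>K. cell (x - (\<chi> i. 1 / 2)))" by (auto simp: mem_cell)
  have op: "\<And>x. x \<in> K \<Longrightarrow> open (cell (x - (\<chi> i. 1 / 2)))" by (simp add: cell_def open_box)
  obtain C where C: "C \<subseteq> K" "finite C" "K \<subseteq> (\<Union>x\<in>C. cell (x - (\<chi> i. 1 / 2)))"
    by (rule compactE_image[OF assms op cover])
  have [measurable]: "K \<in> sets borel" using assms by (intro borel_closed compact_imp_closed)
  have bound: "(\<integral>\<^sup>+x\<in>K. h x \<partial>lborel) \<le> of_nat (card C) * (\<integral>\<^sup>+x\<in>cell 0. h x \<partial>lborel)"
    if [measurable]: "h \<in> borel_measurable borel" and per: "periodic h" for h :: "real ^ 'n \<Rightarrow> ennreal"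
  proof -
    have "(\<integral>\<^sup>+x\<in>K. h x \<partial>lborel) \<le> (\<integral>\<^sup>+x. (\<Sum>y\<in>C. h x * indicator (cell (y - (\<chi> i. 1 / 2))) x) \<partial>lborel)"
    proof (rule nn_integral_mono)
      fix x
      show "h x * indicator K x \<le> (\<Sum>y\<in>C. h x * indicator (cell (y - (\<chi> i. 1 / 2))) x)"
      proof (cases "x \<in> K")
        case True
        then have "x \<in> (\<Union>x\<in>C. cell (x - (\<chi> i. 1 / 2)))" using C(3) by (rule subsetD[rotated])
        then obtain y where y: "y \<in> C" "x \<in> cell (y - (\<chi> i. 1 / 2))" by (rule UN_E)
        have "h x * indicator (cell (y - (\<chi> i. 1 / 2))) x \<le>
            (\<Sum>y\<in>C. h x * indicator (cell (y - (\<chi> i. 1 / 2))) x)"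
          by (rule member_le_sum[OF y(1) _ C(2)]) simp
        then show ?thesis using True y(2) by simp
      qed simp
    qed
    also have "\<dots> = (\<Sum>y\<in>C. (\<integral>\<^sup>+x\<in>cell (y - (\<chi> i. 1 / 2)). h x \<partial>lborel))"
      by (rule nn_integral_sum) auto
    also have "\<dots> = (\<Sum>y\<in>C. (\<integral>\<^sup>+x\<in>cell 0. h x \<partial>lborel))"
      by (intro sum.cong refl nn_integral_cell_shift[OF that, of 0, simplified])
    finally show ?thesis by (simp only: sum_constant)
  qed
  then show ?thesis by (intro exI[of _ "card C"] allI impI)
qed

lemma AE_zero_if_AE_zero_on_cell:
  fixes f :: "real ^ 'n \<Rightarrow> real"
  assumes [measurable]: "f \<in> borel_measurable borel" and per: "periodic f"
    and zero: "AE x in lborel. x \<in> cell 0 \<longrightarrow> f x = 0"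
  shows "AE x in lborel. f x = 0"
proof -
  define h where "h x = ennreal \<bar>f x\<bar>" for x
  have [measurable]: "h \<in> borel_measurable borel" unfolding h_def by measurable
  have "periodic h" unfolding h_def using per by (rule periodic_compose)
  have "(\<integral>\<^sup>+x\<in>cell 0. h x \<partial>lborel) = 0"
    using zero by (subst nn_integral_0_iff_AE) (auto simp: h_def elim!: eventually_mono)
  have "AE x in lborel. x \<in> cbox (- real m *\<^sub>R 1) (real m *\<^sub>R 1) \<longrightarrow> f x = 0" for m
  proof -
    let ?K = "cbox (- real m *\<^sub>R 1) (real m *\<^sub>R 1) :: (real ^ 'n) set"
    obtain N :: nat where "(\<integral>\<^sup>+x\<in>?K. h x \<partial>lborel) \<le> of_nat N * (\<integral>\<^sup>+x\<in>cell 0. h x \<partial>lborel)"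
      using nn_integral_compact_le_cell[OF compact_cbox] \<open>periodic h\<close> \<open>h \<in> borel_measurable borel\<close> by blast
    then have "(\<integral>\<^sup>+x\<in>?K. h x \<partial>lborel) = 0"
      using \<open>(\<integral>\<^sup>+x\<in>cell 0. h x \<partial>lborel) = 0\<close> by simp
    then show ?thesis
      by (subst (asm) nn_integral_0_iff_AE) (auto simp: h_def indicator_def split: if_splits elim: eventually_mono)
  qed
  then have "AE x in lborel. \<forall>m. x \<in> cbox (- real m *\<^sub>R 1) (real m *\<^sub>R 1) \<longrightarrow> f x = 0"
    by (subst AE_all_countable) blast
  then show ?thesis
  proof eventually_elim
    fix x assume *: "\<forall>m. x \<in> cbox (- real m *\<^sub>R 1) (real m *\<^sub>R 1) \<longrightarrow> f x = 0"
    obtain m where m: "norm x < real m" using reals_Archimedean2 by blast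
    have "- real m < x $ i \<and> x $ i < real m" for i
      using component_le_norm_cart[of x i] m by linarith
    then have "x \<in> cbox (- real m *\<^sub>R 1) (real m *\<^sub>R 1)"
      by (simp add: mem_box_cart less_imp_le)
    then show "f x = 0" using * by blast
  qed
qed

lemma integrable_cell_shift:
  fixes f :: "real ^ 'n \<Rightarrow> real"
  assumes [measurable]: "f \<in> borel_measurable borel" and per: "periodic f"
    and int: "set_integrable lborel (cell 0) f"
  shows "set_integrable lborel (cell c) f" "(LINT x:cell c|lborel. f x) = (LINT x:cell 0|lborel. f x)"
proof -
  \<comment> \<open>\<open>ennreal\<close> cuts off negative values: \<open>id\<close> and
    \<open>uminus\<close> give the positive and negative parts of the integral, \<open>norm\<close>
    gives integrability.\<close>
  have eq: "(\<integral>\<^sup>+x. ennreal (g (indicator (cell c) x *\<^sub>R f x)) \<partial>lborel)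
      = (\<integral>\<^sup>+x. ennreal (g (indicator (cell 0) x *\<^sub>R f x)) \<partial>lborel)"
    if "g 0 = 0" and [measurable]: "g \<in> borel_measurable borel" for g :: "real \<Rightarrow> real"
  proof -
    have "(\<integral>\<^sup>+x. ennreal (g (indicator (cell c) x *\<^sub>R f x)) \<partial>lborel) = (\<integral>\<^sup>+x\<in>cell c. ennreal (g (f x)) \<partial>lborel)" for c
      using that by (intro nn_integral_cong) (auto simp: indicator_def)
    moreover have "(\<integral>\<^sup>+x\<in>cell (0 + c). ennreal (g (f x)) \<partial>lborel) = (\<integral>\<^sup>+x\<in>cell 0. ennreal (g (f x)) \<partial>lborel)"
      by (rule nn_integral_cell_shift) (auto intro: periodic_compose per)
    ultimately show ?thesis by simp
  qed
  show int': "set_integrable lborel (cell c) f"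
    using int eq[of norm] unfolding set_integrable_def integrable_iff_bounded by simp
  show "(LINT x:cell c|lborel. f x) = (LINT x:cell 0|lborel. f x)"
    using eq[of id] eq[of uminus] int int' unfolding set_lebesgue_integral_def set_integrable_def
    by (simp add: real_lebesgue_integral_def)
qed

lemma integral_cell_translate:
  fixes f :: "real ^ 'n \<Rightarrow> real"
  assumes [measurable]: "f \<in> borel_measurable borel" and per: "periodic f"
    and int: "set_integrable lborel (cell 0) f"
  shows "set_integrable lborel (cell 0) (\<lambda>x. f (a + x))"
    "(LINT x:cell 0|lborel. f (a + x)) = (LINT x:cell 0|lborel. f x)"
proof -
  have ind: "indicator (cell a) (a + x) = (indicator (cell 0) x :: real)" for x :: "real ^ 'n"
    by (auto simp: indicator_def mem_cell)
  have "(LINT x:cell 0|lborel. f (a + x)) = (LINT x|lborel. indicator (cell a) (a + x) *\<^sub>R f (a + x))"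
    by (simp add: set_lebesgue_integral_def ind)
  also have "\<dots> = (LINT x:cell a|lborel. f x)"
    unfolding set_lebesgue_integral_def
    by (rule integral_lborel_translate[of "\<lambda>x. indicator (cell a) x *\<^sub>R f x"]) simp
  finally show "(LINT x:cell 0|lborel. f (a + x)) = (LINT x:cell 0|lborel. f x)"
    using integrable_cell_shift[OF assms] by simp
  have "integrable (distr lborel borel ((+) a)) (\<lambda>x. indicator (cell a) x *\<^sub>R f x)"
    using integrable_cell_shift[OF assms, of a] by (simp add: set_integrable_def lborel_distr_plus)
  then have "integrable lborel (\<lambda>x. indicator (cell a) (a + x) *\<^sub>R f (a + x))"
    by (subst (asm) integrable_distr_eq) auto
  then show "set_integrable lborel (cell 0) (\<lambda>x. f (a + x))"
    by (simp add: set_integrable_def ind)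
qed

section \<open>The fundamental lemma of the calculus of variations\<close>

lemma borel_measurable_smooth: "smooth f \<Longrightarrow> f \<in> borel_measurable borel"
  by (intro borel_measurable_continuous_onI smooth_continuous_on)

lemma borel_measurable_test_function: "test_function \<phi> \<Longrightarrow> \<phi> \<in> borel_measurable borel"
  by (intro borel_measurable_smooth test_functionD)

text \<open>Bump functions turn the hypothesis into vanishing integrals over all boxes. Boxes form
  an intersection-stable generator of the Borel sets, so after localisation all integrals over Borel
  sets vanish.\<close>

lemma AE_zero_if_test_integrals_zero:
  fixes f :: "real ^ 'n \<Rightarrow> real"
  assumes [measurable]: "f \<in> borel_measurable borel"
    and int: "\<And>K. compact K \<Longrightarrow> set_integrable lborel K f"
    and zero: "\<And>\<phi>. test_function \<phi> \<Longrightarrow> (LINT x|lborel. f x * \<phi> x) = 0"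
  shows "AE x in lborel. f x = 0"
proof -
  have box0: "(LINT x:box a b|lborel. f x) = 0" for a b
  proof -
    have "(\<lambda>m. LINT x|lborel. f x * box_bump a b m x) \<longlonglongrightarrow> (LINT x|lborel. f x * indicator (box a b) x)"
    proof (rule integral_dominated_convergence)
      show "integrable lborel (\<lambda>x. \<bar>indicator (cbox a b) x * f x\<bar>)"
        using int[of "cbox a b"] by (intro integrable_abs) (simp add: set_integrable_def)
      show "AE x in lborel. (\<lambda>m. f x * box_bump a b m x) \<longlonglongrightarrow> f x * indicator (box a b) x"
        by (intro AE_I2 tendsto_mult tendsto_const box_bump_tendsto)
      show "(\<lambda>x. f x * box_bump a b m x) \<in> borel_measurable lborel" for m
        using borel_measurable_test_function[OF test_function_box_bump[of a b m]] by simp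
      show "AE x in lborel. norm (f x * box_bump a b m x) \<le> \<bar>indicator (cbox a b) x * f x\<bar>" for m
      proof (intro AE_I2)
        fix x
        show "norm (f x * box_bump a b m x) \<le> \<bar>indicator (cbox a b) x * f x\<bar>"
        proof (cases "x \<in> box a b")
          case True
          then have "x \<in> cbox a b" using box_subset_cbox by blast
          then show ?thesis using box_bump_bounds[of a b m x]
            by (auto simp: abs_mult mult_left_le)
        qed (simp add: box_bump_eq_0)
      qed
    qed simp
    then have "(\<lambda>m. 0) \<longlonglongrightarrow> (LINT x|lborel. f x * indicator (box a b) x)"
      using zero[OF test_function_box_bump] by simp
    then show ?thesis by (simp add: LIMSEQ_const_iff set_lebesgue_integral_def mult.commute)
  qed
  have "AE x in lborel. x \<in> box (- real m *\<^sub>R 1) (real m *\<^sub>R 1) \<longrightarrow> f x = 0" for m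
  proof -
    let ?K = "box (- real m *\<^sub>R 1) (real m *\<^sub>R 1) :: (real ^ 'n) set"
    \<comment> \<open>Cutting \<open>f\<close> off to a bounded box makes it integrable on the whole
      space, as the complement step of the induction over Borel sets requires.\<close>
    define g where "g x = indicator ?K x * f x" for x
    have "set_integrable lborel ?K f"
      by (rule set_integrable_subset[OF int[of "cbox (- real m *\<^sub>R 1) (real m *\<^sub>R 1)"]])
         (auto simp: box_subset_cbox)
    then have g: "integrable lborel g" by (simp add: g_def[abs_def] set_integrable_def)
    have gA: "set_integrable lborel A g" if "A \<in> sets borel" for A
      using integrable_mult_indicator[of A lborel g] g that by (simp add: set_integrable_def)
    have g_box: "(LINT x:box a b|lborel. g x) = 0" for a b
    proof -
      have "\<exists>c d. box a b \<inter> ?K = box c d" by (intro exI) (rule box_Int_box)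
      then obtain c d where "box a b \<inter> ?K = box c d" by (elim exE)
      moreover have "(LINT x:box a b|lborel. g x) = (LINT x:box a b \<inter> ?K|lborel. f x)"
        unfolding set_lebesgue_integral_def
        by (intro Bochner_Integration.integral_cong) (auto simp: g_def indicator_def)
      ultimately show ?thesis using box0 by simp
    qed
    have "(LINT x:A|lborel. g x) = 0" if "A \<in> sets borel" for A
    proof -
      have "Int_stable (range (\<lambda>(a, b). box a b :: (real ^ 'n) set))"
        by (auto simp: Int_stable_def box_Int_box)
      moreover have "range (\<lambda>(a, b). box a b :: (real ^ 'n) set) \<subseteq> Pow UNIV" by auto
      moreover have "A \<in> sigma_sets UNIV (range (\<lambda>(a, b). box a b))"
        using that unfolding borel_eq_box by simp
      ultimately show ?thesis
      proof (induction rule: sigma_sets_induct_disjoint)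
        case (basic A)
        then show ?case using g_box by auto
      next
        case empty
        then show ?case by (simp add: set_lebesgue_integral_def)
      next
        case (compl A)
        then have A: "A \<in> sets borel" by (simp add: borel_eq_box)
        have "(LINT x:UNIV|lborel. g x) = (LINT x:?K|lborel. g x)"
          unfolding set_lebesgue_integral_def
          by (intro Bochner_Integration.integral_cong) (auto simp: g_def indicator_def)
        then have "(LINT x:UNIV|lborel. g x) = 0" using g_box by simp
        moreover have "(LINT x:UNIV|lborel. g x) = (LINT x:A|lborel. g x) + (LINT x:UNIV - A|lborel. g x)"
          using set_integral_Un[of A "UNIV - A" lborel g] gA A by simp
        ultimately show ?case using compl by simp
      next
        case (union F)
        then have F: "F i \<in> sets borel" for i by (auto simp: borel_eq_box)
        have "(LINT x:\<Union>(range F)|lborel. g x) = (\<Sum>i. (LINT x:F i|lborel. g x))"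
          using F union(1) gA by (intro lebesgue_integral_countable_add) (auto simp: disjoint_family_on_def)
        then show ?case using union by simp
      qed
    qed
    then have "AE x in lborel. g x = 0"
      using density_unique_real[of lborel g "\<lambda>x. 0"] g by (simp add: set_lebesgue_integral_def)
    then show ?thesis by eventually_elim (auto simp: g_def)
  qed
  then have "AE x in lborel. \<forall>m. x \<in> box (- real m *\<^sub>R 1) (real m *\<^sub>R 1) \<longrightarrow> f x = 0"
    by (subst AE_all_countable) blast
  then show ?thesis
  proof eventually_elim
    fix x assume *: "\<forall>m. x \<in> box (- real m *\<^sub>R 1) (real m *\<^sub>R 1) \<longrightarrow> f x = 0"
    obtain m where m: "norm x < real m" using reals_Archimedean2 by blast
    have "- real m < x $ i \<and> x $ i < real m" for i
      using component_le_norm_cart[of x i] m by linarith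
    then have "x \<in> box (- real m *\<^sub>R 1) (real m *\<^sub>R 1)"
      by (simp add: mem_box_cart)
    then show "f x = 0" using * by blast
  qed
qed

subsection \<open>The space of periodic square integrable functions\<close>

abbreviation cint :: "(real ^ 'n \<Rightarrow> real) \<Rightarrow> real" where
  "cint f \<equiv> (LINT x:cell 0|lborel. f x)"

text \<open>Borel measurability, unlike Lebesgue measurability, is kept by the substitutions in
  Fubini arguments, such as \<open>f (x + y)\<close> in two variables. The functions of the
  statement are replaced by Borel versions later.\<close>

definition sq_int :: "(real ^ 'n \<Rightarrow> real) \<Rightarrow> bool" where
  "sq_int f \<longleftrightarrow> f \<in> borel_measurable borel \<and> periodic f \<and> set_integrable lborel (cell 0) (\<lambda>x. (f x)\<^sup>2)"

lemma sq_intD: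
  assumes "sq_int f"
  shows "f \<in> borel_measurable borel" "periodic f" "set_integrable lborel (cell 0) (\<lambda>x. (f x)\<^sup>2)"
  using assms by (auto simp: sq_int_def)

lemma set_integrable_cell_bound:
  fixes f g :: "real ^ 'n \<Rightarrow> real"
  assumes "set_integrable lborel (cell 0) g" and "f \<in> borel_measurable borel"
    and "\<And>x. \<bar>f x\<bar> \<le> \<bar>g x\<bar>"
  shows "set_integrable lborel (cell 0) f"
  using assms unfolding set_integrable_def
  by (elim Bochner_Integration.integrable_bound) (auto intro!: borel_measurable_times simp: indicator_def)

lemma sq_int_mult_integrable:
  assumes "sq_int f" "sq_int g"
  shows "set_integrable lborel (cell 0) (\<lambda>x. f x * g x)"
proof (rule set_integrable_cell_bound)
  show "set_integrable lborel (cell 0) (\<lambda>x. (f x)\<^sup>2 + (g x)\<^sup>2)"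
    using assms by (intro set_integral_add(1)) (auto simp: sq_int_def)
  show "(\<lambda>x. f x * g x) \<in> borel_measurable borel"
    using assms by (auto simp: sq_int_def)
  fix x
  have "0 \<le> (\<bar>f x\<bar> - \<bar>g x\<bar>)\<^sup>2" by simp
  then have "2 * \<bar>f x * g x\<bar> \<le> (f x)\<^sup>2 + (g x)\<^sup>2" by (simp add: power2_eq_square algebra_simps abs_mult)
  then show "\<bar>f x * g x\<bar> \<le> \<bar>(f x)\<^sup>2 + (g x)\<^sup>2\<bar>" by linarith
qed

lemma set_integrable_cell_const: "set_integrable lborel (cell 0 :: (real ^ 'n) set) (\<lambda>x. c :: real)"
  unfolding set_integrable_def
  by (intro integrable_scaleR_left integrable_real_indicator) (auto simp: emeasure_cell)

lemma sq_int_const: "sq_int (\<lambda>x. c)"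
  by (simp add: sq_int_def periodic_def set_integrable_cell_const)

lemma sq_int_integrable: "sq_int f \<Longrightarrow> set_integrable lborel (cell 0) f"
  using sq_int_mult_integrable[OF _ sq_int_const[of 1]] by force

lemma sq_int_linear_combination:
  assumes "sq_int f" "sq_int g"
  shows "sq_int (\<lambda>x. f x + c * g x)"
proof -
  have "set_integrable lborel (cell 0) (\<lambda>x. (f x)\<^sup>2 + ((2 * c) * (f x * g x) + c\<^sup>2 * (g x)\<^sup>2))"
    using assms sq_int_mult_integrable[OF assms]
    by (intro set_integral_add(1) set_integrable_mult_right) (auto simp: sq_int_def)
  moreover have "(f x)\<^sup>2 + ((2 * c) * (f x * g x) + c\<^sup>2 * (g x)\<^sup>2) = (f x + c * g x)\<^sup>2" for x
    by (simp add: power2_eq_square algebra_simps)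
  ultimately show ?thesis
    using assms periodic_compose2[of f g "\<lambda>a b. a + c * b"] by (auto simp: sq_int_def)
qed

lemma cint_cong_AE:
  assumes "AE x in lborel. f x = g x" "f \<in> borel_measurable borel" "g \<in> borel_measurable borel"
  shows "cint f = cint g"
  unfolding set_lebesgue_integral_def using assms
  by (intro integral_cong_AE) (auto elim: eventually_mono)

definition l2_rel :: "(real ^ 'n \<Rightarrow> real) \<Rightarrow> (real ^ 'n \<Rightarrow> real) \<Rightarrow> bool" where
  "l2_rel f g \<longleftrightarrow> sq_int f \<and> sq_int g \<and> (AE x in lborel. f x = g x)"

lemma part_equivp_l2_rel: "part_equivp (l2_rel :: (real ^ 'n \<Rightarrow> real) \<Rightarrow> _)"
proof (rule part_equivpI)
  show "\<exists>f :: real ^ 'n \<Rightarrow> real. l2_rel f f" using sq_int_const[of 0] by (auto simp: l2_rel_def intro!: exI[of _ "\<lambda>x. 0"])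
  show "symp (l2_rel :: (real ^ 'n \<Rightarrow> real) \<Rightarrow> _)" by (auto simp: symp_def l2_rel_def elim: eventually_mono)
  show "transp (l2_rel :: (real ^ 'n \<Rightarrow> real) \<Rightarrow> _)"
  proof (rule transpI)
    fix f g h :: "real ^ 'n \<Rightarrow> real" assume *: "l2_rel f g" "l2_rel g h"
    then have "AE x in lborel. f x = g x" "AE x in lborel. g x = h x" by (auto simp: l2_rel_def)
    then have "AE x in lborel. f x = h x" by eventually_elim simp
    then show "l2_rel f h" using * by (simp add: l2_rel_def)
  qed
qed

\<comment> \<open>As a type of its own, the space of classes can be an instance of
  \<open>real_inner\<close>, and its products and finite powers are again Hilbert spaces by library
  instances.\<close>
quotient_type 'n l2 = "real ^ 'n \<Rightarrow> real" / partial: l2_rel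
  by (rule part_equivp_l2_rel)

instantiation l2 :: (finite) real_inner
begin

lift_definition zero_l2 :: "'a l2" is "\<lambda>x. 0"
  by (simp add: l2_rel_def sq_int_const)

lift_definition plus_l2 :: "'a l2 \<Rightarrow> 'a l2 \<Rightarrow> 'a l2" is "\<lambda>f g x. f x + g x"
proof -
  fix f f' g g' :: "real ^ 'a \<Rightarrow> real" assume *: "l2_rel f f'" "l2_rel g g'"
  then have "AE x in lborel. f x = f' x" "AE x in lborel. g x = g' x" by (auto simp: l2_rel_def)
  then have "AE x in lborel. f x + g x = f' x + g' x" by eventually_elim simp
  then show "l2_rel (\<lambda>x. f x + g x) (\<lambda>x. f' x + g' x)"
    using * sq_int_linear_combination[of _ _ 1] by (auto simp: l2_rel_def)
qed

lift_definition scaleR_l2 :: "real \<Rightarrow> 'a l2 \<Rightarrow> 'a l2" is "\<lambda>c f x. c * f x"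
proof -
  fix c and f f' :: "real ^ 'a \<Rightarrow> real" assume *: "l2_rel f f'"
  then have "AE x in lborel. f x = f' x" by (auto simp: l2_rel_def)
  then have "AE x in lborel. c * f x = c * f' x" by eventually_elim simp
  then show "l2_rel (\<lambda>x. c * f x) (\<lambda>x. c * f' x)"
    using * sq_int_linear_combination[OF sq_int_const[of 0], of _ c] by (auto simp: l2_rel_def)
qed

lift_definition inner_l2 :: "'a l2 \<Rightarrow> 'a l2 \<Rightarrow> real" is "\<lambda>f g. cint (\<lambda>x. f x * g x)"
proof -
  fix f f' g g' :: "real ^ 'a \<Rightarrow> real" assume *: "l2_rel f f'" "l2_rel g g'"
  then have "AE x in lborel. f x = f' x" "AE x in lborel. g x = g' x" by (auto simp: l2_rel_def)
  then have "AE x in lborel. f x * g x = f' x * g' x" by eventually_elim simp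
  then show "cint (\<lambda>x. f x * g x) = cint (\<lambda>x. f' x * g' x)"
    using * by (intro cint_cong_AE) (auto simp: l2_rel_def sq_int_def)
qed

definition uminus_l2 :: "'a l2 \<Rightarrow> 'a l2" where "uminus_l2 x = (-1) *\<^sub>R x"
definition minus_l2 :: "'a l2 \<Rightarrow> 'a l2 \<Rightarrow> 'a l2" where "minus_l2 x y = x + (-1) *\<^sub>R y"
definition norm_l2 :: "'a l2 \<Rightarrow> real" where "norm_l2 x = sqrt (inner x x)"
definition dist_l2 :: "'a l2 \<Rightarrow> 'a l2 \<Rightarrow> real" where "dist_l2 x y = norm (x - y)"
definition sgn_l2 :: "'a l2 \<Rightarrow> 'a l2" where "sgn_l2 x = inverse (norm x) *\<^sub>R x"
definition uniformity_l2 :: "('a l2 \<times> 'a l2) filter" where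
  "uniformity_l2 = (INF e\<in>{0 <..}. principal {(x, y). dist x y < e})"
definition open_l2 :: "'a l2 set \<Rightarrow> bool" where
  "open_l2 U \<longleftrightarrow> (\<forall>x\<in>U. eventually (\<lambda>(x', y). x' = x \<longrightarrow> y \<in> U) uniformity)"

instance
proof
  fix x y z :: "'a l2" and a b r :: real
  have lin: "cint (\<lambda>x. (f x + g x) * h x) = cint (\<lambda>x. f x * h x) + cint (\<lambda>x. g x * h x)"
    if "sq_int f" "sq_int g" "sq_int h" for f g h :: "real ^ 'a \<Rightarrow> real"
    using set_integral_add(2)[OF sq_int_mult_integrable[OF that(1,3)] sq_int_mult_integrable[OF that(2,3)]]
    by (simp add: distrib_right)
  have sc: "sq_int (\<lambda>x. c * f x)" if "sq_int f" for f :: "real ^ 'a \<Rightarrow> real" and c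
    using sq_int_linear_combination[OF sq_int_const[of 0] that, of c] by simp
  have ad: "sq_int (\<lambda>x. f x + g x)" if "sq_int f" "sq_int g" for f g :: "real ^ 'a \<Rightarrow> real"
    using sq_int_linear_combination[OF that, of 1] by simp
  show "dist x y = norm (x - y)" by (simp add: dist_l2_def)
  show "x + y + z = x + (y + z)" by transfer (auto simp: l2_rel_def algebra_simps intro!: ad)
  show "x + y = y + x" by transfer (auto simp: l2_rel_def algebra_simps intro!: ad)
  show "0 + x = x" by transfer (auto simp: l2_rel_def)
  show "- x + x = 0" unfolding uminus_l2_def by transfer (auto simp: l2_rel_def sq_int_const)
  show "x - y = x + - y" by (simp add: uminus_l2_def minus_l2_def)
  show "a *\<^sub>R (x + y) = a *\<^sub>R x + a *\<^sub>R y" by transfer (auto simp: l2_rel_def algebra_simps intro!: ad sc)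
  show "(a + b) *\<^sub>R x = a *\<^sub>R x + b *\<^sub>R x" by transfer (auto simp: l2_rel_def algebra_simps intro!: ad sc)
  show "a *\<^sub>R b *\<^sub>R x = (a * b) *\<^sub>R x" by transfer (auto simp: l2_rel_def algebra_simps intro!: ad sc)
  show "1 *\<^sub>R x = x" by transfer (auto simp: l2_rel_def)
  show "sgn x = inverse (norm x) *\<^sub>R x" by (simp add: sgn_l2_def)
  show "uniformity = (INF e\<in>{0<..}. principal {(x :: 'a l2, y). dist x y < e})"
    by (simp add: uniformity_l2_def)
  show "open U \<longleftrightarrow> (\<forall>x\<in>U. \<forall>\<^sub>F (x', y) in uniformity. x' = x \<longrightarrow> y \<in> U)" for U :: "'a l2 set"
    by (simp add: open_l2_def)
  show "inner x y = inner y x" by transfer (simp add: mult.commute)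
  show "inner (x + y) z = inner x z + inner y z" by transfer (simp add: l2_rel_def lin)
  show "inner (r *\<^sub>R x) y = r * inner x y"
    by transfer (simp add: mult.assoc set_integral_mult_right)
  show "0 \<le> inner x x"
    by transfer (auto simp: set_lebesgue_integral_def intro!: integral_nonneg_AE)
  show "inner x x = 0 \<longleftrightarrow> x = 0"
  proof transfer
    fix f :: "real ^ 'a \<Rightarrow> real" assume "l2_rel f f"
    then have f: "sq_int f" by (simp add: l2_rel_def)
    show "(cint (\<lambda>x. f x * f x) = 0) = l2_rel f (\<lambda>x. 0)"
    proof
      assume 0: "cint (\<lambda>x. f x * f x) = 0"
      have "AE x in lborel. indicator (cell 0) x *\<^sub>R (f x * f x) = 0"
        using sq_int_mult_integrable[OF f f] 0 unfolding set_lebesgue_integral_def set_integrable_def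
        by (subst integral_nonneg_eq_0_iff_AE[symmetric]) auto
      then have "AE x in lborel. x \<in> cell 0 \<longrightarrow> f x = 0"
        by eventually_elim (auto simp: indicator_def split: if_splits)
      \<comment> \<open>The integral sees one cell only; periodicity carries the vanishing to the
        whole space.\<close>
      then have "AE x in lborel. f x = 0"
        using f by (intro AE_zero_if_AE_zero_on_cell) (auto simp: sq_int_def)
      then show "l2_rel f (\<lambda>x. 0)" using f by (simp add: l2_rel_def sq_int_const)
    next
      assume "l2_rel f (\<lambda>x. 0)"
      then have "AE x in lborel. f x = 0" by (simp add: l2_rel_def)
      then have "cint (\<lambda>x. f x * f x) = cint (\<lambda>x :: real ^ 'a. 0)"
        using f by (intro cint_cong_AE) (auto simp: sq_int_def elim: eventually_mono)
      then show "cint (\<lambda>x. f x * f x) = 0" by simp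
    qed
  qed
  show "norm x = sqrt (inner x x)" by (simp add: norm_l2_def)
qed

end

definition l2 :: "(real ^ 'n \<Rightarrow> real) \<Rightarrow> 'n l2" where "l2 f = abs_l2 f"

lemma l2_cases: obtains f where "sq_int f" "x = l2 f"
proof -
  have "l2_rel (rep_l2 x) (rep_l2 x)" using Quotient_rep_reflp[OF Quotient_l2] .
  then show ?thesis using that[of "rep_l2 x"] Quotient_abs_rep[OF Quotient_l2, of x]
    by (simp add: l2_rel_def l2_def)
qed

lemma l2_eq_iff: "sq_int f \<Longrightarrow> sq_int g \<Longrightarrow> l2 f = l2 g \<longleftrightarrow> (AE x in lborel. f x = g x)"
  using Quotient_rel[OF Quotient_l2, of f g] by (auto simp: l2_def l2_rel_def)

lemma inner_l2: "sq_int f \<Longrightarrow> sq_int g \<Longrightarrow> l2 f \<bullet> l2 g = cint (\<lambda>x. f x * g x)"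
  by (simp add: l2_def inner_l2.abs_eq eq_onp_def l2_rel_def)

lemma l2_add: "sq_int f \<Longrightarrow> sq_int g \<Longrightarrow> l2 (\<lambda>x. f x + g x) = l2 f + l2 g"
  by (simp add: l2_def plus_l2.abs_eq eq_onp_def l2_rel_def)

lemma l2_scaleR: "sq_int f \<Longrightarrow> l2 (\<lambda>x. c * f x) = c *\<^sub>R l2 f"
  by (simp add: l2_def scaleR_l2.abs_eq eq_onp_def l2_rel_def)

lemma l2_zero: "l2 (\<lambda>x. 0) = 0"
  by (simp add: l2_def zero_l2_def)

lemma sq_int_cmult: "sq_int f \<Longrightarrow> sq_int (\<lambda>x. c * f x)"
  using sq_int_linear_combination[OF sq_int_const[of 0], of f c] by simp

lemma sq_int_add: "sq_int f \<Longrightarrow> sq_int g \<Longrightarrow> sq_int (\<lambda>x. f x + g x)"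
  using sq_int_linear_combination[of f g 1] by simp

lemma sq_int_diff: "sq_int f \<Longrightarrow> sq_int g \<Longrightarrow> sq_int (\<lambda>x. f x - g x)"
  using sq_int_linear_combination[of f g "-1"] by simp

lemma sq_int_sum: "(\<And>i. i \<in> I \<Longrightarrow> sq_int (f i)) \<Longrightarrow> sq_int (\<lambda>x. \<Sum>i\<in>I. f i x)"
  by (induction I rule: infinite_finite_induct) (auto intro: sq_int_const sq_int_add)

lemma l2_diff: "sq_int f \<Longrightarrow> sq_int g \<Longrightarrow> l2 (\<lambda>x. f x - g x) = l2 f - l2 g"
  using l2_add[of f "\<lambda>x. (-1) * g x"] l2_scaleR[of g "-1"] sq_int_cmult[of g "-1"] by simp

lemma l2_sum: "finite I \<Longrightarrow> (\<And>i. i \<in> I \<Longrightarrow> sq_int (f i)) \<Longrightarrow> l2 (\<lambda>x. \<Sum>i\<in>I. f i x) = (\<Sum>i\<in>I. l2 (f i))"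
  by (induction I rule: finite_induct) (simp_all add: l2_zero l2_add sq_int_sum)

lemma norm_l2_power2: "sq_int f \<Longrightarrow> (norm (l2 f))\<^sup>2 = cint (\<lambda>x. (f x)\<^sup>2)"
  unfolding power2_norm_eq_inner by (simp add: inner_l2 power2_eq_square)

lemma sq_int_abs: "sq_int f \<Longrightarrow> sq_int (\<lambda>x. \<bar>f x\<bar>)"
  using periodic_compose[of f abs] borel_measurable_abs[of f borel] by (simp add: sq_int_def)

text \<open>Cauchy-Schwarz against the constant 1, whose norm is 1 because the cell has volume
  1.\<close>

lemma cint_abs_le_norm: "sq_int f \<Longrightarrow> cint (\<lambda>x. \<bar>f x\<bar>) \<le> norm (l2 f)"
proof -
  assume f: "sq_int f"
  have "cint (\<lambda>x. \<bar>f x\<bar>) = l2 (\<lambda>x. \<bar>f x\<bar>) \<bullet> l2 (\<lambda>x. 1)"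
    using inner_l2[OF sq_int_abs[OF f] sq_int_const[of 1]] by simp
  also have "\<dots> \<le> norm (l2 (\<lambda>x. \<bar>f x\<bar>)) * norm (l2 (\<lambda>x. 1) :: 'a l2)" by (rule norm_cauchy_schwarz)
  also have "norm (l2 (\<lambda>x. \<bar>f x\<bar>)) = norm (l2 f)"
    using norm_l2_power2[OF f] norm_l2_power2[OF sq_int_abs[OF f]]
    by (intro power2_eq_imp_eq[OF _ norm_ge_zero norm_ge_zero]) simp
  also have "norm (l2 (\<lambda>x. 1) :: 'a l2) = 1"
  proof -
    have "(norm (l2 (\<lambda>x. 1) :: 'a l2))\<^sup>2 = 1\<^sup>2"
      unfolding norm_l2_power2[OF sq_int_const] set_lebesgue_integral_def
      by (simp add: measure_def emeasure_cell)
    then show ?thesis by (rule power2_eq_imp_eq) simp_all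
  qed
  finally show ?thesis by simp
qed

text \<open>Riesz-Fischer: along indices with summable gaps the functions converge almost everywhere
  on the cell, and Fatou's lemma shows that this limit is also the limit in norm.\<close>

lemma l2_Cauchy_convergent:
  fixes X :: "nat \<Rightarrow> 'n::finite l2"
  assumes "Cauchy X" shows "convergent X"
proof -
  have "\<forall>k. \<exists>N. \<forall>m\<ge>N. \<forall>n\<ge>N. norm (X m - X n) < (1/2) ^ k"
    using assms unfolding Cauchy_iff by (metis zero_less_divide_1_iff zero_less_numeral zero_less_power)
  then obtain N where N: "\<And>k m n. m \<ge> N k \<Longrightarrow> n \<ge> N k \<Longrightarrow> norm (X m - X n) < (1/2) ^ k" by metis
  \<comment> \<open>Partial sums give a monotone choice of indices: \<open>r j\<close> is at least
    \<open>N k\<close> for all \<open>k \<le> j\<close>.\<close>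
  define r where "r k = (\<Sum>i\<le>k. N i)" for k
  have r: "N k \<le> r j" if "k \<le> j" for k j
    unfolding r_def using that by (intro member_le_sum) auto
  have "\<forall>n. \<exists>f. sq_int f \<and> X n = l2 f" using l2_cases by metis
  then obtain f where f: "\<And>n. sq_int (f n)" "\<And>n. X n = l2 (f n)" by metis
  note [measurable] = sq_intD(1)[OF f(1)]
  define g where "g k = f (r k)" for k
  have g: "sq_int (g k)" for k by (simp add: g_def f)
  note [measurable] = sq_intD(1)[OF g]
  have sqd: "sq_int (\<lambda>x. g (Suc k) x - g k x)" for k by (intro sq_int_diff g)
  have small: "norm (l2 (\<lambda>x. g (Suc k) x - g k x)) < (1/2) ^ k" for k
    using N[of k "r (Suc k)" "r k"] r by (simp add: l2_diff f g_def)
  \<comment> \<open>Where the sequence diverges, \<open>lim\<close> returns some unspecified value,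
    but the same one for the same sequence. This keeps \<open>G\<close> periodic on the whole space
    although convergence is shown on one cell only.\<close>
  define G where "G x = lim (\<lambda>k. g k x)" for x
  have [measurable]: "G \<in> borel_measurable borel" unfolding G_def by measurable
  have perG: "periodic G"
    unfolding periodic_def
  proof
    fix i
    have "AE x in lborel. \<forall>k. g k (x + axis i 1) = g k x"
      using sq_intD(2)[OF g] by (subst AE_all_countable) (auto simp: periodic_def)
    then show "AE x in lborel. G (x + axis i 1) = G x"
    proof (rule eventually_mono)
      fix x assume "\<forall>k. g k (x + axis i 1) = g k x"
      then show "G (x + axis i 1) = G x" by (simp only: G_def)
    qed
  qed
  have "(\<integral>\<^sup>+x\<in>cell 0. (\<Sum>k. ennreal \<bar>g (Suc k) x - g k x\<bar>) \<partial>lborel)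
      = (\<Sum>k. \<integral>\<^sup>+x\<in>cell 0. ennreal \<bar>g (Suc k) x - g k x\<bar> \<partial>lborel)"
    by (subst nn_integral_suminf[symmetric]) (auto simp: ennreal_suminf_multc)
  also have "\<dots> \<le> (\<Sum>k. ennreal ((1/2) ^ k))"
  proof (intro suminf_le allI)
    fix k
    have "(\<integral>\<^sup>+x\<in>cell 0. ennreal \<bar>g (Suc k) x - g k x\<bar> \<partial>lborel) = ennreal (cint (\<lambda>x. \<bar>g (Suc k) x - g k x\<bar>))"
      using sq_int_integrable[OF sq_int_abs[OF sqd[of k]]]
      unfolding set_lebesgue_integral_def set_integrable_def
      by (subst nn_integral_eq_integral[symmetric]) (auto intro!: nn_integral_cong simp: indicator_def)
    also have "\<dots> \<le> ennreal ((1/2) ^ k)"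
      using cint_abs_le_norm[OF sqd[of k]] small[of k] by (intro ennreal_leI) linarith
    finally show "(\<integral>\<^sup>+x\<in>cell 0. ennreal \<bar>g (Suc k) x - g k x\<bar> \<partial>lborel) \<le> ennreal ((1/2) ^ k)" .
  qed auto
  also have "\<dots> = ennreal (\<Sum>k. (1/2) ^ k)"
    by (intro suminf_ennreal2) (auto intro: summable_geometric)
  also have "\<dots> < \<infinity>" by simp
  finally have "(\<integral>\<^sup>+x. (\<Sum>k. ennreal \<bar>g (Suc k) x - g k x\<bar>) * indicator (cell 0) x \<partial>lborel) \<noteq> \<infinity>" by simp
  then have "AE x in lborel. (\<Sum>k. ennreal \<bar>g (Suc k) x - g k x\<bar>) * indicator (cell 0) x \<noteq> \<infinity>"
    by (intro nn_integral_noteq_infinite) auto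
  then have lim: "AE x in lborel. x \<in> cell 0 \<longrightarrow> (\<lambda>k. g k x) \<longlonglongrightarrow> G x"
  proof eventually_elim
    fix x assume *: "(\<Sum>k. ennreal \<bar>g (Suc k) x - g k x\<bar>) * indicator (cell 0) x \<noteq> \<infinity>"
    show "x \<in> cell 0 \<longrightarrow> (\<lambda>k. g k x) \<longlonglongrightarrow> G x"
    proof
      assume "x \<in> cell 0"
      then have "summable (\<lambda>k. \<bar>g (Suc k) x - g k x\<bar>)"
        using * by (intro summable_suminf_not_top) auto
      then have "summable (\<lambda>k. g (Suc k) x - g k x)" by (rule summable_rabs_cancel)
      then have "convergent (\<lambda>k. g k x)"
        by (simp add: summable_iff_convergent sum_lessThan_telescope[of "\<lambda>k. g k x"] convergent_diff_const_right_iff)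
      then show "(\<lambda>k. g k x) \<longlonglongrightarrow> G x" unfolding G_def convergent_LIMSEQ_iff .
    qed
  qed
  have fatou: "(\<integral>\<^sup>+x\<in>cell 0. ennreal ((f n x - G x)\<^sup>2) \<partial>lborel) \<le> ennreal (((1/2) ^ k)\<^sup>2)" if n: "n \<ge> N k" for n k
  proof -
    have "(\<integral>\<^sup>+x\<in>cell 0. ennreal ((f n x - G x)\<^sup>2) \<partial>lborel)
        = (\<integral>\<^sup>+x. liminf (\<lambda>j. ennreal ((f n x - g j x)\<^sup>2) * indicator (cell 0) x) \<partial>lborel)"
    proof (rule nn_integral_cong_AE)
      show "AE x in lborel. ennreal ((f n x - G x)\<^sup>2) * indicator (cell 0) x
          = liminf (\<lambda>j. ennreal ((f n x - g j x)\<^sup>2) * indicator (cell 0) x)"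
        using lim
      proof eventually_elim
        fix x assume *: "x \<in> cell 0 \<longrightarrow> (\<lambda>k. g k x) \<longlonglongrightarrow> G x"
        show "ennreal ((f n x - G x)\<^sup>2) * indicator (cell 0) x
          = liminf (\<lambda>j. ennreal ((f n x - g j x)\<^sup>2) * indicator (cell 0) x)"
        proof (cases "x \<in> cell 0")
          case True
          then have "(\<lambda>j. ennreal ((f n x - g j x)\<^sup>2)) \<longlonglongrightarrow> ennreal ((f n x - G x)\<^sup>2)"
            using * by (intro tendsto_ennrealI tendsto_intros) auto
          from lim_imp_Liminf[OF _ this] show ?thesis using True by simp
        qed (simp add: Liminf_const)
      qed
    qed
    also have "\<dots> \<le> liminf (\<lambda>j. \<integral>\<^sup>+x. ennreal ((f n x - g j x)\<^sup>2) * indicator (cell 0) x \<partial>lborel)"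
      by (rule nn_integral_liminf) measurable
    also have "\<dots> \<le> ennreal (((1/2) ^ k)\<^sup>2)"
    proof (rule Liminf_le, simp)
      show "\<forall>\<^sub>F j in sequentially. (\<integral>\<^sup>+x. ennreal ((f n x - g j x)\<^sup>2) * indicator (cell 0) x \<partial>lborel) \<le> ennreal (((1/2) ^ k)\<^sup>2)"
      proof (rule eventually_sequentiallyI[of k])
        fix j assume "k \<le> j"
        have "norm (l2 (\<lambda>x. f n x - g j x)) < (1/2) ^ k"
          using N[of k n "r j"] r[OF \<open>k \<le> j\<close>] n by (simp add: l2_diff f g_def)
        then have "(norm (l2 (\<lambda>x. f n x - g j x)))\<^sup>2 \<le> ((1/2) ^ k)\<^sup>2"
          by (intro power_mono) auto
        moreover have d: "sq_int (\<lambda>x. f n x - g j x)" by (intro sq_int_diff f g)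
        moreover have "(\<integral>\<^sup>+x. ennreal ((f n x - g j x)\<^sup>2) * indicator (cell 0) x \<partial>lborel)
            = ennreal (cint (\<lambda>x. (f n x - g j x)\<^sup>2))"
          using sq_intD(3)[OF d] unfolding set_lebesgue_integral_def set_integrable_def
          by (subst nn_integral_eq_integral[symmetric]) (auto intro!: nn_integral_cong simp: indicator_def)
        ultimately show "(\<integral>\<^sup>+x. ennreal ((f n x - g j x)\<^sup>2) * indicator (cell 0) x \<partial>lborel) \<le> ennreal (((1/2) ^ k)\<^sup>2)"
          by (simp add: norm_l2_power2 ennreal_leI)
      qed
    qed
    finally show ?thesis .
  qed
  have sqfG: "sq_int (\<lambda>x. f n x - G x)" and nfG: "norm (l2 (\<lambda>x. f n x - G x)) \<le> (1/2) ^ k"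
    if n: "n \<ge> N k" for n k
  proof -
    have eq: "(\<integral>\<^sup>+x. ennreal (norm (indicat_real (cell 0) x *\<^sub>R (f n x - G x)\<^sup>2)) \<partial>lborel)
        = (\<integral>\<^sup>+x\<in>cell 0. ennreal ((f n x - G x)\<^sup>2) \<partial>lborel)"
      by (intro nn_integral_cong) (auto simp: indicator_def)
    have int: "set_integrable lborel (cell 0) (\<lambda>x. (f n x - G x)\<^sup>2)"
      unfolding set_integrable_def integrable_iff_bounded
      using fatou[OF n] eq by (auto intro: le_less_trans)
    then show s: "sq_int (\<lambda>x. f n x - G x)"
      using periodic_compose2[OF sq_intD(2)[OF f(1)] perG, of "(-)"] by (simp add: sq_int_def)
    have "ennreal (cint (\<lambda>x. (f n x - G x)\<^sup>2)) = (\<integral>\<^sup>+x\<in>cell 0. ennreal ((f n x - G x)\<^sup>2) \<partial>lborel)"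
      using int unfolding set_lebesgue_integral_def set_integrable_def
      by (subst nn_integral_eq_integral[symmetric]) (auto intro!: nn_integral_cong simp: indicator_def)
    then have "ennreal (cint (\<lambda>x. (f n x - G x)\<^sup>2)) \<le> ennreal (((1/2) ^ k)\<^sup>2)"
      using fatou[OF n] by simp
    then have "(norm (l2 (\<lambda>x. f n x - G x)))\<^sup>2 \<le> ((1/2) ^ k)\<^sup>2"
      unfolding norm_l2_power2[OF s] by (subst (asm) ennreal_le_iff) simp_all
    then show "norm (l2 (\<lambda>x. f n x - G x)) \<le> (1/2) ^ k" by (rule power2_le_imp_le) simp
  qed
  have sqG: "sq_int G"
    using sq_int_diff[OF f(1) sqfG[OF order_refl], of "N 0" 0] by simp
  have "X \<longlonglongrightarrow> l2 G"
  proof (rule LIMSEQ_I)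
    fix e :: real assume "0 < e"
    then obtain k where k: "(1/2) ^ k < e" using real_arch_pow_inv[of e "1/2"] by auto
    show "\<exists>no. \<forall>n\<ge>no. norm (X n - l2 G) < e"
    proof (intro exI allI impI)
      fix n assume "n \<ge> N k"
      from nfG[OF this] k show "norm (X n - l2 G) < e" by (simp add: l2_diff f sqG)
    qed
  qed
  then show ?thesis by (auto simp: convergent_def)
qed

instance l2 :: (finite) complete_space
  by standard (rule l2_Cauchy_convergent)

subsection \<open>Convolution with test functions\<close>

text \<open>\<open>N\<close> does not depend on \<open>f\<close>, so integration over
  \<open>K\<close> against a bounded kernel is a bounded functional on \<open>'n l2\<close>.\<close>

lemma periodic_compact_bound:
  fixes K :: "(real ^ 'n) set"
  assumes "compact K"
  shows "\<exists>N::nat. \<forall>f. sq_int f \<longrightarrow> set_integrable lborel K f \<and> (LINT x:K|lborel. \<bar>f x\<bar>) \<le> real N * norm (l2 f)"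
proof -
  obtain N :: nat where N: "\<And>h :: real ^ 'n \<Rightarrow> ennreal. h \<in> borel_measurable borel \<Longrightarrow> periodic h \<Longrightarrow>
      (\<integral>\<^sup>+x\<in>K. h x \<partial>lborel) \<le> of_nat N * (\<integral>\<^sup>+x\<in>cell 0. h x \<partial>lborel)"
    using nn_integral_compact_le_cell[OF assms] by blast
  have K [measurable]: "K \<in> sets borel" using assms by (intro borel_closed compact_imp_closed)
  have "set_integrable lborel K f \<and> (LINT x:K|lborel. \<bar>f x\<bar>) \<le> real N * norm (l2 f)" if f: "sq_int f" for f
  proof -
    have [measurable]: "f \<in> borel_measurable borel" using f by (rule sq_intD)
    have eq: "(\<integral>\<^sup>+x\<in>S. ennreal \<bar>f x\<bar> \<partial>lborel) = (\<integral>\<^sup>+x. ennreal (norm (indicator S x *\<^sub>R f x)) \<partial>lborel)" for S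
      by (intro nn_integral_cong) (simp add: indicator_def)
    have "(\<integral>\<^sup>+x\<in>cell 0. ennreal \<bar>f x\<bar> \<partial>lborel) = ennreal (cint (\<lambda>x. \<bar>f x\<bar>))"
      using sq_int_integrable[OF sq_int_abs[OF f]] unfolding set_lebesgue_integral_def set_integrable_def
      by (subst nn_integral_eq_integral[symmetric]) (auto intro!: nn_integral_cong simp: indicator_def)
    also have "\<dots> \<le> ennreal (norm (l2 f))" by (intro ennreal_leI cint_abs_le_norm f)
    finally have c: "(\<integral>\<^sup>+x\<in>cell 0. ennreal \<bar>f x\<bar> \<partial>lborel) \<le> ennreal (norm (l2 f))" .
    have "(\<integral>\<^sup>+x\<in>K. ennreal \<bar>f x\<bar> \<partial>lborel) \<le> of_nat N * (\<integral>\<^sup>+x\<in>cell 0. ennreal \<bar>f x\<bar> \<partial>lborel)"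
      by (rule N) (auto intro: periodic_compose sq_intD(2)[OF f])
    also have "\<dots> \<le> of_nat N * ennreal (norm (l2 f))" by (rule mult_left_mono[OF c]) simp
    also have "\<dots> = ennreal (real N * norm (l2 f))"
      by (simp add: ennreal_mult ennreal_of_nat_eq_real_of_nat)
    finally have le: "(\<integral>\<^sup>+x\<in>K. ennreal \<bar>f x\<bar> \<partial>lborel) \<le> ennreal (real N * norm (l2 f))" .
    then have int: "set_integrable lborel K f"
      unfolding set_integrable_def integrable_iff_bounded eq[symmetric] by (auto intro: le_less_trans)
    have "ennreal (LINT x:K|lborel. \<bar>f x\<bar>) = (\<integral>\<^sup>+x\<in>K. ennreal \<bar>f x\<bar> \<partial>lborel)"
      using set_integrable_abs[OF int] unfolding set_lebesgue_integral_def set_integrable_def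
      by (subst nn_integral_eq_integral[symmetric]) (auto intro!: nn_integral_cong simp: indicator_def)
    then have "ennreal (LINT x:K|lborel. \<bar>f x\<bar>) \<le> ennreal (real N * norm (l2 f))" using le by simp
    then show ?thesis using int by (subst (asm) ennreal_le_iff) auto
  qed
  then show ?thesis by blast
qed

lemma sq_int_integrable_compact: "sq_int f \<Longrightarrow> compact K \<Longrightarrow> set_integrable lborel K f"
  using periodic_compact_bound by blast

lemma integrable_mult_compact_support:
  fixes f g :: "real ^ 'n \<Rightarrow> real"
  assumes f: "f \<in> borel_measurable borel" "set_integrable lborel K f" and K: "compact K"
    and g: "g \<in> borel_measurable borel" "\<And>x. \<bar>g x\<bar> \<le> B" "\<And>x. x \<notin> K \<Longrightarrow> g x = 0"
  shows "integrable lborel (\<lambda>x. f x * g x)" "\<bar>LINT x|lborel. f x * g x\<bar> \<le> B * (LINT x:K|lborel. \<bar>f x\<bar>)"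
proof -
  have fK: "integrable lborel (\<lambda>x. B * (indicator K x * \<bar>f x\<bar>))"
    using set_integrable_abs[OF f(2)] by (intro integrable_mult_right) (simp add: set_integrable_def)
  have le: "\<bar>f x * g x\<bar> \<le> B * (indicator K x * \<bar>f x\<bar>)" for x
  proof (cases "x \<in> K")
    case True
    then show ?thesis using mult_left_mono[OF g(2)[of x], of "\<bar>f x\<bar>"] by (simp add: abs_mult mult.commute)
  qed (simp add: g(3))
  show int: "integrable lborel (\<lambda>x. f x * g x)"
    by (rule Bochner_Integration.integrable_bound[OF fK])
       (use f g order_trans[OF le abs_ge_self] in \<open>auto intro!: borel_measurable_times\<close>)
  have "\<bar>LINT x|lborel. f x * g x\<bar> \<le> (LINT x|lborel. \<bar>f x * g x\<bar>)" by (rule integral_abs_bound)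
  also have "\<dots> \<le> (LINT x|lborel. B * (indicator K x * \<bar>f x\<bar>))"
    using int fK le by (intro integral_mono integrable_abs) auto
  also have "\<dots> = B * (LINT x:K|lborel. \<bar>f x\<bar>)" by (simp add: set_lebesgue_integral_def)
  finally show "\<bar>LINT x|lborel. f x * g x\<bar> \<le> B * (LINT x:K|lborel. \<bar>f x\<bar>)" .
qed

lemma test_function_support:
  assumes "test_function \<phi>"
  obtains M where "0 < M" "\<And>x. norm x > M \<Longrightarrow> \<phi> x = 0"
proof -
  obtain M where "0 < M" "\<forall>x\<in>{x. \<phi> x \<noteq> 0}. norm x \<le> M"
    using test_functionD(2)[OF assms] bounded_pos by blast
  then show ?thesis using that[of M] by force
qed

lemma test_function_bounded:
  assumes "test_function \<phi>"
  obtains B where "0 < B" "\<And>x. \<bar>\<phi> x\<bar> \<le> B"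
proof -
  obtain M where M: "0 < M" "\<And>x. norm x > M \<Longrightarrow> \<phi> x = 0" using test_function_support[OF assms] by blast
  have "compact (\<phi> ` cball 0 M)"
    using smooth_continuous_on[OF test_functionD(1)[OF assms]] compact_cball by (rule compact_continuous_image)
  then obtain B where B: "0 < B" "\<forall>y\<in>\<phi> ` cball 0 M. norm y \<le> B"
    using compact_imp_bounded bounded_pos by blast
  have "\<bar>\<phi> x\<bar> \<le> B" for x
    using B M(2)[of x] by (cases "norm x > M") auto
  then show ?thesis using that B(1) by blast
qed

lemma test_function_uniformly_continuous:
  assumes "test_function \<phi>" "0 < e"
  obtains d where "0 < d" "\<And>x y. norm (x - y) < d \<Longrightarrow> \<bar>\<phi> x - \<phi> y\<bar> < e"
proof -
  obtain M where M: "0 < M" "\<And>x. norm x > M \<Longrightarrow> \<phi> x = 0" using test_function_support[OF assms(1)] by blast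
  have "uniformly_continuous_on (cball 0 (M + 1)) \<phi>"
    using smooth_continuous_on[OF test_functionD(1)[OF assms(1)]] compact_cball
    by (rule compact_uniformly_continuous)
  then obtain d where d: "0 < d" "\<And>x y. x \<in> cball 0 (M + 1) \<Longrightarrow> y \<in> cball 0 (M + 1) \<Longrightarrow> dist y x < d \<Longrightarrow> dist (\<phi> y) (\<phi> x) < e"
    unfolding uniformly_continuous_on_def using assms(2) by meson
  have "\<bar>\<phi> x - \<phi> y\<bar> < e" if xy: "norm (x - y) < min d 1" for x y
  proof (cases "x \<in> cball 0 (M + 1) \<and> y \<in> cball 0 (M + 1)")
    case True
    then show ?thesis using d(2)[of y x] xy by (simp add: dist_norm)
  next
    case False
    have "norm x \<le> norm y + norm (x - y)" "norm y \<le> norm x + norm (x - y)"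
      using norm_triangle_ineq[of y "x - y"] norm_triangle_ineq[of x "y - x"] by (auto simp: norm_minus_commute)
    then have "norm x > M" "norm y > M" using False xy by auto
    then show ?thesis using M assms(2) by simp
  qed
  then show ?thesis using that[of "min d 1"] d(1) by auto
qed

lemma frechet_derivative_eq_sum_pd:
  assumes "f differentiable (at x)"
  shows "frechet_derivative f (at x) h = (\<Sum>i\<in>UNIV. h $ i * pd i f x)"
proof -
  have lin: "linear (frechet_derivative f (at x))"
    using assms frechet_derivative_works has_derivative_linear by blast
  have "h = (\<Sum>i\<in>UNIV. (h $ i) *\<^sub>R axis i 1)"
    by (simp add: vec_eq_iff axis_def if_distrib cong: if_cong)
  then have "frechet_derivative f (at x) h = frechet_derivative f (at x) (\<Sum>i\<in>UNIV. (h $ i) *\<^sub>R axis i 1)" by simp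
  also have "\<dots> = (\<Sum>i\<in>UNIV. h $ i * pd i f x)"
    by (simp add: linear_sum[OF lin] linear_cmul[OF lin])
  finally show ?thesis .
qed

lemma smooth_line_derivative:
  assumes "smooth f"
  shows "((\<lambda>s. f (z + s *\<^sub>R h)) has_real_derivative (\<Sum>i\<in>UNIV. h $ i * pd i f (z + s *\<^sub>R h))) (at s within S)"
proof -
  have l: "((\<lambda>s. z + s *\<^sub>R h) has_derivative (\<lambda>t. t *\<^sub>R h)) (at s within S)"
    by (auto intro!: derivative_eq_intros)
  have "((\<lambda>s. f (z + s *\<^sub>R h)) has_derivative (\<lambda>t. frechet_derivative f (at (z + s *\<^sub>R h)) (t *\<^sub>R h))) (at s within S)"
    using has_derivative_compose[OF l smooth_has_derivative[OF assms]] .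
  moreover have "frechet_derivative f (at (z + s *\<^sub>R h)) (t *\<^sub>R h) = (\<Sum>i\<in>UNIV. h $ i * pd i f (z + s *\<^sub>R h)) * t" for t
    by (subst frechet_derivative_eq_sum_pd[OF smooth_differentiable[OF assms]])
       (simp add: sum_distrib_left mult_ac)
  ultimately show ?thesis by (simp add: has_field_derivative_def)
qed

text \<open>Mean value inequality for the remainder along the segment from \<open>z\<close> to
  \<open>z + h\<close>; the dimension appears because each component of \<open>h\<close> is
  estimated by \<open>norm h\<close>.\<close>

lemma smooth_remainder_bound:
  fixes \<phi> :: "real ^ 'n \<Rightarrow> real"
  assumes "smooth \<phi>" and close: "\<And>i s. 0 \<le> s \<Longrightarrow> s \<le> 1 \<Longrightarrow> \<bar>pd i \<phi> (z + s *\<^sub>R h) - pd i \<phi> z\<bar> \<le> e"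
  shows "\<bar>\<phi> (z + h) - \<phi> z - (\<Sum>i\<in>UNIV. h $ i * pd i \<phi> z)\<bar> \<le> real CARD('n) * e * norm h"
proof -
  define L where "L = (\<Sum>i\<in>UNIV. h $ i * pd i \<phi> z)"
  let ?\<psi> = "\<lambda>s. \<phi> (z + s *\<^sub>R h) - s * L"
  have der: "(?\<psi> has_real_derivative (\<Sum>i\<in>UNIV. h $ i * pd i \<phi> (z + s *\<^sub>R h)) - L) (at s within {0..1})" for s
    using DERIV_diff[OF smooth_line_derivative[OF assms(1)] DERIV_cmult_Id[of L]]
    by (simp add: mult.commute)
  have bnd: "norm ((\<Sum>i\<in>UNIV. h $ i * pd i \<phi> (z + s *\<^sub>R h)) - L) \<le> real CARD('n) * e * norm h"
    if s: "s \<in> {0..1}" for s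
  proof -
    have "norm ((\<Sum>i\<in>UNIV. h $ i * pd i \<phi> (z + s *\<^sub>R h)) - L)
        = \<bar>\<Sum>i\<in>UNIV. h $ i * (pd i \<phi> (z + s *\<^sub>R h) - pd i \<phi> z)\<bar>"
      by (simp add: L_def sum_subtractf right_diff_distrib)
    also have "\<dots> \<le> (\<Sum>i\<in>(UNIV :: 'n set). norm h * e)"
      by (rule order_trans[OF sum_abs], rule sum_mono)
         (use s in \<open>auto simp: abs_mult intro!: mult_mono close component_le_norm_cart\<close>)
    finally show ?thesis by (simp add: mult_ac)
  qed
  have "norm (?\<psi> 1 - ?\<psi> 0) \<le> (real CARD('n) * e * norm h) * norm (1 - 0 :: real)"
    by (rule field_differentiable_bound[of "{0..1}"]) (use der bnd in auto)
  then show ?thesis by (simp add: L_def algebra_simps)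
qed

lemma test_function_remainder:
  fixes \<phi> :: "real ^ 'n \<Rightarrow> real"
  assumes "test_function \<phi>" "0 < e"
  obtains d where "0 < d" "\<And>z h. norm h < d \<Longrightarrow>
    \<bar>\<phi> (z + h) - \<phi> z - (\<Sum>i\<in>UNIV. h $ i * pd i \<phi> z)\<bar> \<le> e * norm h"
proof -
  define e' where "e' = e / real CARD('n)"
  have e': "0 < e'" using assms(2) by (simp add: e'_def)
  have "\<forall>i. \<exists>d>0. \<forall>x y. norm (x - y) < d \<longrightarrow> \<bar>pd i \<phi> x - pd i \<phi> y\<bar> < e'"
    using test_function_uniformly_continuous[OF test_function_pd[OF assms(1)] e'] by metis
  then obtain \<delta> where \<delta>: "\<And>i. 0 < \<delta> i" "\<And>i x y. norm (x - y) < \<delta> i \<Longrightarrow> \<bar>pd i \<phi> x - pd i \<phi> y\<bar> < e'" by metis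
  define d where "d = Min (range \<delta>)"
  have d: "0 < d" "d \<le> \<delta> i" for i using \<delta>(1) by (auto simp: d_def)
  have "\<bar>\<phi> (z + h) - \<phi> z - (\<Sum>i\<in>UNIV. h $ i * pd i \<phi> z)\<bar> \<le> e * norm h" if h: "norm h < d" for z h
  proof -
    have "\<bar>pd i \<phi> (z + s *\<^sub>R h) - pd i \<phi> z\<bar> \<le> e'" if s: "0 \<le> s" "s \<le> 1" for i s
    proof -
      have "norm (s *\<^sub>R h) \<le> norm h" using s by (simp add: mult_left_le_one_le)
      then have "norm ((z + s *\<^sub>R h) - z) < \<delta> i" using h d(2)[of i] by simp
      then show ?thesis using \<delta>(2) less_imp_le by blast
    qed
    from smooth_remainder_bound[OF test_functionD(1)[OF assms(1)] this] show ?thesis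
      by (simp add: e'_def)
  qed
  then show ?thesis using that d(1) by blast
qed

text \<open>The integral runs over the whole space, not over a cell: it is meant for periodic
  \<open>f\<close> and \<open>\<eta>\<close> of bounded support, for which the result is smooth and
  periodic.\<close>

definition conv :: "(real ^ 'n \<Rightarrow> real) \<Rightarrow> (real ^ 'n \<Rightarrow> real) \<Rightarrow> real ^ 'n \<Rightarrow> real" where
  "conv f \<eta> x = (LINT y|lborel. f y * \<eta> (x - y))"

lemma conv_integrable:
  assumes f: "sq_int f" and \<eta>: "test_function \<eta>"
  shows "integrable lborel (\<lambda>y. f y * \<eta> (x - y))"
proof -
  obtain M where M: "0 < M" "\<And>x. norm x > M \<Longrightarrow> \<eta> x = 0" using test_function_support[OF \<eta>] by blast
  obtain B where B: "0 < B" "\<And>x. \<bar>\<eta> x\<bar> \<le> B" using test_function_bounded[OF \<eta>] by blast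
  have [measurable]: "\<eta> \<in> borel_measurable borel" using \<eta> by (rule borel_measurable_test_function)
  show ?thesis
  proof (rule integrable_mult_compact_support(1)[of _ "cball x M"])
    show "set_integrable lborel (cball x M) f" using f by (intro sq_int_integrable_compact) auto
    show "\<eta> (x - y) = 0" if "y \<notin> cball x M" for y using that M(2)[of "x - y"] by (simp add: dist_norm)
  qed (use B sq_intD(1)[OF f] in auto)
qed

text \<open>The first order remainder of \<open>\<eta>\<close> is small uniformly in its base point,
  so it can be integrated against \<open>f\<close>.\<close>

lemma conv_has_derivative:
  fixes f :: "real ^ 'n \<Rightarrow> real"
  assumes f: "sq_int f" and \<eta>: "test_function \<eta>"
  shows "(conv f \<eta> has_derivative (\<lambda>h. \<Sum>i\<in>UNIV. h $ i * conv f (pd i \<eta>) x)) (at x)"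
proof -
  obtain M where M: "0 < M" "\<And>x. norm x > M \<Longrightarrow> \<eta> x = 0" using test_function_support[OF \<eta>] by blast
  have M': "pd i \<eta> z = 0" if "norm z > M" for i z
  proof -
    have "closure {x. \<eta> x \<noteq> 0} \<subseteq> cball 0 M" using M(2) by (intro closure_minimal) (force, simp)
    then show ?thesis using that by (intro pd_eq_0_outside_closure) auto
  qed
  note bm = borel_measurable_test_function[OF \<eta>] borel_measurable_test_function[OF test_function_pd[OF \<eta>]]
  note [measurable] = bm sq_intD(1)[OF f]
  \<comment> \<open>The margin 1 keeps the shifted kernel supported in \<open>K\<close> for every
    increment \<open>h\<close> of norm below 1.\<close>
  define K where "K = cball x (M + 1)"
  define C where "C = (LINT y:K|lborel. \<bar>f y\<bar>)"
  have C: "0 \<le> C" unfolding C_def set_lebesgue_integral_def by (intro integral_nonneg_AE) auto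
  have intK: "set_integrable lborel K f" using f unfolding K_def by (intro sq_int_integrable_compact) auto
  let ?R = "\<lambda>h z. \<eta> (z + h) - \<eta> z - (\<Sum>i\<in>UNIV. h $ i * pd i \<eta> z)"
  have eq: "conv f \<eta> (x + h) - conv f \<eta> x - (\<Sum>i\<in>UNIV. h $ i * conv f (pd i \<eta>) x)
      = (LINT y|lborel. f y * ?R h (x - y))" for h
  proof -
    have i1: "integrable lborel (\<lambda>y. f y * \<eta> (x - y + h))"
      using conv_integrable[OF f \<eta>, of "x + h"] by (simp add: algebra_simps)
    have i2: "integrable lborel (\<lambda>y. f y * \<eta> (x - y))" by (rule conv_integrable[OF f \<eta>])
    have i3: "integrable lborel (\<lambda>y. h $ i * (f y * pd i \<eta> (x - y)))" for i
      by (intro integrable_mult_right conv_integrable f test_function_pd \<eta>)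
    have "(LINT y|lborel. f y * ?R h (x - y)) = (LINT y|lborel. f y * \<eta> (x - y + h) - f y * \<eta> (x - y)
        - (\<Sum>i\<in>UNIV. h $ i * (f y * pd i \<eta> (x - y))))"
      by (intro Bochner_Integration.integral_cong) (simp_all add: algebra_simps sum_distrib_left)
    also have "\<dots> = (LINT y|lborel. f y * \<eta> (x - y + h)) - (LINT y|lborel. f y * \<eta> (x - y))
        - (\<Sum>i\<in>UNIV. LINT y|lborel. h $ i * (f y * pd i \<eta> (x - y)))"
      using i1 i2 i3 by (simp add: Bochner_Integration.integral_diff Bochner_Integration.integral_sum del: integral_mult_right_zero integral_mult_right)
    also have "\<dots> = conv f \<eta> (x + h) - conv f \<eta> x - (\<Sum>i\<in>UNIV. h $ i * conv f (pd i \<eta>) x)"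
      by (simp add: conv_def add_diff_eq add_diff_add diff_add_eq)
    finally show ?thesis ..
  qed
  have small: "\<exists>d>0. \<forall>h. norm h < d \<longrightarrow>
     norm (conv f \<eta> (x + h) - conv f \<eta> x - (\<Sum>i\<in>UNIV. h $ i * conv f (pd i \<eta>) x)) \<le> e * norm h"
    if e: "0 < e" for e
  proof -
    \<comment> \<open>The summand 1 guards against \<open>C = 0\<close>.\<close>
    define e' where "e' = e / (C + 1)"
    have e': "0 < e'" "e' * C \<le> e" using e C by (auto simp: e'_def field_simps)
    obtain d where d: "0 < d" "\<And>z h. norm h < d \<Longrightarrow> \<bar>?R h z\<bar> \<le> e' * norm h"
      using test_function_remainder[OF \<eta> e'(1)] by metis
    have "norm (conv f \<eta> (x + h) - conv f \<eta> x - (\<Sum>i\<in>UNIV. h $ i * conv f (pd i \<eta>) x)) \<le> e * norm h"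
      if h: "norm h < min d 1" for h
    proof -
      have z: "?R h (x - y) = 0" if "y \<notin> K" for y
      proof -
        have "norm (x - y) > M + 1" using that by (simp add: K_def dist_norm)
        moreover have "norm (x - y) \<le> norm (x - y + h) + norm h"
          using norm_triangle_ineq4[of "x - y + h" h] by simp
        ultimately show ?thesis using M(2) M' h by simp
      qed
      have "\<bar>LINT y|lborel. f y * ?R h (x - y)\<bar> \<le> (e' * norm h) * (LINT y:K|lborel. \<bar>f y\<bar>)"
      proof (rule integrable_mult_compact_support(2)[OF sq_intD(1)[OF f] intK])
        show "(\<lambda>y. ?R h (x - y)) \<in> borel_measurable borel" by measurable
      qed (use d(2)[of h] h z in \<open>auto simp: K_def\<close>)
      also have "\<dots> \<le> e * norm h"
        using mult_right_mono[OF e'(2), of "norm h"] by (simp add: C_def mult_ac)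
      finally show ?thesis by (simp add: eq)
    qed
    then show ?thesis using d(1) by (intro exI[of _ "min d 1"]) auto
  qed
  show ?thesis
    unfolding has_derivative_at_alt
  proof (intro conjI allI impI)
    show "bounded_linear (\<lambda>h. \<Sum>i\<in>UNIV. h $ i * conv f (pd i \<eta>) x)"
      by (intro bounded_linear_sum bounded_linear_mult_const bounded_linear_vec_nth)
    fix e :: real assume "0 < e"
    from small[OF this] obtain d where d: "0 < d" "\<And>h. norm h < d \<Longrightarrow>
       norm (conv f \<eta> (x + h) - conv f \<eta> x - (\<Sum>i\<in>UNIV. h $ i * conv f (pd i \<eta>) x)) \<le> e * norm h" by blast
    show "\<exists>d>0. \<forall>y. norm (y - x) < d \<longrightarrow>
       norm (conv f \<eta> y - conv f \<eta> x - (\<Sum>i\<in>UNIV. (y - x) $ i * conv f (pd i \<eta>) x)) \<le> e * norm (y - x)"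
    proof (intro exI conjI allI impI)
      fix y assume "norm (y - x) < d"
      from d(2)[OF this] show "norm (conv f \<eta> y - conv f \<eta> x - (\<Sum>i\<in>UNIV. (y - x) $ i * conv f (pd i \<eta>) x)) \<le> e * norm (y - x)"
        by simp
    qed (rule d(1))
  qed
qed

lemma pd_conv:
  assumes "sq_int f" "test_function \<eta>"
  shows "pd i (conv f \<eta>) = conv f (pd i \<eta>)"
proof
  fix x
  have "pd i (conv f \<eta>) x = (\<Sum>j\<in>UNIV. axis i 1 $ j * conv f (pd j \<eta>) x)"
    by (rule pd_eqI[OF conv_has_derivative[OF assms]])
  also have "\<dots> = (\<Sum>j\<in>UNIV. if j = i then conv f (pd j \<eta>) x else 0)"
    by (intro sum.cong) (auto simp: axis_def)
  finally show "pd i (conv f \<eta>) x = conv f (pd i \<eta>) x" by simp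
qed

lemma smooth_conv:
  assumes f: "sq_int f" and \<eta>: "test_function \<eta>"
  shows "smooth (conv f \<eta>)"
proof (rule smooth_coinduct[of "\<lambda>g. \<exists>\<eta>. test_function \<eta> \<and> g = conv f \<eta>"])
  show "g differentiable (at x)" if "\<exists>\<eta>. test_function \<eta> \<and> g = conv f \<eta>" for g x
    using that conv_has_derivative[OF f] differentiable_def by blast
  show "\<exists>\<eta>. test_function \<eta> \<and> pd i g = conv f \<eta>" if "\<exists>\<eta>. test_function \<eta> \<and> g = conv f \<eta>" for g i
    using that pd_conv[OF f] test_function_pd by metis
qed (use \<eta> in blast)

definition smooth_periodic :: "(real ^ 'n \<Rightarrow> real) \<Rightarrow> bool" where
  "smooth_periodic p \<longleftrightarrow> smooth p \<and> (\<forall>k x. p (x + axis k 1) = p x)"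

lemma smooth_periodicD:
  assumes "smooth_periodic p" shows "smooth p" "p (x + axis k 1) = p x"
  using assms by (auto simp: smooth_periodic_def)

lemma smooth_periodic_conv:
  assumes f: "sq_int f" and \<eta>: "test_function \<eta>"
  shows "smooth_periodic (conv f \<eta>)"
  unfolding smooth_periodic_def
proof (intro conjI allI)
  show "smooth (conv f \<eta>)" using assms by (rule smooth_conv)
  fix k and x :: "real ^ 'a"
  let ?e = "axis k 1 :: real ^ 'a"
  note [measurable] = borel_measurable_test_function[OF \<eta>] sq_intD(1)[OF f]
  have "conv f \<eta> (x + ?e) = (LINT y|lborel. f (?e + y) * \<eta> (x + ?e - (?e + y)))"
    unfolding conv_def by (rule integral_lborel_translate[symmetric]) measurable
  also have "\<dots> = conv f \<eta> x"
    unfolding conv_def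
  proof (rule integral_cong_AE)
    have "AE y in lborel. f (y + ?e) = f y" using sq_intD(2)[OF f] by (simp add: periodic_def)
    then show "AE y in lborel. f (?e + y) * \<eta> (x + ?e - (?e + y)) = f y * \<eta> (x - y)"
      by (rule eventually_mono) (simp add: add.commute)
  qed measurable
  finally show "conv f \<eta> (x + ?e) = conv f \<eta> x" .
qed

lemma smooth_periodic_pd:
  assumes "smooth_periodic p" shows "smooth_periodic (pd i p)"
  unfolding smooth_periodic_def
proof (intro conjI allI)
  show "smooth (pd i p)" using assms by (simp add: smooth_pd smooth_periodicD)
  fix k x
  have "(\<lambda>x. p (axis k 1 + 1 *\<^sub>R x)) = p"
    using smooth_periodicD(2)[OF assms] by (simp add: fun_eq_iff add.commute)
  then show "pd i p (x + axis k 1) = pd i p x"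
    using pd_affine[of p "axis k 1" 1 x i] smooth_differentiable[OF smooth_periodicD(1)[OF assms]]
    by (simp add: add.commute)
qed

lemma sq_int_smooth_periodic:
  assumes "smooth_periodic p" shows "sq_int p"
  unfolding sq_int_def
proof (intro conjI)
  have c: "continuous_on S p" for S using assms by (intro smooth_continuous_on smooth_periodicD(1))
  show "p \<in> borel_measurable borel" using c by (rule borel_measurable_continuous_onI)
  show "periodic p" using assms by (simp add: periodic_def smooth_periodicD)
  have "set_integrable lborel (cbox 0 (0 + 1)) (\<lambda>x. (p x)\<^sup>2)"
    unfolding set_integrable_def by (intro borel_integrable_compact compact_cbox continuous_intros c)
  then show "set_integrable lborel (cell 0) (\<lambda>x. (p x)\<^sup>2)"
    by (rule set_integrable_subset) (auto simp: cell_def box_subset_cbox)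
qed

lemma smooth_periodic_linear_combination:
  "smooth_periodic p \<Longrightarrow> smooth_periodic q \<Longrightarrow> smooth_periodic (\<lambda>x. p x + c * q x)"
  by (simp add: smooth_periodic_def smooth_linear_combination)

lemma smooth_periodic_const: "smooth_periodic (\<lambda>x. c)"
  by (simp add: smooth_periodic_def smooth_const)

lemma smooth_periodic_sum: "(\<And>i. i \<in> I \<Longrightarrow> smooth_periodic (f i)) \<Longrightarrow> smooth_periodic (\<lambda>x. \<Sum>i\<in>I. f i x)"
  by (simp add: smooth_periodic_def smooth_sum)

lemma smooth_periodic_mult:
  "smooth_periodic p \<Longrightarrow> smooth_periodic q \<Longrightarrow> smooth_periodic (\<lambda>x. p x * q x)"
  by (simp add: smooth_periodic_def smooth_mult)

abbreviation reflect :: "(real ^ 'n \<Rightarrow> real) \<Rightarrow> real ^ 'n \<Rightarrow> real" where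
  "reflect \<eta> \<equiv> \<lambda>y. \<eta> (- y)"

lemma test_function_reflect: "test_function \<eta> \<Longrightarrow> test_function (reflect \<eta>)"
  using test_function_affine[of \<eta> "-1" 0] by simp

lemma conv_altdef:
  assumes f: "sq_int f" and \<eta>: "test_function \<eta>"
  shows "conv f \<eta> x = (LINT y|lborel. f (x + y) * \<eta> (- y))"
proof -
  note [measurable] = borel_measurable_test_function[OF \<eta>] sq_intD(1)[OF f]
  have "conv f \<eta> x = (LINT y|lborel. f (x + y) * \<eta> (x - (x + y)))"
    unfolding conv_def by (rule integral_lborel_translate[symmetric]) measurable
  then show ?thesis by simp
qed

lemma sq_int_translate: "sq_int f \<Longrightarrow> sq_int (\<lambda>x. f (a + x))"
  unfolding sq_int_def
  using integral_cell_translate(1)[of "\<lambda>x. (f x)\<^sup>2" a] periodic_compose[of f "\<lambda>t. t\<^sup>2"]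
  by (auto intro: periodic_translate)

lemma norm_l2_translate: "sq_int f \<Longrightarrow> norm (l2 (\<lambda>x. f (a + x))) = norm (l2 f)"
proof -
  assume f: "sq_int f"
  have "(norm (l2 (\<lambda>x. f (a + x))))\<^sup>2 = (norm (l2 f))\<^sup>2"
    unfolding norm_l2_power2[OF f] norm_l2_power2[OF sq_int_translate[OF f]]
    using f by (intro integral_cell_translate(2)) (auto simp: sq_int_def intro: periodic_compose)
  then show ?thesis by (rule power2_eq_imp_eq) simp_all
qed

lemma integrable_test_function: "test_function \<eta> \<Longrightarrow> integrable lborel \<eta>"
  using conv_integrable[OF sq_int_const[of 1] test_function_reflect, of \<eta> 0] by simp

text \<open>Cauchy-Schwarz and translation invariance of the norm give the integrable majorant for
  Fubini's theorem. The kernel is merely integrable so that it can be a test function in the adjoint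
  relation and the indicator of a cell in the Poincare inequality.\<close>

lemma fubini_translate:
  fixes f g :: "real ^ 'n \<Rightarrow> real"
  assumes f: "sq_int f" and g: "sq_int g" and \<eta>: "integrable lborel \<eta>"
  shows "cint (\<lambda>x. f x * (LINT y|lborel. g (x + y) * \<eta> y)) = (LINT y|lborel. \<eta> y * cint (\<lambda>x. f x * g (x + y)))"
proof -
  note [measurable] = borel_measurable_integrable[OF \<eta>] sq_intD(1)[OF f] sq_intD(1)[OF g]
  let ?G = "\<lambda>(y, x). \<eta> y * (indicator (cell 0) x * (f x * g (x + y)))"
  have gy: "sq_int (\<lambda>x. g (x + y))" for y using sq_int_translate[OF g, of y] by (simp add: add.commute)
  have fg: "integrable lborel (\<lambda>x. indicator (cell 0) x * (f x * g (x + y)))" for y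
    using sq_int_mult_integrable[OF f gy] by (simp add: set_integrable_def)
  have bound: "(LINT x|lborel. \<bar>indicator (cell 0) x * (f x * g (x + y))\<bar>) \<le> norm (l2 f) * norm (l2 g)" for y
  proof -
    have "(LINT x|lborel. \<bar>indicator (cell 0) x * (f x * g (x + y))\<bar>) = cint (\<lambda>x. \<bar>f x\<bar> * \<bar>g (x + y)\<bar>)"
      by (simp add: set_lebesgue_integral_def abs_mult)
    also have "\<dots> = l2 (\<lambda>x. \<bar>f x\<bar>) \<bullet> l2 (\<lambda>x. \<bar>g (x + y)\<bar>)"
      by (rule inner_l2[symmetric]) (intro sq_int_abs f gy)+
    also have "\<dots> \<le> norm (l2 (\<lambda>x. \<bar>f x\<bar>)) * norm (l2 (\<lambda>x. \<bar>g (x + y)\<bar>))" by (rule norm_cauchy_schwarz)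
    also have "norm (l2 (\<lambda>x. \<bar>h x\<bar>)) = norm (l2 h)" if h: "sq_int h" for h :: "real ^ 'n \<Rightarrow> real"
      using norm_l2_power2[OF h] norm_l2_power2[OF sq_int_abs[OF h]]
      by (intro power2_eq_imp_eq[OF _ norm_ge_zero norm_ge_zero]) simp
    note this[OF f]
    also have "norm (l2 (\<lambda>x. \<bar>g (x + y)\<bar>)) = norm (l2 g)"
      using norm_l2_translate[OF sq_int_abs[OF g], of y] norm_l2_power2[OF g] norm_l2_power2[OF sq_int_abs[OF g]]
      by (intro power2_eq_imp_eq[OF _ norm_ge_zero norm_ge_zero]) (simp add: add.commute)
    finally show ?thesis .
  qed
  have int: "integrable (lborel \<Otimes>\<^sub>M lborel) ?G"
  proof (rule lborel_pair.Fubini_integrable)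
    show "?G \<in> borel_measurable (lborel \<Otimes>\<^sub>M lborel)" by measurable
    show "AE y in lborel. integrable lborel (\<lambda>x. ?G (y, x))"
      using fg by (auto intro!: integrable_mult_right)
    show "integrable lborel (\<lambda>y. LINT x|lborel. norm (?G (y, x)))"
    proof (rule Bochner_Integration.integrable_bound)
      show "integrable lborel (\<lambda>y. \<eta> y * (norm (l2 f) * norm (l2 g)))"
        by (intro integrable_mult_left \<eta>)
      show "(\<lambda>y. LINT x|lborel. norm (?G (y, x))) \<in> borel_measurable lborel" by measurable
      show "AE y in lborel. norm (LINT x|lborel. norm (?G (y, x))) \<le> norm (\<eta> y * (norm (l2 f) * norm (l2 g)))"
      proof (rule AE_I2)
        fix y
        have "norm (LINT x|lborel. norm (?G (y, x))) = \<bar>\<eta> y\<bar> * (LINT x|lborel. \<bar>indicator (cell 0) x * (f x * g (x + y))\<bar>)"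
          by (simp add: abs_mult)
        also have "\<dots> \<le> \<bar>\<eta> y\<bar> * (norm (l2 f) * norm (l2 g))" by (rule mult_left_mono[OF bound]) simp
        finally show "norm (LINT x|lborel. norm (?G (y, x))) \<le> norm (\<eta> y * (norm (l2 f) * norm (l2 g)))"
          by (simp add: abs_mult)
      qed
    qed
  qed
  have "(LINT y|lborel. \<eta> y * cint (\<lambda>x. f x * g (x + y))) = (LINT y|lborel. LINT x|lborel. ?G (y, x))"
    by (simp add: set_lebesgue_integral_def)
  also have "\<dots> = (LINT x|lborel. LINT y|lborel. ?G (y, x))"
    using lborel_pair.Fubini_integral[of "\<lambda>y x. ?G (y, x)"] int by simp
  also have "\<dots> = cint (\<lambda>x. f x * (LINT y|lborel. g (x + y) * \<eta> y))"
    unfolding set_lebesgue_integral_def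
  proof (rule Bochner_Integration.integral_cong[OF refl])
    fix x
    have "(LINT y|lborel. ?G (y, x)) = (LINT y|lborel. (indicator (cell 0) x * f x) * (g (x + y) * \<eta> y))"
      by (intro Bochner_Integration.integral_cong) (auto simp: mult_ac)
    then show "(LINT y|lborel. ?G (y, x)) = indicator (cell 0) x *\<^sub>R (f x * (LINT y|lborel. g (x + y) * \<eta> y))"
      by (simp add: mult.assoc)
  qed
  finally show ?thesis ..
qed

text \<open>Convolution is an average of translations, and the adjoint of a translation is the
  opposite translation; hence the reflected kernel.\<close>

lemma cint_conv_adjoint:
  assumes f: "sq_int f" and g: "sq_int g" and \<eta>: "test_function \<eta>"
  shows "cint (\<lambda>x. f x * conv g \<eta> x) = cint (\<lambda>x. conv f (reflect \<eta>) x * g x)"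
proof -
  note [measurable] = borel_measurable_test_function[OF \<eta>] sq_intD(1)[OF f] sq_intD(1)[OF g]
  have gf: "cint (\<lambda>x. g x * f (x + y)) = cint (\<lambda>x. f x * g (x + (- y)))" for y
  proof -
    have "cint (\<lambda>x. f (y + x) * g (y + x + (- y))) = cint (\<lambda>x. f x * g (x + (- y)))"
    proof (rule integral_cell_translate(2))
      have gy: "sq_int (\<lambda>x. g (x + (- y)))" using sq_int_translate[OF g, of "- y"] by (simp add: add.commute)
      show "set_integrable lborel (cell 0) (\<lambda>x. f x * g (x + - y))" by (rule sq_int_mult_integrable[OF f gy])
      show "periodic (\<lambda>x. f x * g (x + - y))"
        by (rule periodic_compose2[OF sq_intD(2)[OF f] sq_intD(2)[OF gy]])
    qed measurable
    then show ?thesis by (simp add: add.commute mult.commute)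
  qed
  have meas: "(\<lambda>y. cint (\<lambda>x. f x * g (x + y))) \<in> borel_measurable borel"
    unfolding set_lebesgue_integral_def by measurable
  have "cint (\<lambda>x. f x * conv g \<eta> x) = cint (\<lambda>x. f x * (LINT y|lborel. g (x + y) * reflect \<eta> y))"
    by (simp add: conv_altdef g \<eta>)
  also have "\<dots> = (LINT y|lborel. reflect \<eta> y * cint (\<lambda>x. f x * g (x + y)))"
    by (rule fubini_translate[OF f g integrable_test_function[OF test_function_reflect[OF \<eta>]]])
  also have "\<dots> = (LINT y|lborel. reflect \<eta> (0 - y) * cint (\<lambda>x. f x * g (x + (0 - y))))"
    using meas by (intro integral_lborel_reflect[symmetric]) measurable
  also have "\<dots> = (LINT y|lborel. \<eta> y * cint (\<lambda>x. g x * f (x + y)))"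
    by (simp add: gf)
  also have "\<dots> = cint (\<lambda>x. g x * (LINT y|lborel. f (x + y) * \<eta> y))"
    by (rule fubini_translate[OF g f integrable_test_function[OF \<eta>], symmetric])
  also have "\<dots> = cint (\<lambda>x. conv f (reflect \<eta>) x * g x)"
    by (simp add: conv_altdef f test_function_reflect \<eta> mult.commute)
  finally show ?thesis .
qed

lemma AE_zero_if_conv_zero:
  assumes f: "sq_int f" and zero: "\<And>\<eta>. test_function \<eta> \<Longrightarrow> conv f \<eta> 0 = 0"
  shows "AE x in lborel. f x = 0"
proof (rule AE_zero_if_test_integrals_zero)
  show "f \<in> borel_measurable borel" using f by (rule sq_intD)
  show "set_integrable lborel K f" if "compact K" for K using f that by (rule sq_int_integrable_compact)
  show "(LINT x|lborel. f x * \<phi> x) = 0" if "test_function \<phi>" for \<phi>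
    using zero[OF test_function_reflect[OF that]] by (simp add: conv_def)
qed

subsection \<open>Calculus of smooth periodic functions\<close>

lemma smooth_axis_mvt:
  assumes "smooth f" "0 < s"
  obtains u where "0 < u" "u < s" "f (z + s *\<^sub>R axis i 1) - f z = s * pd i f (z + u *\<^sub>R axis i 1)"
proof -
  have der: "((\<lambda>s. f (z + s *\<^sub>R axis i 1)) has_real_derivative pd i f (z + t *\<^sub>R axis i 1)) (at t)" for t
  proof -
    have "(\<Sum>j\<in>UNIV. axis i 1 $ j * pd j f (z + t *\<^sub>R axis i 1))
        = (\<Sum>j\<in>UNIV. if j = i then pd j f (z + t *\<^sub>R axis i 1) else 0)"
      by (intro sum.cong) (auto simp: axis_def)
    then show ?thesis using smooth_line_derivative[OF assms(1), of z "axis i 1" t UNIV] by simp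
  qed
  have "\<exists>u. 0 < u \<and> u < s \<and> f (z + s *\<^sub>R axis i 1) - f (z + 0 *\<^sub>R axis i 1) = (s - 0) * pd i f (z + u *\<^sub>R axis i 1)"
    by (rule MVT2[OF assms(2)]) (rule der)
  then obtain u where "0 < u" "u < s" "f (z + s *\<^sub>R axis i 1) - f z = s * pd i f (z + u *\<^sub>R axis i 1)"
    by auto
  then show ?thesis by (rule that)
qed

text \<open>Both iterated derivatives are limits of the same second difference quotient.\<close>

lemma pd_commute:
  fixes f :: "real ^ 'n \<Rightarrow> real"
  assumes f: "smooth f"
  shows "pd i (pd j f) x = pd j (pd i f) x"
proof -
  define D where "D s = f (x + s *\<^sub>R axis i 1 + s *\<^sub>R axis j 1) - f (x + s *\<^sub>R axis i 1)
      - f (x + s *\<^sub>R axis j 1) + f x" for s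
  \<comment> \<open>The second difference is symmetric in \<open>i\<close> and \<open>j\<close>, so
    one argument with \<open>k\<close> and \<open>l\<close> in either role serves both orders. Each
    application of the mean value theorem removes one difference.\<close>
  have mvt: "\<exists>y. norm (y - x) < 2 * s \<and> D s = s * s * pd k (pd l f) y"
    if s: "0 < s" and kl: "k = i \<and> l = j \<or> k = j \<and> l = i" for s k l
  proof -
    let ?g = "\<lambda>z. f (s *\<^sub>R axis k 1 + 1 *\<^sub>R z) + (-1) * f z"
    have sg: "smooth ?g" by (intro smooth_linear_combination smooth_affine f)
    have D: "D s = ?g (x + s *\<^sub>R axis l 1) - ?g x"
      using kl by (auto simp: D_def algebra_simps)
    obtain u where u: "0 < u" "u < s" "?g (x + s *\<^sub>R axis l 1) - ?g x = s * pd l ?g (x + u *\<^sub>R axis l 1)"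
      by (rule smooth_axis_mvt[OF sg s])
    have "pd l ?g z = pd l f (z + s *\<^sub>R axis k 1) - pd l f z" for z
    proof -
      have "(\<lambda>z. f (s *\<^sub>R axis k 1 + 1 *\<^sub>R z)) differentiable (at z)"
        by (rule smooth_differentiable[OF smooth_affine[OF f]])
      then have "pd l ?g z = pd l (\<lambda>z. f (s *\<^sub>R axis k 1 + 1 *\<^sub>R z)) z + (-1) * pd l f z"
        by (rule pd_linear_combination) (rule smooth_differentiable[OF f])
      also have "pd l (\<lambda>z. f (s *\<^sub>R axis k 1 + 1 *\<^sub>R z)) z = 1 * pd l f (s *\<^sub>R axis k 1 + 1 *\<^sub>R z)"
        by (rule pd_affine) (rule smooth_differentiable[OF f])
      finally show ?thesis by (simp add: add.commute)
    qed
    moreover obtain v where v: "0 < v" "v < s"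
      "pd l f (x + u *\<^sub>R axis l 1 + s *\<^sub>R axis k 1) - pd l f (x + u *\<^sub>R axis l 1)
        = s * pd k (pd l f) (x + u *\<^sub>R axis l 1 + v *\<^sub>R axis k 1)"
      by (rule smooth_axis_mvt[OF smooth_pd[OF f] s])
    ultimately have "D s = s * s * pd k (pd l f) (x + u *\<^sub>R axis l 1 + v *\<^sub>R axis k 1)"
      using u(3) D by simp
    moreover have "norm (x + u *\<^sub>R axis l 1 + v *\<^sub>R axis k 1 - x) < 2 * s"
    proof -
      have "norm (x + u *\<^sub>R axis l 1 + v *\<^sub>R axis k 1 - x) \<le> norm (u *\<^sub>R axis l (1 :: real)) + norm (v *\<^sub>R axis k (1 :: real))"
        by (rule order_trans[OF _ norm_triangle_ineq]) simp
      also have "\<dots> = u + v" using u v by (simp add: norm_axis_1)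
      finally show ?thesis using u v by simp
    qed
    ultimately show ?thesis by blast
  qed
  define a where "a = pd i (pd j f)"
  define b where "b = pd j (pd i f)"
  have cont: "isCont a x" "isCont b x"
    unfolding a_def b_def using smooth_continuous_on[OF smooth_pd[OF smooth_pd[OF f]], of UNIV]
    by (simp_all add: continuous_on_eq_continuous_at)
  have "dist (a x) (b x) \<le> e" if e: "0 < e" for e
  proof -
    have "0 < e / 2" using e by simp
    then obtain d1 d2 where d: "0 < d1" "\<And>y. dist y x < d1 \<Longrightarrow> dist (a y) (a x) < e / 2"
        "0 < d2" "\<And>y. dist y x < d2 \<Longrightarrow> dist (b y) (b x) < e / 2"
      using cont unfolding continuous_at_eps_delta by metis
    define s where "s = min d1 d2 / 2"
    have s: "0 < s" "2 * s \<le> d1" "2 * s \<le> d2" using d by (auto simp: s_def)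
    obtain y where y: "norm (y - x) < 2 * s" "D s = s * s * a y"
      using mvt[OF s(1), of i j] unfolding a_def by blast
    obtain z where z: "norm (z - x) < 2 * s" "D s = s * s * b z"
      using mvt[OF s(1), of j i] unfolding b_def by blast
    have "a y = b z" using y(2) z(2) s(1) by simp
    moreover have "dist (a y) (a x) < e / 2" "dist (b z) (b x) < e / 2"
      using y(1) z(1) s(2,3) by (intro d(2) d(4); simp add: dist_norm)+
    ultimately show ?thesis
      using dist_triangle2[of "a x" "b x" "a y"] dist_commute[of "a x" "a y"] dist_commute[of "b x" "b z"] by simp
  qed
  then have "dist (a x) (b x) \<le> 0 + e" if "0 < e" for e using that by simp
  then have "dist (a x) (b x) \<le> 0" by (rule field_le_epsilon)
  then show ?thesis by (simp add: a_def b_def)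
qed

text \<open>The convolution of the constant 1 with \<open>\<phi>\<close> is constant, and its
  partial derivative is the convolution of 1 with \<open>pd i \<phi>\<close>.\<close>

lemma integral_pd_test_function:
  assumes "test_function \<phi>" shows "(LINT x|lborel. pd i \<phi> x) = 0"
proof -
  have const: "conv (\<lambda>x. 1) \<eta> x = (LINT y|lborel. \<eta> y)" if "test_function \<eta>" for \<eta> :: "real ^ 'a \<Rightarrow> real" and x
    using integral_lborel_reflect[OF borel_measurable_test_function[OF that], of x] by (simp add: conv_def)
  have "conv (\<lambda>x. 1) \<phi> = (\<lambda>x. LINT y|lborel. \<phi> y)" using const[OF assms] by blast
  then have "pd i (conv (\<lambda>x. 1) \<phi>) 0 = 0" using pd_const by simp
  moreover have "pd i (conv (\<lambda>x. 1) \<phi>) 0 = conv (\<lambda>x. 1) (pd i \<phi>) 0"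
    by (rule fun_cong[OF pd_conv[OF sq_int_const assms]])
  ultimately show ?thesis using const[OF test_function_pd[OF assms]] by simp
qed

lemma test_function_mult_smooth:
  assumes "smooth p" "test_function \<phi>" shows "test_function (\<lambda>x. p x * \<phi> x)"
proof -
  have "bounded {x. p x * \<phi> x \<noteq> 0}"
    by (rule bounded_subset[OF test_functionD(2)[OF assms(2)]]) auto
  then show ?thesis using smooth_mult[OF assms(1) test_functionD(1)[OF assms(2)]]
    by (simp add: test_function_def smooth_def)
qed

lemma smooth_integration_by_parts:
  assumes p: "smooth p" and \<phi>: "test_function \<phi>"
  shows "(LINT x|lborel. p x * pd i \<phi> x) = - (LINT x|lborel. pd i p x * \<phi> x)"
proof -
  have "pd i (\<lambda>x. p x * \<phi> x) = (\<lambda>x. p x * pd i \<phi> x + pd i p x * \<phi> x)"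
    using p test_functionD(1)[OF \<phi>] by (intro ext pd_mult) (auto intro: smooth_differentiable)
  then have "0 = (LINT x|lborel. p x * pd i \<phi> x + pd i p x * \<phi> x)"
    using integral_pd_test_function[OF test_function_mult_smooth[OF p \<phi>], of i] by simp
  also have "\<dots> = (LINT x|lborel. p x * pd i \<phi> x) + (LINT x|lborel. pd i p x * \<phi> x)"
    by (intro Bochner_Integration.integral_add integrable_test_function test_function_mult_smooth
        test_function_pd smooth_pd p \<phi>)
  finally show ?thesis by simp
qed

text \<open>A periodic function has no bounded support to give uniform continuity of its
  derivatives; compactness of a ball around the cell gives it instead.\<close>

lemma smooth_remainder_on_cell:
  fixes p :: "real ^ 'n \<Rightarrow> real"
  assumes p: "smooth p" and e: "0 < e"
  shows "\<exists>d>0. \<forall>z h. z \<in> cell 0 \<longrightarrow> norm h < d \<longrightarrow>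
    \<bar>p (z + h) - p z - (\<Sum>i\<in>UNIV. h $ i * pd i p z)\<bar> \<le> e * norm h"
proof -
  obtain R where R: "\<And>z :: real ^ 'n. z \<in> cell 0 \<Longrightarrow> norm z \<le> R"
    using bounded_box[of 0 "0 + 1 :: real ^ 'n"] unfolding cell_def bounded_iff by blast
  define e' where "e' = e / real CARD('n)"
  have e': "0 < e'" using e by (simp add: e'_def)
  have "uniformly_continuous_on (cball 0 (R + 1)) (pd i p)" for i
    by (intro compact_uniformly_continuous smooth_continuous_on smooth_pd p compact_cball)
  then have "\<forall>i. \<exists>d>0. \<forall>x\<in>cball 0 (R + 1). \<forall>y\<in>cball 0 (R + 1). dist y x < d \<longrightarrow> dist (pd i p y) (pd i p x) < e'"
    using e' unfolding uniformly_continuous_on_def by blast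
  then obtain \<delta> where \<delta>: "\<And>i. 0 < \<delta> i" "\<And>i x y. x \<in> cball 0 (R + 1) \<Longrightarrow> y \<in> cball 0 (R + 1) \<Longrightarrow>
      dist y x < \<delta> i \<Longrightarrow> dist (pd i p y) (pd i p x) < e'" by metis
  define d where "d = min 1 (Min (range \<delta>))"
  have d: "0 < d" "d \<le> \<delta> i" "d \<le> 1" for i using \<delta>(1) by (auto simp: d_def min_le_iff_disj)
  have "\<bar>p (z + h) - p z - (\<Sum>i\<in>UNIV. h $ i * pd i p z)\<bar> \<le> e * norm h"
    if z: "z \<in> cell 0" and h: "norm h < d" for z h
  proof -
    have "\<bar>pd i p (z + s *\<^sub>R h) - pd i p z\<bar> \<le> e'" if s: "0 \<le> s" "s \<le> 1" for i s
    proof -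
      have sh: "norm (s *\<^sub>R h) \<le> norm h" using s by (simp add: mult_left_le_one_le)
      have "norm (z + s *\<^sub>R h) \<le> R + 1"
        using norm_triangle_ineq[of z "s *\<^sub>R h"] R[OF z] sh h d(3) by linarith
      moreover have "dist (z + s *\<^sub>R h) z < \<delta> i" using sh h d(2)[of i] by (simp add: dist_norm)
      ultimately have "dist (pd i p (z + s *\<^sub>R h)) (pd i p z) < e'"
        using R[OF z] by (intro \<delta>(2)) auto
      then show ?thesis by (simp add: dist_norm)
    qed
    from smooth_remainder_bound[OF p this] show ?thesis by (simp add: e'_def)
  qed
  then show ?thesis using d(1) by blast
qed

lemma cint_cell_bound:
  fixes f :: "real ^ 'n \<Rightarrow> real"
  assumes "set_integrable lborel (cell 0) f" "\<And>x. x \<in> cell 0 \<Longrightarrow> \<bar>f x\<bar> \<le> B"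
  shows "\<bar>cint f\<bar> \<le> B"
proof -
  have cB: "set_integrable lborel (cell 0 :: (real ^ 'n) set) (\<lambda>x. B)" by (rule set_integrable_cell_const)
  have "\<bar>cint f\<bar> \<le> (LINT x|lborel. \<bar>indicator (cell 0) x *\<^sub>R f x\<bar>)"
    unfolding set_lebesgue_integral_def by (rule integral_abs_bound)
  also have "\<dots> \<le> (LINT x|lborel. indicator (cell 0 :: (real ^ 'n) set) x *\<^sub>R B)"
    using assms cB unfolding set_integrable_def
    by (intro integral_mono integrable_abs) (auto simp: indicator_def)
  also have "\<dots> = B" by (simp add: measure_def emeasure_cell)
  finally show ?thesis .
qed

text \<open>Over a cell, \<open>p\<close> and its translates have the same integral, so the
  integrated difference quotient is 0, and it approximates the integrated derivative to any
  precision \<open>e\<close>.\<close>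

lemma cint_pd_eq_0:
  assumes p: "smooth_periodic p" shows "cint (pd i p) = 0"
proof -
  note sp = sq_int_smooth_periodic[OF p] and spd = sq_int_smooth_periodic[OF smooth_periodic_pd[OF p]]
  have "\<bar>cint (pd i p)\<bar> \<le> 0 + e" if e: "0 < e" for e
  proof -
    obtain d where d: "0 < d" "\<And>z h. z \<in> cell 0 \<Longrightarrow> norm h < d \<Longrightarrow>
      \<bar>p (z + h) - p z - (\<Sum>i\<in>UNIV. h $ i * pd i p z)\<bar> \<le> e * norm h"
      using smooth_remainder_on_cell[OF smooth_periodicD(1)[OF p] e] by blast
    define t where "t = d / 2"
    have t: "0 < t" "t < d" using d(1) by (auto simp: t_def)
    let ?h = "t *\<^sub>R axis i 1 :: real ^ 'a"
    have "norm ?h = t" using t by (simp add: norm_axis_1)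
    have "(\<Sum>j\<in>UNIV. ?h $ j * pd j p z) = t * pd i p z" for z
    proof -
      have "(\<Sum>j\<in>UNIV. ?h $ j * pd j p z) = (\<Sum>j\<in>UNIV. if j = i then t * pd j p z else 0)"
        by (intro sum.cong) (auto simp: axis_def)
      then show ?thesis by simp
    qed
    then have rem: "\<bar>p (?h + z) - p z - t * pd i p z\<bar> \<le> e * t" if "z \<in> cell 0" for z
      using d(2)[OF that, of ?h] t \<open>norm ?h = t\<close> by (simp add: add.commute)
    have i1: "set_integrable lborel (cell 0) (\<lambda>z. p (?h + z))" by (intro sq_int_integrable sq_int_translate sp)
    have i2: "set_integrable lborel (cell 0) p" "set_integrable lborel (cell 0) (\<lambda>z. t * pd i p z)"
      by (intro sq_int_integrable sq_int_cmult sp spd)+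
    have "\<bar>cint (\<lambda>z. p (?h + z) - p z - t * pd i p z)\<bar> \<le> e * t"
      by (rule cint_cell_bound[OF set_integral_diff(1)[OF set_integral_diff(1)[OF i1 i2(1)] i2(2)] rem])
    also have "cint (\<lambda>z. p (?h + z) - p z - t * pd i p z) = cint (\<lambda>z. p (?h + z)) - cint p - t * cint (pd i p)"
      using set_integral_diff(2)[OF set_integral_diff(1)[OF i1 i2(1)] i2(2)] set_integral_diff(2)[OF i1 i2(1)]
      by simp
    also have "cint (\<lambda>z. p (?h + z)) = cint p"
      by (rule integral_cell_translate(2)[OF sq_intD(1,2)[OF sp] sq_int_integrable[OF sp]])
    finally have "t * \<bar>cint (pd i p)\<bar> \<le> t * e" using t by (simp add: abs_mult mult.commute)
    then show ?thesis using t by simp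
  qed
  then have "\<bar>cint (pd i p)\<bar> \<le> 0" by (rule field_le_epsilon)
  then show ?thesis by simp
qed

lemma cint_integration_by_parts:
  assumes p: "smooth_periodic p" and q: "smooth_periodic q"
  shows "cint (\<lambda>x. pd i p x * q x) = - cint (\<lambda>x. p x * pd i q x)"
proof -
  have "pd i (\<lambda>x. p x * q x) = (\<lambda>x. p x * pd i q x + pd i p x * q x)"
    using smooth_periodicD(1)[OF p] smooth_periodicD(1)[OF q]
    by (intro ext pd_mult) (auto intro: smooth_differentiable)
  then have "0 = cint (\<lambda>x. p x * pd i q x + pd i p x * q x)"
    using cint_pd_eq_0[OF smooth_periodic_mult[OF p q], of i] by simp
  also have "\<dots> = cint (\<lambda>x. p x * pd i q x) + cint (\<lambda>x. pd i p x * q x)"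
    by (intro set_integral_add(2) sq_int_mult_integrable sq_int_smooth_periodic smooth_periodic_pd p q)
  finally show ?thesis by simp
qed

text \<open>Split \<open>t\<close> into \<open>N\<close> short steps. Translations are isometries,
  so every step contributes the same norm, and a short step is a directional derivative up to a
  uniformly small remainder.\<close>

lemma smooth_translate_estimate:
  fixes p :: "real ^ 'n \<Rightarrow> real"
  assumes p: "smooth_periodic p"
  shows "(norm (l2 (\<lambda>x. p (t + x)) - l2 p))\<^sup>2 \<le> (norm t)\<^sup>2 * (\<Sum>i\<in>UNIV. cint (\<lambda>x. (pd i p x)\<^sup>2))"
proof -
  define S where "S = (\<Sum>i\<in>UNIV. cint (\<lambda>x. (pd i p x)\<^sup>2))"
  note sp = sq_int_smooth_periodic[OF p] and spd = sq_int_smooth_periodic[OF smooth_periodic_pd[OF p]]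
  define T where "T h = l2 (\<lambda>x. p (h + x))" for h
  \<comment> \<open>Cauchy-Schwarz over the coordinates, for a combination of vectors of
    \<open>'n l2\<close>.\<close>
  have grad: "norm (\<Sum>i\<in>UNIV. (h $ i) *\<^sub>R l2 (pd i p)) \<le> norm h * sqrt S" for h
  proof -
    have "norm (\<Sum>i\<in>UNIV. (h $ i) *\<^sub>R l2 (pd i p)) \<le> (\<Sum>i\<in>UNIV. \<bar>h $ i\<bar> * \<bar>norm (l2 (pd i p))\<bar>)"
      by (rule order_trans[OF norm_sum]) simp
    also have "\<dots> \<le> L2_set (\<lambda>i. h $ i) UNIV * L2_set (\<lambda>i. norm (l2 (pd i p))) UNIV"
      by (rule L2_set_mult_ineq)
    also have "L2_set (\<lambda>i. h $ i) UNIV = norm h" by (simp add: norm_vec_def L2_set_def)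
    also have "L2_set (\<lambda>i. norm (l2 (pd i p))) UNIV = sqrt S"
      by (simp add: L2_set_def S_def norm_l2_power2[OF spd])
    finally show ?thesis .
  qed
  have Tdiff: "norm (T (a + h) - T a) = norm (T h - T 0)" for a h
  proof -
    have d: "sq_int (\<lambda>x. p (h + x) - p x)" by (intro sq_int_diff sq_int_translate sp)
    have "T (a + h) - T a = l2 (\<lambda>x. p (h + (a + x)) - p (a + x))"
      using l2_diff[OF sq_int_translate[OF sp, of "a + h"] sq_int_translate[OF sp, of a]]
      by (simp add: T_def add_ac)
    moreover have "sq_int (\<lambda>x. p (h + (a + x)) - p (a + x))" using sq_int_translate[OF d, of a] .
    moreover have "T h - T 0 = l2 (\<lambda>x. p (h + x) - p x)"
      unfolding T_def by (subst l2_diff) (auto intro!: sq_int_translate sp)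
    ultimately show ?thesis using norm_l2_translate[OF d, of a] by simp
  qed
  have main: "norm (T t - T 0) \<le> norm t * sqrt S + e" if e: "0 < e" for e
  proof -
    \<comment> \<open>Chosen so that the remainders of all \<open>N\<close> steps, of total size
      \<open>norm t * e'\<close>, add up to at most \<open>e\<close>.\<close>
    define e' where "e' = e / (norm t + 1)"
    have e': "0 < e'" "norm t * e' \<le> e" using e by (auto simp: e'_def field_simps add_pos_nonneg)
    obtain d where d: "0 < d" "\<And>z h. z \<in> cell 0 \<Longrightarrow> norm h < d \<Longrightarrow>
      \<bar>p (z + h) - p z - (\<Sum>i\<in>UNIV. h $ i * pd i p z)\<bar> \<le> e' * norm h"
      using smooth_remainder_on_cell[OF smooth_periodicD(1)[OF p] e'(1)] by blast
    obtain N where N: "norm t / d < real N" using reals_Archimedean2 by blast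
    have N0: "0 < real N" using N d(1) by (meson divide_nonneg_pos le_less_trans norm_ge_zero)
    define h where "h = (1 / real N) *\<^sub>R t"
    have nh: "norm h = norm t / real N" using N0 by (simp add: h_def)
    have hd: "norm h < d" using N N0 d(1) by (simp add: nh field_simps)
    have "norm (T h - T 0) \<le> norm h * sqrt S + e' * norm h"
    proof -
      let ?r = "\<lambda>x. p (h + x) - p x - (\<Sum>i\<in>UNIV. h $ i * pd i p x)"
      have sr: "sq_int ?r" by (intro sq_int_diff sq_int_translate sq_int_sum sq_int_cmult sp spd)
      have "(norm (l2 ?r))\<^sup>2 \<le> (e' * norm h)\<^sup>2"
      proof -
        have "\<bar>cint (\<lambda>x. (?r x)\<^sup>2)\<bar> \<le> (e' * norm h)\<^sup>2"
        proof (rule cint_cell_bound[OF sq_intD(3)[OF sr]])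
          fix x :: "real ^ 'n" assume "x \<in> cell 0"
          from d(2)[OF this hd] have "\<bar>?r x\<bar> \<le> e' * norm h" by (simp add: add.commute)
          then have "\<bar>?r x\<bar>\<^sup>2 \<le> (e' * norm h)\<^sup>2" by (rule power_mono) simp
          then show "\<bar>(?r x)\<^sup>2\<bar> \<le> (e' * norm h)\<^sup>2" by simp
        qed
        then show ?thesis unfolding norm_l2_power2[OF sr] by linarith
      qed
      then have "norm (l2 ?r) \<le> e' * norm h" by (rule power2_le_imp_le) (use e' in simp)
      moreover have "l2 ?r = (T h - T 0) - (\<Sum>i\<in>UNIV. (h $ i) *\<^sub>R l2 (pd i p))"
        unfolding T_def
        by (simp add: l2_diff l2_sum l2_scaleR sq_int_diff sq_int_translate sq_int_sum sq_int_cmult sp spd)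
      ultimately show ?thesis
        using grad[of h] norm_triangle_sub[of "T h - T 0" "\<Sum>i\<in>UNIV. (h $ i) *\<^sub>R l2 (pd i p)"] by simp
    qed
    moreover have "norm (T (real m *\<^sub>R h) - T 0) \<le> real m * norm (T h - T 0)" for m
    proof (induction m)
      case (Suc m)
      have "real (Suc m) *\<^sub>R h = real m *\<^sub>R h + h" by (simp add: algebra_simps)
      then have "norm (T (real (Suc m) *\<^sub>R h) - T 0)
          = norm ((T (real m *\<^sub>R h + h) - T (real m *\<^sub>R h)) + (T (real m *\<^sub>R h) - T 0))" by simp
      also have "\<dots> \<le> norm (T h - T 0) + norm (T (real m *\<^sub>R h) - T 0)"
        using norm_triangle_ineq[of "T (real m *\<^sub>R h + h) - T (real m *\<^sub>R h)" "T (real m *\<^sub>R h) - T 0"]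
        unfolding Tdiff[of "real m *\<^sub>R h" h] .
      also have "\<dots> \<le> norm (T h - T 0) + real m * norm (T h - T 0)" using Suc by simp
      finally show ?case by (simp add: algebra_simps)
    qed simp
    from this[of N] have "norm (T t - T 0) \<le> real N * norm (T h - T 0)" using N0 by (simp add: h_def)
    ultimately have "norm (T t - T 0) \<le> real N * (norm h * sqrt S + e' * norm h)"
      using N0 by (meson mult_left_mono order_trans less_imp_le)
    also have "\<dots> = norm t * sqrt S + norm t * e'" using N0 by (simp add: nh field_simps)
    finally show ?thesis using e'(2) by linarith
  qed
  have "norm (T t - T 0) \<le> norm t * sqrt S" by (rule field_le_epsilon) (rule main)
  then have "(norm (T t - T 0))\<^sup>2 \<le> (norm t * sqrt S)\<^sup>2" by (rule power_mono) simp
  moreover have "0 \<le> S" unfolding S_def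
    by (intro sum_nonneg) (auto simp: set_lebesgue_integral_def intro!: integral_nonneg_AE)
  ultimately show ?thesis by (simp add: T_def S_def[symmetric] power_mult_distrib)
qed

text \<open>The average of \<open>t \<mapsto> (t $ i)\<^sup>2\<close> over the centred cell is \<open>1/12\<close>; the cruder bound
  \<open>5/32\<close>, from a function taking two values, is enough.\<close>

lemma average_coordinate_square:
  fixes i :: "'n::finite"
  shows "(LINT t:cell (\<chi> j. - 1 / 2)|lborel. (t $ i)\<^sup>2) \<le> (5 / 32 :: real)"
  "set_integrable lborel (cell (\<chi> j. - 1 / 2)) (\<lambda>t :: real ^ 'n. (t $ i)\<^sup>2)"
proof -
  let ?T = "cell (\<chi> j. - 1 / 2) :: (real ^ 'n) set"
  let ?l = "(\<chi> j. if j = i then - 1 / 4 else - 1 / 2) :: real ^ 'n"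
  let ?u = "(\<chi> j. if j = i then 1 / 4 else 1 / 2) :: real ^ 'n"
  let ?B = "box ?l ?u :: (real ^ 'n) set"
  have BT: "t \<in> ?B \<longleftrightarrow> t \<in> ?T \<and> \<bar>t $ i\<bar> < 1 / 4" for t
  proof -
    have split: "(\<forall>j. P j) \<longleftrightarrow> P i \<and> (\<forall>j. j \<noteq> i \<longrightarrow> P j)" for P by metis
    show ?thesis unfolding mem_cell mem_box_cart
      by (subst (1 2) split) (auto simp: abs_less_iff)
  qed
  have "emeasure lborel ?B = (\<Prod>b\<in>Basis. (?u - ?l) \<bullet> b)"
    by (rule emeasure_lborel_box) (auto simp: Basis_vec_def inner_axis)
  also have "(\<Prod>b\<in>Basis. (?u - ?l) \<bullet> b) = (\<Prod>b\<in>(Basis :: (real ^ 'n) set). if b = axis i 1 then 1 / 2 else 1)"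
    by (intro prod.cong) (auto simp: Basis_vec_def inner_axis axis_eq_axis)
  also have "\<dots> = 1 / 2"
    by (subst prod.delta) (auto simp: Basis_vec_def)
  finally have mB: "emeasure lborel ?B = ennreal (1 / 2)" .
  have cell1: "integrable lborel (indicat_real ?T)"
    by (intro integrable_real_indicator) (auto simp: emeasure_cell)
  have "emeasure lborel ?B < \<infinity>" unfolding mB infinity_ennreal_def by (rule ennreal_less_top)
  then have B1: "integrable lborel (indicat_real ?B)"
    by (rule integrable_real_indicator[rotated]) simp
  \<comment> \<open>In the cell the square is at most 1/4, and at most 1/16 where
    \<open>t $ i\<close> is below 1/4 in absolute value. The latter part is \<open>?B\<close>, of
    volume 1/2, whence 1/4 - 3/32 = 5/32.\<close>
  have le: "indicator ?T t *\<^sub>R (t $ i)\<^sup>2 \<le> 1 / 4 * indicat_real ?T t - 3 / 16 * indicat_real ?B t" for t :: "real ^ 'n"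
  proof (cases "t \<in> ?T")
    case True
    then have "- 1 / 2 < t $ i" "t $ i < 1 / 2" by (auto simp: mem_cell)
    then have t2: "\<bar>t $ i\<bar> \<le> 1 / 2" by linarith
    have "\<bar>t $ i\<bar>\<^sup>2 \<le> (1 / 2)\<^sup>2" using t2 by (rule power_mono) simp
    moreover have "\<bar>t $ i\<bar>\<^sup>2 \<le> (1 / 4)\<^sup>2" if "\<bar>t $ i\<bar> < 1 / 4" using that by (intro power_mono) auto
    ultimately show ?thesis using True BT[of t] by (auto simp: indicator_def power2_eq_square)
  qed (auto simp: indicator_def BT)
  have cm: "(\<lambda>t :: real ^ 'n. t $ i) \<in> borel_measurable borel"
    by (intro borel_measurable_continuous_onI continuous_intros)
  show int: "set_integrable lborel ?T (\<lambda>t. (t $ i)\<^sup>2)"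
    unfolding set_integrable_def
  proof (rule Bochner_Integration.integrable_bound[OF cell1])
    show "(\<lambda>t. indicator ?T t *\<^sub>R (t $ i)\<^sup>2) \<in> borel_measurable lborel" using cm by measurable
    show "AE t in lborel. norm (indicator ?T t *\<^sub>R (t $ i)\<^sup>2) \<le> norm (indicat_real ?T t)"
    proof (rule AE_I2)
      fix t show "norm (indicator ?T t *\<^sub>R (t $ i)\<^sup>2) \<le> norm (indicat_real ?T t)"
        using le[of t] by (cases "t \<in> ?T"; cases "t \<in> ?B") simp_all
    qed
  qed
  have "(LINT t:?T|lborel. (t $ i)\<^sup>2) \<le> (LINT t|lborel. 1 / 4 * indicat_real ?T t - 3 / 16 * indicat_real ?B t)"
    unfolding set_lebesgue_integral_def using int le cell1 B1 unfolding set_integrable_def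
    by (intro integral_mono) auto
  also have "\<dots> = 1 / 4 * (LINT t|lborel. indicat_real ?T t) - 3 / 16 * (LINT t|lborel. indicat_real ?B t)"
    using cell1 B1 by (simp add: Bochner_Integration.integral_diff)
  also have "\<dots> = 5 / 32"
  proof -
    have "measure lborel ?B = 1 / 2" unfolding measure_def mB by (rule enn2real_ennreal) simp
    moreover have "measure lborel ?T = 1" by (simp add: measure_def emeasure_cell)
    ultimately show ?thesis by simp
  qed
  finally show "(LINT t:?T|lborel. (t $ i)\<^sup>2) \<le> 5 / 32" .
qed

text \<open>Expanding the square in the translation estimate gives twice the squared norm minus
  twice the autocorrelation \<open>c t\<close>, which averages to 0 when the mean is zero. The bound
  5/32 for each coordinate is then halved.\<close>

lemma smooth_poincare:
  fixes p :: "real ^ 'n \<Rightarrow> real"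
  assumes p: "smooth_periodic p" and mean: "cint p = 0"
  shows "cint (\<lambda>x. (p x)\<^sup>2) \<le> real CARD('n) * (5 / 64) * (\<Sum>i\<in>UNIV. cint (\<lambda>x. (pd i p x)\<^sup>2))"
proof -
  define S where "S = (\<Sum>i\<in>UNIV. cint (\<lambda>x. (pd i p x)\<^sup>2))"
  have S: "0 \<le> S" unfolding S_def
    by (intro sum_nonneg) (auto simp: set_lebesgue_integral_def intro!: integral_nonneg_AE)
  note sp = sq_int_smooth_periodic[OF p]
  note [measurable] = sq_intD(1)[OF sp]
  let ?T = "cell (\<chi> j. - 1 / 2) :: (real ^ 'n) set"
  define c where "c t = cint (\<lambda>x. p x * p (x + t))" for t
  have T1: "integrable lborel (indicat_real ?T)"
    by (intro integrable_real_indicator) (auto simp: emeasure_cell)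
  have pt: "sq_int (\<lambda>x. p (x + t))" for t using sq_int_translate[OF sp, of t] by (simp add: add.commute)
  have le: "2 * cint (\<lambda>x. (p x)\<^sup>2) - 2 * c t \<le> (\<Sum>i\<in>UNIV. (t $ i)\<^sup>2) * S" for t
  proof -
    have "(norm (l2 (\<lambda>x. p (x + t)) - l2 p))\<^sup>2 = (norm (l2 (\<lambda>x. p (x + t))))\<^sup>2 + (norm (l2 p))\<^sup>2 - 2 * (l2 p \<bullet> l2 (\<lambda>x. p (x + t)))"
      unfolding power2_norm_eq_inner by (simp add: inner_diff_left inner_diff_right inner_commute)
    also have "norm (l2 (\<lambda>x. p (x + t))) = norm (l2 p)"
      using norm_l2_translate[OF sp, of t] by (simp add: add.commute)
    also have "l2 p \<bullet> l2 (\<lambda>x. p (x + t)) = c t" by (simp add: c_def inner_l2 sp pt)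
    finally have "2 * cint (\<lambda>x. (p x)\<^sup>2) - 2 * c t = (norm (l2 (\<lambda>x. p (x + t)) - l2 p))\<^sup>2"
      by (simp add: norm_l2_power2[OF sp])
    also have "\<dots> \<le> (norm t)\<^sup>2 * S"
      using smooth_translate_estimate[OF p, of t] by (simp add: add.commute S_def)
    also have "(norm t)\<^sup>2 = (\<Sum>i\<in>UNIV. (t $ i)\<^sup>2)" by (simp add: norm_vec_def L2_set_def sum_nonneg)
    finally show ?thesis .
  qed
  have cm: "c \<in> borel_measurable borel" unfolding c_def set_lebesgue_integral_def by measurable
  have cb: "\<bar>c t\<bar> \<le> (norm (l2 p))\<^sup>2" for t
  proof -
    have "\<bar>l2 p \<bullet> l2 (\<lambda>x. p (x + t))\<bar> \<le> norm (l2 p) * norm (l2 (\<lambda>x. p (x + t)))" by (rule Cauchy_Schwarz_ineq2)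
    also have "norm (l2 (\<lambda>x. p (x + t))) = norm (l2 p)"
      using norm_l2_translate[OF sp, of t] by (simp add: add.commute)
    finally show ?thesis by (simp add: c_def inner_l2 sp pt power2_eq_square)
  qed
  have ci: "integrable lborel (\<lambda>t. indicator ?T t * c t)"
  proof (rule Bochner_Integration.integrable_bound)
    show "integrable lborel (\<lambda>t. indicat_real ?T t * (norm (l2 p))\<^sup>2)" by (intro integrable_mult_left T1)
  qed (use cm cb in \<open>auto simp: indicator_def\<close>)
  \<comment> \<open>After Fubini the inner integral is that of \<open>p\<close> over a translated
    cell, which is the mean of \<open>p\<close>.\<close>
  have c0: "(LINT t|lborel. indicator ?T t * c t) = 0"
  proof -
    have "(LINT t|lborel. indicator ?T t * c t) = cint (\<lambda>x. p x * (LINT t|lborel. p (x + t) * indicator ?T t))"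
      unfolding c_def by (rule fubini_translate[OF sp sp T1, symmetric])
    moreover have "(LINT t|lborel. p (x + t) * indicator ?T t) = 0" for x
    proof -
      have "(LINT t|lborel. p (x + t) * indicator ?T t) = (LINT t|lborel. (\<lambda>s. p s * indicator (cell (x + (\<chi> j. - 1 / 2))) s) (x + t))"
        by (intro Bochner_Integration.integral_cong) (auto simp: indicator_def mem_cell)
      also have "\<dots> = (LINT s|lborel. p s * indicator (cell (x + (\<chi> j. - 1 / 2))) s)"
        by (rule integral_lborel_translate) measurable
      also have "\<dots> = (LINT s:cell (x + (\<chi> j. - 1 / 2))|lborel. p s)"
        by (simp add: set_lebesgue_integral_def mult.commute)
      also have "\<dots> = 0"
        using integrable_cell_shift(2)[OF sq_intD(1,2)[OF sp] sq_int_integrable[OF sp]] mean by simp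
      finally show ?thesis .
    qed
    ultimately have "(LINT t|lborel. indicator ?T t * c t) = cint (\<lambda>x. p x * 0)" by (simp only:)
    also have "\<dots> = 0" by (simp add: set_lebesgue_integral_def)
    finally show ?thesis .
  qed
  have "2 * cint (\<lambda>x. (p x)\<^sup>2) = (LINT t|lborel. 2 * cint (\<lambda>x. (p x)\<^sup>2) * indicator ?T t) - 2 * (LINT t|lborel. indicator ?T t * c t)"
    unfolding c0 by (simp add: measure_def emeasure_cell)
  also have "\<dots> = (LINT t|lborel. 2 * cint (\<lambda>x. (p x)\<^sup>2) * indicator ?T t - 2 * (indicator ?T t * c t))"
    using T1 ci by (simp add: Bochner_Integration.integral_diff)
  also have "\<dots> \<le> (LINT t|lborel. (\<Sum>i\<in>UNIV. S * (indicator ?T t * (t $ i)\<^sup>2)))"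
  proof (rule integral_mono)
    show "integrable lborel (\<lambda>t. 2 * cint (\<lambda>x. (p x)\<^sup>2) * indicator ?T t - 2 * (indicator ?T t * c t))"
      using T1 ci by (intro Bochner_Integration.integrable_diff integrable_mult_right) auto
    show "integrable lborel (\<lambda>t. \<Sum>i\<in>UNIV. S * (indicator ?T t * (t $ i)\<^sup>2))"
      using average_coordinate_square(2) unfolding set_integrable_def
      by (intro Bochner_Integration.integrable_sum integrable_mult_right) simp
    fix t :: "real ^ 'n"
    show "2 * cint (\<lambda>x. (p x)\<^sup>2) * indicator ?T t - 2 * (indicator ?T t * c t) \<le> (\<Sum>i\<in>UNIV. S * (indicator ?T t * (t $ i)\<^sup>2))"
      using le[of t] by (auto simp: indicator_def sum_distrib_left[symmetric] mult.commute)
  qed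
  also have "\<dots> = (\<Sum>i\<in>UNIV. S * (LINT t:?T|lborel. (t $ i)\<^sup>2))"
    using average_coordinate_square(2) unfolding set_integrable_def set_lebesgue_integral_def
    by (subst Bochner_Integration.integral_sum) auto
  also have "\<dots> \<le> (\<Sum>i\<in>(UNIV :: 'n set). S * (5 / 32))"
    using average_coordinate_square(1) S by (intro sum_mono mult_left_mono) auto
  finally show ?thesis by (simp add: S_def[symmetric])
qed

subsection \<open>Weak derivatives in the periodic space\<close>

definition l2_conv :: "'n::finite l2 \<Rightarrow> (real ^ 'n \<Rightarrow> real) \<Rightarrow> real ^ 'n \<Rightarrow> real" where
  "l2_conv u \<eta> = conv (SOME f. sq_int f \<and> u = l2 f) \<eta>"

lemma conv_cong_AE:
  assumes "sq_int f" "sq_int g" "AE x in lborel. f x = g x" "test_function \<eta>"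
  shows "conv f \<eta> x = conv g \<eta> x"
  unfolding conv_def
proof (rule integral_cong_AE)
  note [measurable] = sq_intD(1)[OF assms(1)] sq_intD(1)[OF assms(2)] borel_measurable_test_function[OF assms(4)]
  show "(\<lambda>y. f y * \<eta> (x - y)) \<in> borel_measurable lborel" "(\<lambda>y. g y * \<eta> (x - y)) \<in> borel_measurable lborel"
    by measurable
  show "AE y in lborel. f y * \<eta> (x - y) = g y * \<eta> (x - y)"
    using assms(3) by (rule eventually_mono) simp
qed

lemma l2_conv_l2:
  assumes f: "sq_int f" and \<eta>: "test_function \<eta>"
  shows "l2_conv (l2 f) \<eta> x = conv f \<eta> x"
proof -
  define g where "g = (SOME g. sq_int g \<and> l2 f = l2 g)"
  have g: "sq_int g \<and> l2 f = l2 g" unfolding g_def by (rule someI[of _ f]) (simp add: f)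
  then have "AE x in lborel. g x = f x" using f l2_eq_iff[of g f] by simp
  then have "conv g \<eta> x = conv f \<eta> x" using conv_cong_AE f g \<eta> by blast
  moreover have "l2_conv (l2 f) \<eta> x = conv g \<eta> x" by (simp only: l2_conv_def g_def)
  ultimately show ?thesis by simp
qed

text \<open>The bound on compact sets is uniform in the function, so evaluating a convolution at a
  point is continuous on \<open>'n l2\<close>. This is what makes the weak derivative a closed
  relation.\<close>

lemma bounded_linear_l2_conv:
  assumes \<eta>: "test_function \<eta>"
  shows "bounded_linear (\<lambda>u. l2_conv u \<eta> x)"
proof -
  obtain M where M: "0 < M" "\<And>x. norm x > M \<Longrightarrow> \<eta> x = 0" using test_function_support[OF \<eta>] by blast
  obtain B where B: "0 < B" "\<And>x. \<bar>\<eta> x\<bar> \<le> B" using test_function_bounded[OF \<eta>] by blast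
  obtain N :: nat where N: "\<And>f. sq_int f \<Longrightarrow> set_integrable lborel (cball x M) f \<and>
      (LINT y:cball x M|lborel. \<bar>f y\<bar>) \<le> real N * norm (l2 f)"
    using periodic_compact_bound[OF compact_cball] by blast
  note [measurable] = borel_measurable_test_function[OF \<eta>]
  show ?thesis
  proof (rule bounded_linear_intro)
    show "l2_conv (u + v) \<eta> x = l2_conv u \<eta> x + l2_conv v \<eta> x" for u v
    proof -
      obtain f where f: "sq_int f" "u = l2 f" by (rule l2_cases)
      obtain g where g: "sq_int g" "v = l2 g" by (rule l2_cases)
      have "l2_conv (u + v) \<eta> x = conv (\<lambda>x. f x + g x) \<eta> x"
        using l2_conv_l2[OF sq_int_add[OF f(1) g(1)] \<eta>] by (simp add: f g l2_add)
      also have "\<dots> = conv f \<eta> x + conv g \<eta> x"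
        using conv_integrable[OF f(1) \<eta>, of x] conv_integrable[OF g(1) \<eta>, of x]
        by (simp add: conv_def distrib_right)
      finally show ?thesis by (simp add: f g l2_conv_l2 \<eta>)
    qed
    show "l2_conv (c *\<^sub>R u) \<eta> x = c *\<^sub>R l2_conv u \<eta> x" for c u
    proof -
      obtain f where f: "sq_int f" "u = l2 f" by (rule l2_cases)
      have "l2_conv (c *\<^sub>R u) \<eta> x = conv (\<lambda>x. c * f x) \<eta> x"
        using l2_conv_l2[OF sq_int_cmult[OF f(1)] \<eta>] by (simp add: f l2_scaleR)
      then show ?thesis using f \<eta> by (simp add: conv_def l2_conv_l2 mult.assoc)
    qed
    show "norm (l2_conv u \<eta> x) \<le> norm u * (B * real N)" for u
    proof -
      obtain f where f: "sq_int f" "u = l2 f" by (rule l2_cases)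
      have "\<bar>LINT y|lborel. f y * \<eta> (x - y)\<bar> \<le> B * (LINT y:cball x M|lborel. \<bar>f y\<bar>)"
      proof (rule integrable_mult_compact_support(2))
        show "f \<in> borel_measurable borel" using f(1) by (rule sq_intD)
        show "set_integrable lborel (cball x M) f" using N f(1) by blast
        show "\<eta> (x - y) = 0" if "y \<notin> cball x M" for y using that M(2)[of "x - y"] by (simp add: dist_norm)
      qed (use B in auto)
      also have "\<dots> \<le> B * (real N * norm (l2 f))" using N[OF f(1)] B by (intro mult_left_mono) auto
      finally show ?thesis by (simp add: f l2_conv_l2 \<eta> conv_def mult_ac)
    qed
  qed
qed

text \<open>Stated through convolutions, the weak derivative is visibly a closed linear relation.\<close>

definition l2_deriv :: "'n::finite \<Rightarrow> 'n l2 \<Rightarrow> 'n l2 \<Rightarrow> bool" where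
  "l2_deriv i u v \<longleftrightarrow> (\<forall>\<eta> x. test_function \<eta> \<longrightarrow> l2_conv u (pd i \<eta>) x = l2_conv v \<eta> x)"

lemma l2_deriv_linear:
  assumes "l2_deriv i u v" "l2_deriv i u' v'" shows "l2_deriv i (u + c *\<^sub>R u') (v + c *\<^sub>R v')"
  unfolding l2_deriv_def
proof (intro allI impI)
  fix \<eta> x assume \<eta>: "test_function (\<eta> :: real ^ 'a \<Rightarrow> real)"
  interpret a: bounded_linear "\<lambda>u. l2_conv u (pd i \<eta>) x" by (rule bounded_linear_l2_conv[OF test_function_pd[OF \<eta>]])
  interpret b: bounded_linear "\<lambda>u. l2_conv u \<eta> x" by (rule bounded_linear_l2_conv[OF \<eta>])
  show "l2_conv (u + c *\<^sub>R u') (pd i \<eta>) x = l2_conv (v + c *\<^sub>R v') \<eta> x"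
    using assms \<eta> by (simp add: a.add a.scaleR b.add b.scaleR l2_deriv_def)
qed

lemma closed_l2_deriv: "closed {z. l2_deriv i (fst z) (snd z)}"
proof -
  have "{z. l2_deriv i (fst z) (snd z)} = (\<Inter>\<eta>\<in>{\<eta>. test_function \<eta>}. \<Inter>x. {z. l2_conv (fst z) (pd i \<eta>) x = l2_conv (snd z) \<eta> x})"
    by (auto simp: l2_deriv_def)
  moreover have "closed {z. l2_conv (fst z) (pd i \<eta>) x = l2_conv (snd z) \<eta> x}" if "test_function \<eta>" for \<eta> :: "real ^ 'a \<Rightarrow> real" and x
    by (intro closed_Collect_eq bounded_linear.continuous_on[OF bounded_linear_l2_conv] continuous_intros
        test_function_pd that)
  ultimately show ?thesis by (simp only:) (intro closed_INT ballI; simp)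
qed

lemma l2_eq_0_if_l2_conv_zero:
  assumes "\<And>\<eta>. test_function \<eta> \<Longrightarrow> l2_conv u \<eta> 0 = 0" shows "u = 0"
proof -
  obtain f where f: "sq_int f" "u = l2 f" by (rule l2_cases)
  have "AE x in lborel. f x = 0"
    using AE_zero_if_conv_zero[OF f(1)] assms by (simp add: f l2_conv_l2)
  then show ?thesis using f l2_eq_iff[OF f(1) sq_int_const[of 0]] by (simp add: l2_zero)
qed

lemma l2_deriv_unique:
  assumes "l2_deriv i u v" "l2_deriv i u v'" shows "v = v'"
proof -
  have "l2_deriv i 0 (v - v')" using l2_deriv_linear[OF assms, of "-1"] by simp
  moreover have "l2_conv 0 (pd i \<eta>) x = 0" if "test_function \<eta>" for \<eta> :: "real ^ 'a \<Rightarrow> real" and x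
    using bounded_linear_l2_conv[OF test_function_pd[OF that]] linear_0 bounded_linear.linear by blast
  ultimately have "v - v' = 0" by (intro l2_eq_0_if_l2_conv_zero) (auto simp: l2_deriv_def)
  then show ?thesis by simp
qed

lemma pd_reflected:
  assumes "smooth \<eta>" shows "pd i (\<lambda>y. \<eta> (x - y)) y = - pd i \<eta> (x - y)"
proof -
  have "pd i (\<lambda>y. \<eta> (x + (-1) *\<^sub>R y)) y = (-1) * pd i \<eta> (x + (-1) *\<^sub>R y)"
    by (rule pd_affine) (rule smooth_differentiable[OF assms])
  then show ?thesis by simp
qed

lemma test_function_reflected: "test_function \<eta> \<Longrightarrow> test_function (\<lambda>y. \<eta> (x - y))"
  using test_function_affine[of \<eta> "-1" x] by simp

lemma conv_pd_smooth:
  assumes p: "smooth_periodic p" and \<eta>: "test_function \<eta>"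
  shows "conv p (pd i \<eta>) x = conv (pd i p) \<eta> x"
  using smooth_integration_by_parts[OF smooth_periodicD(1)[OF p] test_function_reflected[OF \<eta>, of x], of i]
  unfolding pd_reflected[OF test_functionD(1)[OF \<eta>]] by (simp add: conv_def)

lemma l2_deriv_smooth:
  assumes "smooth_periodic p" shows "l2_deriv i (l2 p) (l2 (pd i p))"
  unfolding l2_deriv_def
  by (simp add: l2_conv_l2 sq_int_smooth_periodic smooth_periodic_pd assms test_function_pd conv_pd_smooth)

lemma smooth_zero_if_AE_zero:
  assumes "smooth p" "AE x in lborel. p x = 0" shows "p x = 0"
proof -
  have "closed {x. p x = 0}" by (intro closed_Collect_eq smooth_continuous_on assms continuous_on_const)
  moreover have "AE x in lebesgue. x \<in> {x. p x = 0}" using assms(2) by (simp add: AE_completion_iff)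
  ultimately show ?thesis using mem_closed_if_AE_lebesgue by blast
qed

lemma smooth_periodic_zero:
  assumes p: "smooth_periodic p" and 0: "cint (\<lambda>x. (p x)\<^sup>2) = 0" shows "p x = 0"
proof -
  have "norm (l2 p) = 0" using norm_l2_power2[OF sq_int_smooth_periodic[OF p]] 0 by simp
  then have "AE x in lborel. p x = 0"
    using l2_eq_iff[OF sq_int_smooth_periodic[OF p] sq_int_const[of 0]] by (simp add: l2_zero)
  then show ?thesis using smooth_zero_if_AE_zero smooth_periodicD(1)[OF p] by blast
qed

section \<open>Density of smooth functions in the graph of the weak gradient\<close>

lemma cint_conv_conv:
  assumes f: "sq_int f" and \<eta>: "test_function \<eta>" and q: "sq_int q"
  shows "cint (\<lambda>x. f x * conv q (reflect \<eta>) x) = cint (\<lambda>x. conv f \<eta> x * q x)"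
  using cint_conv_adjoint[OF f q test_function_reflect[OF \<eta>]] by simp

lemma cint_square_nonneg: "0 \<le> cint (\<lambda>x. (f x)\<^sup>2)"
  by (auto simp: set_lebesgue_integral_def intro!: integral_nonneg_AE)

text \<open>The periodic Sobolev space of order 1, embedded as pairs of a function and its weak
  gradient. The norm of the product is the Sobolev norm, and completeness is closedness of the
  graph.\<close>

definition H1_graph :: "('n::finite l2 \<times> ('n l2 ^ 'n)) set" where
  "H1_graph = {(u, v). \<forall>i. l2_deriv i u (v $ i)}"

definition smooth_graph :: "('n::finite l2 \<times> ('n l2 ^ 'n)) set" where
  "smooth_graph = {(l2 p, \<chi> i. l2 (pd i p)) | p. smooth_periodic p}"

lemma smooth_graph_linear:
  assumes "smooth_periodic p" "smooth_periodic q"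
  shows "(l2 (\<lambda>x. p x + c * q x), \<chi> i. l2 (pd i (\<lambda>x. p x + c * q x)))
    = (l2 p, \<chi> i. l2 (pd i p)) + c *\<^sub>R (l2 q, \<chi> i. l2 (pd i q))"
proof -
  have "pd i (\<lambda>x. p x + c * q x) = (\<lambda>x. pd i p x + c * pd i q x)" for i
    using assms by (intro ext pd_linear_combination) (auto intro: smooth_differentiable smooth_periodicD)
  then have "l2 (pd i (\<lambda>x. p x + c * q x)) = l2 (pd i p) + c *\<^sub>R l2 (pd i q)" for i
    using assms by (simp add: l2_add l2_scaleR sq_int_smooth_periodic smooth_periodic_pd sq_int_cmult)
  moreover have "l2 (\<lambda>x. p x + c * q x) = l2 p + c *\<^sub>R l2 q"
    using assms by (simp add: l2_add l2_scaleR sq_int_smooth_periodic sq_int_cmult)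
  ultimately show ?thesis by (simp add: vec_eq_iff)
qed

lemma subspace_smooth_graph: "subspace (smooth_graph :: ('a::finite l2 \<times> ('a l2 ^ 'a)) set)"
proof (rule subspaceI)
  have *: "x + c *\<^sub>R y \<in> smooth_graph" if xy: "x \<in> smooth_graph" "y \<in> smooth_graph" for x y :: "'a l2 \<times> ('a l2 ^ 'a)" and c
  proof -
    obtain p where p: "smooth_periodic p" "x = (l2 p, \<chi> i. l2 (pd i p))"
      using xy(1) unfolding smooth_graph_def by blast
    obtain q where q: "smooth_periodic q" "y = (l2 q, \<chi> i. l2 (pd i q))"
      using xy(2) unfolding smooth_graph_def by blast
    have "x + c *\<^sub>R y = (l2 (\<lambda>x. p x + c * q x), \<chi> i. l2 (pd i (\<lambda>x. p x + c * q x)))"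
      unfolding p(2) q(2) by (rule smooth_graph_linear[OF p(1) q(1), symmetric])
    then show ?thesis using smooth_periodic_linear_combination[OF p(1) q(1)] unfolding smooth_graph_def by blast
  qed
  show z: "(0 :: 'a l2 \<times> ('a l2 ^ 'a)) \<in> smooth_graph"
  proof -
    have "(0 :: 'a l2 \<times> ('a l2 ^ 'a)) = (l2 (\<lambda>x. 0), \<chi> i. l2 (pd i (\<lambda>x. 0)))"
      by (simp add: l2_zero frechet_derivative_const zero_prod_def vec_eq_iff)
    then show ?thesis unfolding smooth_graph_def mem_Collect_eq
      by (intro exI[of _ "\<lambda>x. 0"] conjI smooth_periodic_const)
  qed
  show "x + y \<in> smooth_graph" if "x \<in> smooth_graph" "y \<in> smooth_graph" for x y :: "'a l2 \<times> ('a l2 ^ 'a)"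
    using *[OF that, of 1] by simp
  show "c *\<^sub>R x \<in> smooth_graph" if "x \<in> smooth_graph" for x :: "'a l2 \<times> ('a l2 ^ 'a)" and c
    using *[OF z that, of c] by simp
qed

lemma closed_H1_graph: "closed H1_graph"
proof -
  have "H1_graph = (\<Inter>i. (\<lambda>z :: 'a l2 \<times> ('a l2 ^ 'a). (fst z, snd z $ i)) -` {z. l2_deriv i (fst z) (snd z)})"
    by (auto simp: H1_graph_def)
  moreover have "closed (\<Inter>i. (\<lambda>z :: 'a l2 \<times> ('a l2 ^ 'a). (fst z, snd z $ i)) -` {z. l2_deriv i (fst z) (snd z)})"
    by (intro closed_INT ballI closed_vimage closed_l2_deriv continuous_intros)
  ultimately show ?thesis by (rule ssubst)
qed

lemma smooth_graph_subset: "smooth_graph \<subseteq> H1_graph"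
  by (auto simp: smooth_graph_def H1_graph_def intro: l2_deriv_smooth)

text \<open>The orthogonal complement of the smooth graph in the graph of the weak gradient is trivial: test with
  the double convolution of \<open>f\<close> with \<open>\<eta>\<close> and its reflection.\<close>

lemma H1_graph_orthogonal_smooth:
  assumes z: "(u, v) \<in> H1_graph" and orth: "\<And>r. r \<in> smooth_graph \<Longrightarrow> (u, v) \<bullet> r = 0"
  shows "(u, v) = 0"
proof -
  have l2_deriv: "l2_deriv i u (v $ i)" for i using z by (simp add: H1_graph_def)
  obtain f where f: "sq_int f" "u = l2 f" by (rule l2_cases)
  have "\<forall>i. \<exists>g. sq_int g \<and> v $ i = l2 g" using l2_cases by metis
  then obtain g where g: "\<And>i. sq_int (g i)" "\<And>i. v $ i = l2 (g i)" by metis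
  have u0: "u = 0"
  proof (rule l2_eq_0_if_l2_conv_zero)
    fix \<eta> :: "real ^ 'a \<Rightarrow> real" assume \<eta>: "test_function \<eta>"
    define h where "h = conv f \<eta>"
    \<comment> \<open>The adjoint relation moves the reflected kernel to the other factor, so that
      both parts of the inner product become squares: the squared norm of \<open>h\<close> and those
      of its partial derivatives.\<close>
    define p where "p = conv h (reflect \<eta>)"
    have h: "smooth_periodic h" unfolding h_def by (rule smooth_periodic_conv[OF f(1) \<eta>])
    note sh = sq_int_smooth_periodic[OF h]
    have p: "smooth_periodic p" unfolding p_def by (rule smooth_periodic_conv[OF sh test_function_reflect[OF \<eta>]])
    have dh: "pd i h x = conv (g i) \<eta> x" for i x
    proof -
      have "pd i h x = conv f (pd i \<eta>) x" unfolding h_def by (rule fun_cong[OF pd_conv[OF f(1) \<eta>]])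
      also have "\<dots> = conv (g i) \<eta> x"
        using l2_deriv[of i] \<eta> l2_conv_l2[OF f(1) test_function_pd[OF \<eta>]] l2_conv_l2[OF g(1) \<eta>]
        unfolding l2_deriv_def f(2) g(2) by metis
      finally show ?thesis .
    qed
    have dp: "pd i p x = conv (pd i h) (reflect \<eta>) x" for i x
    proof -
      have "pd i p x = conv h (pd i (reflect \<eta>)) x"
        unfolding p_def by (rule fun_cong[OF pd_conv[OF sh test_function_reflect[OF \<eta>]]])
      also have "\<dots> = conv (pd i h) (reflect \<eta>) x" by (rule conv_pd_smooth[OF h test_function_reflect[OF \<eta>]])
      finally show ?thesis .
    qed
    have sdh: "sq_int (pd i h)" for i by (rule sq_int_smooth_periodic[OF smooth_periodic_pd[OF h]])
    have "u \<bullet> l2 p = cint (\<lambda>x. f x * p x)" unfolding f(2) by (rule inner_l2[OF f(1) sq_int_smooth_periodic[OF p]])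
    also have "\<dots> = cint (\<lambda>x. (h x)\<^sup>2)"
      unfolding p_def by (subst cint_conv_conv[OF f(1) \<eta> sh]) (simp add: h_def power2_eq_square)
    finally have 1: "u \<bullet> l2 p = cint (\<lambda>x. (h x)\<^sup>2)" .
    have 2: "v $ i \<bullet> l2 (pd i p) = cint (\<lambda>x. (pd i h x)\<^sup>2)" for i
    proof -
      have "v $ i \<bullet> l2 (pd i p) = cint (\<lambda>x. g i x * pd i p x)"
        unfolding g(2) by (rule inner_l2[OF g(1) sq_int_smooth_periodic[OF smooth_periodic_pd[OF p]]])
      also have "\<dots> = cint (\<lambda>x. conv (g i) \<eta> x * pd i h x)"
        unfolding dp by (rule cint_conv_conv[OF g(1) \<eta> sdh])
      finally show ?thesis unfolding dh by (simp add: power2_eq_square)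
    qed
    have "(u, v) \<bullet> (l2 p, \<chi> i. l2 (pd i p)) = 0"
      by (rule orth) (use p in \<open>auto simp: smooth_graph_def\<close>)
    then have "cint (\<lambda>x. (h x)\<^sup>2) + (\<Sum>i\<in>UNIV. cint (\<lambda>x. (pd i h x)\<^sup>2)) = 0"
      by (simp add: inner_prod_def inner_vec_def 1 2)
    moreover have "0 \<le> (\<Sum>i\<in>UNIV. cint (\<lambda>x. (pd i h x)\<^sup>2))" by (intro sum_nonneg cint_square_nonneg)
    ultimately have "cint (\<lambda>x. (h x)\<^sup>2) = 0" using cint_square_nonneg[of h] by linarith
    then have "h 0 = 0" by (rule smooth_periodic_zero[OF h])
    then show "l2_conv u \<eta> 0 = 0" by (simp add: f l2_conv_l2 \<eta> h_def)
  qed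
  moreover have "v = 0"
  proof -
    have "l2_deriv i 0 0" for i :: 'a using l2_deriv_smooth[OF smooth_periodic_const[of 0], of i]
      by (simp add: frechet_derivative_const l2_zero)
    then have "v $ i = 0" for i using l2_deriv_unique l2_deriv u0 by blast
    then show ?thesis by (simp add: vec_eq_iff)
  qed
  ultimately show ?thesis by (simp add: zero_prod_def)
qed

lemma H1_graph_diff: "z \<in> H1_graph \<Longrightarrow> z' \<in> H1_graph \<Longrightarrow> z - z' \<in> H1_graph"
  using l2_deriv_linear[where c = "-1"] by (fastforce simp: H1_graph_def)

text \<open>The closed graph contains the smooth one, so the residual of the projection onto the
  closure stays in the graph; being orthogonal to all smooth pairs, it is 0.\<close>

lemma H1_graph_eq_closure: "H1_graph = closure (smooth_graph :: ('a::finite l2 \<times> ('a l2 ^ 'a)) set)"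
proof
  show sub: "closure (smooth_graph :: ('a l2 \<times> ('a l2 ^ 'a)) set) \<subseteq> H1_graph"
    by (rule closure_minimal[OF smooth_graph_subset closed_H1_graph])
  show "H1_graph \<subseteq> closure (smooth_graph :: ('a l2 \<times> ('a l2 ^ 'a)) set)"
  proof
    fix z :: "'a l2 \<times> ('a l2 ^ 'a)" assume z: "z \<in> H1_graph"
    show "z \<in> closure smooth_graph"
    proof (rule orthogonal_projection_closure[OF subspace_smooth_graph, of z])
      fix p assume p: "p \<in> closure smooth_graph" "\<And>r. r \<in> smooth_graph \<Longrightarrow> (z - p) \<bullet> r = 0"
      have "z - p \<in> H1_graph" using z p(1) sub by (blast intro: H1_graph_diff)
      then have "z - p = 0"
        using H1_graph_orthogonal_smooth[of "fst (z - p)" "snd (z - p)", unfolded prod.collapse] p(2) by blast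
      then show "z \<in> closure smooth_graph" using p(1) by simp
    qed
  qed
qed

text \<open>Density as a proof rule, for the identities and inequalities that are first derived by
  classical calculus.\<close>

lemma H1_graph_induct:
  assumes "closed {z. P z}" and "\<And>p. smooth_periodic p \<Longrightarrow> P (l2 p, \<chi> i. l2 (pd i p))" and "z \<in> H1_graph"
  shows "P z"
proof -
  have "smooth_graph \<subseteq> {z. P z}" using assms(2) by (auto simp: smooth_graph_def)
  then have "closure smooth_graph \<subseteq> {z. P z}" using assms(1) by (rule closure_minimal)
  then show ?thesis using assms(3) H1_graph_eq_closure by blast
qed

section \<open>Extension of classical facts by density\<close>

definition one_l2 :: "'n::finite l2" where "one_l2 = l2 (\<lambda>x. 1)"

lemma inner_one_l2: "sq_int f \<Longrightarrow> l2 f \<bullet> one_l2 = cint f"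
  using inner_l2[OF _ sq_int_const[of 1]] by (simp add: one_l2_def)

lemma H1_mean_derivative:
  assumes "(u, v) \<in> H1_graph" shows "v $ i \<bullet> one_l2 = 0"
proof -
  have "snd (u, v) $ i \<bullet> one_l2 = 0"
  proof (rule H1_graph_induct[OF _ _ assms])
    show "closed {z :: 'a l2 \<times> ('a l2 ^ 'a). snd z $ i \<bullet> one_l2 = 0}"
      by (intro closed_Collect_eq continuous_intros)
    show "snd (l2 p, \<chi> i. l2 (pd i p)) $ i \<bullet> one_l2 = 0" if p: "smooth_periodic p" for p
      by (simp add: inner_one_l2 sq_int_smooth_periodic smooth_periodic_pd p cint_pd_eq_0)
  qed
  then show ?thesis by simp
qed

text \<open>Integration by parts leads to \<open>p\<close> times a second derivative of
  \<open>q\<close>, where the order of the indices can be exchanged.\<close>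

lemma smooth_mixed_product:
  assumes p: "smooth_periodic p" and q: "smooth_periodic q"
  shows "l2 (pd i p) \<bullet> l2 (pd j q) = l2 (pd j p) \<bullet> l2 (pd i q)"
proof -
  have c: "l2 (pd i p) \<bullet> l2 (pd j q) = - cint (\<lambda>x. p x * pd i (pd j q) x)" for i j
    using cint_integration_by_parts[OF p smooth_periodic_pd[OF q]]
    by (simp add: inner_l2 sq_int_smooth_periodic smooth_periodic_pd p q)
  show ?thesis unfolding c using pd_commute[OF smooth_periodicD(1)[OF q], where i = i and j = j] by simp
qed

text \<open>The factors lack second derivatives, so the classical integration by parts is reached by
  density, in one factor after the other.\<close>

lemma H1_mixed_product:
  assumes "(u, v) \<in> H1_graph" "(u', v') \<in> H1_graph"
  shows "v $ i \<bullet> v' $ j = v $ j \<bullet> v' $ i"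
proof -
  have sm: "snd (u, v) $ i \<bullet> l2 (pd j q) = snd (u, v) $ j \<bullet> l2 (pd i q)" if q: "smooth_periodic q" for q
  proof (rule H1_graph_induct[OF _ _ assms(1)])
    show "closed {z :: 'a l2 \<times> ('a l2 ^ 'a). snd z $ i \<bullet> l2 (pd j q) = snd z $ j \<bullet> l2 (pd i q)}"
      by (intro closed_Collect_eq continuous_intros)
  qed (simp add: smooth_mixed_product q)
  have "v $ i \<bullet> snd (u', v') $ j = v $ j \<bullet> snd (u', v') $ i"
  proof (rule H1_graph_induct[OF _ _ assms(2)])
    show "closed {z :: 'a l2 \<times> ('a l2 ^ 'a). v $ i \<bullet> snd z $ j = v $ j \<bullet> snd z $ i}"
      by (intro closed_Collect_eq continuous_intros)
  qed (use sm in simp)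
  then show ?thesis by simp
qed

lemma H1_poincare:
  fixes u :: "'n::finite l2"
  assumes "(u, v) \<in> H1_graph" and mean: "u \<bullet> one_l2 = 0"
  shows "(norm u)\<^sup>2 \<le> real CARD('n) * (5 / 64) * (norm v)\<^sup>2"
proof -
  \<comment> \<open>Zero mean is not inherited by approximating smooth functions. The variance form,
    with the squared mean subtracted, makes sense for every function and is a closed condition, so
    this is the form that is extended.\<close>
  have "(norm (fst (u, v)))\<^sup>2 - (fst (u, v) \<bullet> one_l2)\<^sup>2 \<le> real CARD('n) * (5 / 64) * (norm (snd (u, v)))\<^sup>2"
  proof (rule H1_graph_induct[OF _ _ assms(1)])
    show "closed {z :: 'n l2 \<times> ('n l2 ^ 'n). (norm (fst z))\<^sup>2 - (fst z \<bullet> one_l2)\<^sup>2 \<le> real CARD('n) * (5 / 64) * (norm (snd z))\<^sup>2}"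
      by (intro closed_Collect_le continuous_intros)
    fix p :: "real ^ 'n \<Rightarrow> real" assume p: "smooth_periodic p"
    note sp = sq_int_smooth_periodic[OF p]
    define m where "m = cint p"
    define q where "q x = p x + (-1) * m" for x
    have q: "smooth_periodic q" unfolding q_def
      by (rule smooth_periodic_linear_combination[OF p smooth_periodic_const])
    have dq: "pd i q x = pd i p x" for i x
    proof -
      have "pd i q x = pd i p x + (-1) * pd i (\<lambda>x. m) x" unfolding q_def
        by (rule pd_linear_combination) (use smooth_differentiable smooth_periodicD(1)[OF p] in auto)
      then show ?thesis by (simp add: frechet_derivative_const)
    qed
    have lq: "l2 q = l2 p - m *\<^sub>R one_l2"
      using l2_add[OF sp sq_int_const[of "(-1) * m"]] l2_scaleR[OF sq_int_const[of 1], of "-m"]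
      by (simp add: q_def[abs_def] one_l2_def)
    have one: "(one_l2 :: 'n l2) \<bullet> one_l2 = 1"
      using inner_one_l2[OF sq_int_const[of 1]]
      by (simp add: one_l2_def set_lebesgue_integral_def measure_def emeasure_cell)
    have m: "l2 p \<bullet> one_l2 = m" "one_l2 \<bullet> l2 p = m"
      using inner_one_l2[OF sp] inner_commute[of one_l2 "l2 p"] by (simp_all add: m_def)
    have "cint q = l2 q \<bullet> one_l2" by (simp add: inner_one_l2 sq_int_smooth_periodic q)
    also have "\<dots> = 0" by (simp add: lq inner_diff_left m one)
    finally have "cint (\<lambda>x. (q x)\<^sup>2) \<le> real CARD('n) * (5 / 64) * (\<Sum>i\<in>UNIV. cint (\<lambda>x. (pd i q x)\<^sup>2))"
      by (rule smooth_poincare[OF q])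
    moreover have "cint (\<lambda>x. (q x)\<^sup>2) = (norm (l2 p))\<^sup>2 - m\<^sup>2"
      unfolding norm_l2_power2[OF sq_int_smooth_periodic[OF q], symmetric] lq
      unfolding power2_norm_eq_inner
      by (simp add: inner_diff_left inner_diff_right m one power2_eq_square)
    moreover have "(\<Sum>i\<in>UNIV. cint (\<lambda>x. (pd i q x)\<^sup>2)) = (norm ((\<chi> i. l2 (pd i p)) :: 'n l2 ^ 'n))\<^sup>2"
      unfolding dq norm_vec_def L2_set_def
      by (simp add: norm_l2_power2 sq_int_smooth_periodic smooth_periodic_pd p sum_nonneg cint_square_nonneg)
    ultimately show "(norm (fst (l2 p, \<chi> i. l2 (pd i p))))\<^sup>2 - (fst (l2 p, \<chi> i. l2 (pd i p)) \<bullet> one_l2)\<^sup>2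
        \<le> real CARD('n) * (5 / 64) * (norm (snd (l2 p, (\<chi> i. l2 (pd i p)) :: 'n l2 ^ 'n)))\<^sup>2"
      by (simp add: m)
  qed
  then show ?thesis using mean by simp
qed

section \<open>Density of Laplacians among functions of mean zero\<close>

definition laplacian :: "(real ^ 'n \<Rightarrow> real) \<Rightarrow> real ^ 'n \<Rightarrow> real" where
  "laplacian q x = (\<Sum>i\<in>UNIV. pd i (pd i q) x)"

lemma smooth_periodic_laplacian: "smooth_periodic q \<Longrightarrow> smooth_periodic (laplacian q)"
  unfolding laplacian_def[abs_def] by (intro smooth_periodic_sum smooth_periodic_pd)

text \<open>For \<open>q\<close> the double convolution of a representative of \<open>u\<close>, the
  pairing is minus the squared norm of the gradient of \<open>h\<close>. So \<open>h\<close> has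
  mean zero and no gradient, and vanishes by the Poincare inequality.\<close>

lemma laplacian_orthogonal_zero:
  fixes u :: "'n::finite l2"
  assumes mean: "u \<bullet> one_l2 = 0" and orth: "\<And>q. smooth_periodic q \<Longrightarrow> u \<bullet> l2 (laplacian q) = 0"
  shows "u = 0"
proof (rule l2_eq_0_if_l2_conv_zero)
  fix \<eta> :: "real ^ 'n \<Rightarrow> real" assume \<eta>: "test_function \<eta>"
  note \<eta>' = test_function_reflect[OF \<eta>]
  obtain f where f: "sq_int f" "u = l2 f" by (rule l2_cases)
  define h where "h = conv f \<eta>"
  have h: "smooth_periodic h" unfolding h_def by (rule smooth_periodic_conv[OF f(1) \<eta>])
  define q where "q = conv h (reflect \<eta>)"
  have q: "smooth_periodic q" unfolding q_def by (rule smooth_periodic_conv[OF sq_int_smooth_periodic[OF h] \<eta>'])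
  have pdc: "pd i (conv r (reflect \<eta>)) = conv (pd i r) (reflect \<eta>)" if r: "smooth_periodic r" for r i
  proof
    fix x
    have "pd i (conv r (reflect \<eta>)) x = conv r (pd i (reflect \<eta>)) x"
      by (rule fun_cong[OF pd_conv[OF sq_int_smooth_periodic[OF r] \<eta>']])
    also have "\<dots> = conv (pd i r) (reflect \<eta>) x" by (rule conv_pd_smooth[OF r \<eta>'])
    finally show "pd i (conv r (reflect \<eta>)) x = conv (pd i r) (reflect \<eta>) x" .
  qed
  have ddq: "pd i (pd i q) x = conv (pd i (pd i h)) (reflect \<eta>) x" for i x
    unfolding q_def pdc[OF h] by (rule fun_cong[OF pdc[OF smooth_periodic_pd[OF h]]])
  note s = sq_int_smooth_periodic[OF smooth_periodic_pd[OF smooth_periodic_pd[OF h]]]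
  have sq: "sq_int (pd i (pd i q))" for i
    by (rule sq_int_smooth_periodic[OF smooth_periodic_pd[OF smooth_periodic_pd[OF q]]])
  have "0 = u \<bullet> l2 (laplacian q)" using orth[OF q] by simp
  also have "l2 (laplacian q) = (\<Sum>i\<in>UNIV. l2 (pd i (pd i q)))"
    unfolding laplacian_def[abs_def] by (rule l2_sum) (auto intro: sq)
  also have "u \<bullet> \<dots> = (\<Sum>i\<in>UNIV. u \<bullet> l2 (pd i (pd i q)))" by (rule inner_sum_right)
  also have "\<dots> = (\<Sum>i\<in>UNIV. - cint (\<lambda>x. (pd i h x)\<^sup>2))"
  proof (rule sum.cong[OF refl])
    fix i
    have "u \<bullet> l2 (pd i (pd i q)) = cint (\<lambda>x. f x * pd i (pd i q) x)" unfolding f(2) by (rule inner_l2[OF f(1) sq])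
    also have "\<dots> = cint (\<lambda>x. h x * pd i (pd i h) x)"
      unfolding ddq h_def[symmetric] by (subst cint_conv_conv[OF f(1) \<eta> s]) (simp add: h_def)
    also have "\<dots> = - cint (\<lambda>x. (pd i h x)\<^sup>2)"
      using cint_integration_by_parts[OF h smooth_periodic_pd[OF h], of i i] by (simp add: power2_eq_square)
    finally show "u \<bullet> l2 (pd i (pd i q)) = - cint (\<lambda>x. (pd i h x)\<^sup>2)" .
  qed
  finally have g0: "(\<Sum>i\<in>UNIV. cint (\<lambda>x. (pd i h x)\<^sup>2)) = 0" by (simp add: sum_negf)
  \<comment> \<open>By the adjoint relation the mean of \<open>h\<close> is the integral of the
    kernel times the mean of \<open>f\<close>.\<close>
  have "cint h = cint (\<lambda>x. 1 * conv f \<eta> x)" by (simp add: h_def)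
  also have "\<dots> = cint (\<lambda>x. conv (\<lambda>x. 1) (reflect \<eta>) x * f x)"
    by (rule cint_conv_adjoint[OF sq_int_const f(1) \<eta>])
  also have "conv (\<lambda>x. 1) (reflect \<eta>) = (\<lambda>x. LINT y|lborel. reflect \<eta> y)"
    using integral_lborel_reflect[OF borel_measurable_test_function[OF \<eta>']] by (simp add: conv_def[abs_def])
  also have "cint (\<lambda>x. (LINT y|lborel. reflect \<eta> y) * f x) = (LINT y|lborel. reflect \<eta> y) * cint f"
    by simp
  also have "cint f = 0" using mean inner_one_l2[OF f(1)] f(2) by simp
  finally have "cint h = 0" by simp
  then have "cint (\<lambda>x. (h x)\<^sup>2) \<le> 0" using smooth_poincare[OF h] g0 by simp
  then have "cint (\<lambda>x. (h x)\<^sup>2) = 0" using cint_square_nonneg[of h] by linarith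
  then have "h 0 = 0" by (rule smooth_periodic_zero[OF h])
  then show "l2_conv u \<eta> 0 = 0" by (simp add: f l2_conv_l2 \<eta> h_def)
qed

text \<open>A substitute for solving the Poisson equation. Laplacians have mean zero, so the
  residual of the projection has mean zero as well, and the orthogonality lemma applies to
  it.\<close>

lemma laplacian_dense:
  fixes u :: "'n::finite l2"
  assumes mean: "u \<bullet> one_l2 = 0" and e: "0 < e"
  shows "\<exists>q. smooth_periodic q \<and> norm (l2 (laplacian q) - u) < e"
proof -
  define R where "R = {l2 (laplacian q) :: 'n l2 | q. smooth_periodic q}"
  have lin: "l2 (laplacian p) + c *\<^sub>R l2 (laplacian q) \<in> R" if p: "smooth_periodic p" and q: "smooth_periodic q" for p q c
  proof -
    have step: "pd i (\<lambda>x. p x + c * q x) = (\<lambda>x. pd i p x + c * pd i q x)" if pq: "smooth_periodic p" "smooth_periodic q" for p q i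
      using pq by (intro ext pd_linear_combination) (auto intro: smooth_differentiable smooth_periodicD)
    have "pd i (pd i (\<lambda>x. p x + c * q x)) = (\<lambda>x. pd i (pd i p) x + c * pd i (pd i q) x)" for i
      unfolding step[OF p q] by (rule step[OF smooth_periodic_pd[OF p] smooth_periodic_pd[OF q]])
    then have "pd i (pd i (\<lambda>x. p x + c * q x)) x = pd i (pd i p) x + c * pd i (pd i q) x" for i x
      by (rule fun_cong)
    then have "laplacian (\<lambda>x. p x + c * q x) = (\<lambda>x. laplacian p x + c * laplacian q x)"
      unfolding laplacian_def[abs_def] by (simp only: sum.distrib sum_distrib_left)
    then have "l2 (laplacian (\<lambda>x. p x + c * q x)) = l2 (laplacian p) + c *\<^sub>R l2 (laplacian q)"
      using p q by (simp add: l2_add l2_scaleR sq_int_smooth_periodic smooth_periodic_laplacian sq_int_cmult)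
    then show ?thesis using smooth_periodic_linear_combination[OF p q, of c] unfolding R_def by (metis (mono_tags, lifting) mem_Collect_eq)
  qed
  have zero: "0 \<in> R"
  proof -
    have "laplacian (\<lambda>x :: real ^ 'n. 0) = (\<lambda>x. 0)" by (simp add: laplacian_def[abs_def] frechet_derivative_const)
    then have "l2 (laplacian (\<lambda>x :: real ^ 'n. 0)) = 0" by (simp add: l2_zero)
    then show ?thesis using smooth_periodic_const[of 0] unfolding R_def by (metis (mono_tags, lifting) mem_Collect_eq)
  qed
  have "subspace R"
  proof (rule subspaceI)
    show "0 \<in> R" by (rule zero)
    show "x + y \<in> R" if xy: "x \<in> R" "y \<in> R" for x y
    proof -
      obtain p q where "smooth_periodic p" "x = l2 (laplacian p)" "smooth_periodic q" "y = l2 (laplacian q)"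
        using xy unfolding R_def by blast
      then show ?thesis using lin[of p q 1] by simp
    qed
    show "c *\<^sub>R x \<in> R" if x: "x \<in> R" for c x
    proof -
      obtain p where p: "smooth_periodic p" "x = l2 (laplacian p)" using x unfolding R_def by blast
      have "laplacian (\<lambda>x :: real ^ 'n. 0) = (\<lambda>x. 0)" by (simp add: laplacian_def[abs_def] frechet_derivative_const)
      then show ?thesis using lin[OF smooth_periodic_const[of 0] p(1), of c] p(2) by (simp add: l2_zero)
    qed
  qed
  then have "\<exists>p\<in>closure R. \<forall>r\<in>R. (u - p) \<bullet> r = 0"
    by (rule orthogonal_projection_closure[of R u]) blast
  then obtain p where p: "p \<in> closure R" "\<And>r. r \<in> R \<Longrightarrow> (u - p) \<bullet> r = 0" by blast
  have "R \<subseteq> {r. r \<bullet> one_l2 = 0}"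
  proof
    fix r assume "r \<in> R"
    then obtain q where q: "smooth_periodic q" "r = l2 (laplacian q)" unfolding R_def by blast
    have "r = (\<Sum>i\<in>UNIV. l2 (pd i (pd i q)))"
      unfolding q(2) laplacian_def[abs_def]
      by (rule l2_sum) (auto intro!: sq_int_smooth_periodic smooth_periodic_pd q(1))
    then show "r \<in> {r. r \<bullet> one_l2 = 0}"
      by (simp add: inner_sum_left inner_one_l2 sq_int_smooth_periodic smooth_periodic_pd q(1) cint_pd_eq_0)
  qed
  then have "closure R \<subseteq> {r. r \<bullet> one_l2 = 0}"
    by (rule closure_minimal) (intro closed_Collect_eq continuous_intros)
  then have "(u - p) \<bullet> one_l2 = 0" using p(1) mean by (auto simp: inner_diff_left)
  moreover have "(u - p) \<bullet> l2 (laplacian q) = 0" if "smooth_periodic q" for q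
    using p(2) that unfolding R_def by blast
  ultimately have "u - p = 0" by (rule laplacian_orthogonal_zero)
  then have "u \<in> closure R" using p(1) by simp
  then obtain r where "r \<in> R" "dist r u < e" using e closure_approachable by blast
  then show ?thesis unfolding R_def by (auto simp: dist_norm)
qed

lemma cint_sum:
  assumes "\<And>i. set_integrable lborel (cell 0) (f i)"
  shows "set_integrable lborel (cell 0) (\<lambda>x. \<Sum>i\<in>I. f i x)" "cint (\<lambda>x. \<Sum>i\<in>I. f i x) = (\<Sum>i\<in>I. cint (f i))"
proof -
  have "set_integrable lborel (cell 0) (\<lambda>x. \<Sum>i\<in>I. f i x) \<and> cint (\<lambda>x. \<Sum>i\<in>I. f i x) = (\<Sum>i\<in>I. cint (f i))"
  proof (induction I rule: infinite_finite_induct)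
    case (insert i I)
    then show ?case
      using set_integral_add[OF assms[of i], of "\<lambda>x. \<Sum>i\<in>I. f i x"] by simp
  qed (simp_all add: set_integrable_cell_const set_lebesgue_integral_def)
  then show "set_integrable lborel (cell 0) (\<lambda>x. \<Sum>i\<in>I. f i x)" "cint (\<lambda>x. \<Sum>i\<in>I. f i x) = (\<Sum>i\<in>I. cint (f i))"
    by auto
qed

subsection \<open>Multiplication by bounded coefficients\<close>

definition bounded_coeff :: "(real ^ 'n \<Rightarrow> real) \<Rightarrow> bool" where
  "bounded_coeff a \<longleftrightarrow> a \<in> borel_measurable borel \<and> periodic a \<and> (\<exists>M. AE x in lborel. \<bar>a x\<bar> \<le> M)"

lemma sq_int_bounded_mult:
  assumes a: "bounded_coeff a" and f: "sq_int f"
  shows "sq_int (\<lambda>x. a x * f x)" "\<exists>M\<ge>0. \<forall>f. sq_int f \<longrightarrow> norm (l2 (\<lambda>x. a x * f x)) \<le> M * norm (l2 f)"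
proof -
  obtain M0 where M0: "AE x in lborel. \<bar>a x\<bar> \<le> M0" using a by (auto simp: bounded_coeff_def)
  define M where "M = \<bar>M0\<bar>"
  have M: "0 \<le> M" "AE x in lborel. \<bar>a x\<bar> \<le> M"
    using M0 by (auto simp: M_def elim!: eventually_mono)
  note [measurable] = a[unfolded bounded_coeff_def, THEN conjunct1]
  have *: "sq_int (\<lambda>x. a x * f x) \<and> cint (\<lambda>x. (a x * f x)\<^sup>2) \<le> M\<^sup>2 * cint (\<lambda>x. (f x)\<^sup>2)" if f: "sq_int f" for f
  proof -
    note [measurable] = sq_intD(1)[OF f]
    have le: "AE x in lborel. indicator (cell 0) x *\<^sub>R (a x * f x)\<^sup>2 \<le> M\<^sup>2 * (indicator (cell 0) x *\<^sub>R (f x)\<^sup>2)"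
      using M(2)
    proof eventually_elim
      fix x assume "\<bar>a x\<bar> \<le> M"
      then have "(a x)\<^sup>2 \<le> M\<^sup>2" using power_mono[of "\<bar>a x\<bar>" M 2] by simp
      then show "indicator (cell 0) x *\<^sub>R (a x * f x)\<^sup>2 \<le> M\<^sup>2 * (indicator (cell 0) x *\<^sub>R (f x)\<^sup>2)"
        by (simp add: power_mult_distrib indicator_def mult_right_mono)
    qed
    have i: "integrable lborel (\<lambda>x. M\<^sup>2 * (indicator (cell 0) x *\<^sub>R (f x)\<^sup>2))"
      using sq_intD(3)[OF f] unfolding set_integrable_def by (rule integrable_mult_right)
    have int: "set_integrable lborel (cell 0) (\<lambda>x. (a x * f x)\<^sup>2)"
      unfolding set_integrable_def
    proof (rule Bochner_Integration.integrable_bound[OF i])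
      show "AE x in lborel. norm (indicator (cell 0) x *\<^sub>R (a x * f x)\<^sup>2) \<le> norm (M\<^sup>2 * (indicator (cell 0) x *\<^sub>R (f x)\<^sup>2))"
        using le by eventually_elim simp
    qed measurable
    have "cint (\<lambda>x. (a x * f x)\<^sup>2) \<le> (LINT x|lborel. M\<^sup>2 * (indicator (cell 0) x *\<^sub>R (f x)\<^sup>2))"
      unfolding set_lebesgue_integral_def
      by (rule integral_mono_AE[OF int[unfolded set_integrable_def] i le])
    also have "\<dots> = M\<^sup>2 * cint (\<lambda>x. (f x)\<^sup>2)" unfolding set_lebesgue_integral_def by (rule integral_mult_right_zero)
    finally show ?thesis
      using int periodic_compose2[of a f "\<lambda>s t. s * t"] a sq_intD(2)[OF f] by (simp add: sq_int_def bounded_coeff_def)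
  qed
  show "sq_int (\<lambda>x. a x * f x)" using * f by blast
  have "norm (l2 (\<lambda>x. a x * f x)) \<le> M * norm (l2 f)" if f: "sq_int f" for f
  proof (rule power2_le_imp_le)
    show "(norm (l2 (\<lambda>x. a x * f x)))\<^sup>2 \<le> (M * norm (l2 f))\<^sup>2"
      using *[OF f] by (simp add: norm_l2_power2 f power_mult_distrib)
  qed (use M in simp)
  then show "\<exists>M\<ge>0. \<forall>f. sq_int f \<longrightarrow> norm (l2 (\<lambda>x. a x * f x)) \<le> M * norm (l2 f)" using M(1) by blast
qed

definition l2_mul :: "(real ^ 'n::finite \<Rightarrow> real) \<Rightarrow> 'n l2 \<Rightarrow> 'n l2" where
  "l2_mul a u = l2 (\<lambda>x. a x * (SOME f. sq_int f \<and> u = l2 f) x)"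

lemma l2_mul_l2:
  assumes a: "bounded_coeff a" and f: "sq_int f" shows "l2_mul a (l2 f) = l2 (\<lambda>x. a x * f x)"
proof -
  define g where "g = (SOME g. sq_int g \<and> l2 f = l2 g)"
  have g: "sq_int g \<and> l2 f = l2 g" unfolding g_def by (rule someI[of _ f]) (simp add: f)
  then have "AE x in lborel. g x = f x" using f l2_eq_iff[of g f] by simp
  then have "AE x in lborel. a x * g x = a x * f x" by (rule eventually_mono) simp
  then have "l2 (\<lambda>x. a x * g x) = l2 (\<lambda>x. a x * f x)"
    using l2_eq_iff[OF sq_int_bounded_mult(1)[OF a] sq_int_bounded_mult(1)[OF a]] f g by blast
  moreover have "l2_mul a (l2 f) = l2 (\<lambda>x. a x * g x)" by (simp only: l2_mul_def g_def)
  ultimately show ?thesis by simp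
qed

lemma bounded_linear_l2_mul:
  fixes a :: "real ^ 'n \<Rightarrow> real"
  assumes a: "bounded_coeff a" shows "bounded_linear (l2_mul a)"
proof -
  obtain M where M: "\<And>f. sq_int f \<Longrightarrow> norm (l2 (\<lambda>x. a x * f x)) \<le> M * norm (l2 f)"
    using sq_int_bounded_mult(2)[OF a sq_int_const[of 0]] by blast
  note sa = sq_int_bounded_mult(1)[OF a]
  show ?thesis
  proof (rule bounded_linear_intro)
    show "l2_mul a (u + v) = l2_mul a u + l2_mul a v" for u v
    proof -
      obtain f where f: "sq_int f" "u = l2 f" by (rule l2_cases)
      obtain g where g: "sq_int g" "v = l2 g" by (rule l2_cases)
      have "l2_mul a (u + v) = l2 (\<lambda>x. a x * (f x + g x))"
        unfolding f(2) g(2) l2_add[OF f(1) g(1), symmetric] by (rule l2_mul_l2[OF a sq_int_add[OF f(1) g(1)]])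
      also have "\<dots> = l2_mul a u + l2_mul a v"
        unfolding f(2) g(2) l2_mul_l2[OF a f(1)] l2_mul_l2[OF a g(1)] l2_add[OF sa[OF f(1)] sa[OF g(1)], symmetric]
        by (simp add: distrib_left)
      finally show ?thesis .
    qed
    show "l2_mul a (c *\<^sub>R u) = c *\<^sub>R l2_mul a u" for c u
    proof -
      obtain f where f: "sq_int f" "u = l2 f" by (rule l2_cases)
      have "l2_mul a (c *\<^sub>R u) = l2 (\<lambda>x. a x * (c * f x))"
        unfolding f(2) l2_scaleR[OF f(1), symmetric] by (rule l2_mul_l2[OF a sq_int_cmult[OF f(1)]])
      also have "\<dots> = c *\<^sub>R l2_mul a u"
        unfolding f(2) l2_mul_l2[OF a f(1)] l2_scaleR[OF sa[OF f(1)], symmetric] by (simp add: mult.left_commute)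
      finally show ?thesis .
    qed
    show "norm (l2_mul a u) \<le> norm u * M" for u
    proof -
      obtain f where f: "sq_int f" "u = l2 f" by (rule l2_cases)
      show ?thesis unfolding f(2) l2_mul_l2[OF a f(1)] using M[OF f(1)] by (simp add: mult.commute)
    qed
  qed
qed

lemma bounded_linear_vecI:
  fixes f :: "'a::real_normed_vector \<Rightarrow> 'b::real_normed_vector ^ 'n"
  assumes "\<And>i. bounded_linear (\<lambda>x. f x $ i)" shows "bounded_linear f"
proof -
  have "\<forall>i. \<exists>K. \<forall>x. norm (f x $ i) \<le> norm x * K" using assms bounded_linear.bounded by blast
  then obtain K where K: "\<And>i x. norm (f x $ i) \<le> norm x * K i" by metis
  show ?thesis
  proof (rule bounded_linear_intro)
    show "f (x + y) = f x + f y" for x y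
      using linear_add[OF bounded_linear.linear[OF assms]] by (simp add: vec_eq_iff)
    show "f (c *\<^sub>R x) = c *\<^sub>R f x" for c x
      using linear_cmul[OF bounded_linear.linear[OF assms]] by (simp add: vec_eq_iff)
    fix x
    have "norm (f x) \<le> (\<Sum>i\<in>UNIV. norm (f x $ i))" unfolding norm_vec_def by (rule L2_set_le_sum) simp
    also have "\<dots> \<le> (\<Sum>i\<in>UNIV. norm x * K i)" by (intro sum_mono K)
    finally show "norm (f x) \<le> norm x * (\<Sum>i\<in>UNIV. K i)" by (simp add: sum_distrib_left)
  qed
qed

subsection \<open>The bilinear form\<close>

type_synonym 'n jet = "('n l2 ^ 'n) \<times> ('n l2 ^ 'n ^ 'n)"

text \<open>A jet \<open>(w, M)\<close> stands for a vector field with its Jacobian; \<open>M $ i $ j\<close> is the \<open>j\<close>-th derivative of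
  the \<open>i\<close>-th component.\<close>

definition jet_space :: "'n::finite jet set" where
  "jet_space = {(w, M). \<forall>i. w $ i \<bullet> one_l2 = 0 \<and> (w $ i, M $ i) \<in> H1_graph}"

definition jet_div :: "'n::finite jet \<Rightarrow> 'n l2" where
  "jet_div z = (\<Sum>i\<in>UNIV. snd z $ i $ i)"

definition jet_curl :: "'n::finite jet \<Rightarrow> 'n l2 ^ 'n ^ 'n" where
  "jet_curl z = (\<chi> i j. snd z $ i $ j - snd z $ j $ i)"

definition jet_op :: "('n::finite \<Rightarrow> 'n \<Rightarrow> real ^ 'n \<Rightarrow> real) \<Rightarrow> ('n \<Rightarrow> real ^ 'n \<Rightarrow> real) \<Rightarrow> 'n jet \<Rightarrow> 'n l2" where
  "jet_op a b z = (\<Sum>i\<in>UNIV. \<Sum>j\<in>UNIV. l2_mul (a i j) (snd z $ i $ j)) + (\<Sum>i\<in>UNIV. l2_mul (b i) (fst z $ i))"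

text \<open>The form \<open>B2\<close> on jets. It is not symmetric, since the coefficients act on
  the second argument only.\<close>

definition jet_form :: "('n::finite \<Rightarrow> 'n \<Rightarrow> real ^ 'n \<Rightarrow> real) \<Rightarrow> ('n \<Rightarrow> real ^ 'n \<Rightarrow> real) \<Rightarrow> 'n jet \<Rightarrow> 'n jet \<Rightarrow> real" where
  "jet_form a b z z' = jet_div z \<bullet> jet_op a b z' + 1 / 2 * (jet_curl z \<bullet> jet_curl z')"

lemma bounded_linear_snd_nth: "bounded_linear (\<lambda>z :: 'n::finite jet. snd z $ i $ j)"
  by (intro bounded_linear_compose[OF bounded_linear_vec_nth] bounded_linear_snd)

lemma bounded_linear_fst_nth: "bounded_linear (\<lambda>z :: 'n::finite jet. fst z $ i)"
  by (intro bounded_linear_compose[OF bounded_linear_vec_nth] bounded_linear_fst)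

lemma bounded_linear_jet_div: "bounded_linear jet_div"
  unfolding jet_div_def[abs_def] by (intro bounded_linear_sum bounded_linear_snd_nth)

lemma bounded_linear_jet_curl: "bounded_linear jet_curl"
  by (intro bounded_linear_vecI) (simp add: jet_curl_def bounded_linear_sub bounded_linear_snd_nth)

lemma bounded_linear_jet_op:
  assumes "\<And>i j. bounded_coeff (a i j)" "\<And>i. bounded_coeff (b i)"
  shows "bounded_linear (jet_op a b)"
  unfolding jet_op_def[abs_def]
  by (intro bounded_linear_add bounded_linear_sum bounded_linear_compose[OF bounded_linear_l2_mul]
      bounded_linear_snd_nth bounded_linear_fst_nth assms)

lemma bounded_bilinear_jet_form:
  assumes "\<And>i j. bounded_coeff (a i j)" "\<And>i. bounded_coeff (b i)"
  shows "bounded_bilinear (jet_form a b)"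
proof -
  have 1: "bounded_linear (\<lambda>z. (jet_div z, (1 / 2) *\<^sub>R jet_curl z))"
    by (intro bounded_linear_Pair bounded_linear_jet_div bounded_linear_scaleR_right[THEN bounded_linear_compose]
        bounded_linear_jet_curl)
  have 2: "bounded_linear (\<lambda>z. (jet_op a b z, jet_curl z))"
    by (intro bounded_linear_Pair bounded_linear_jet_op bounded_linear_jet_curl assms)
  have "jet_form a b = (\<lambda>z z'. (jet_div z, (1 / 2) *\<^sub>R jet_curl z) \<bullet> (jet_op a b z', jet_curl z'))"
    by (simp add: jet_form_def fun_eq_iff inner_prod_def)
  then show ?thesis using bounded_bilinear.comp[OF bounded_bilinear_inner 1 2] by simp
qed

lemma H1_graph_linear: "z \<in> H1_graph \<Longrightarrow> z' \<in> H1_graph \<Longrightarrow> z + c *\<^sub>R z' \<in> H1_graph"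
  using l2_deriv_linear[where c = c] by (fastforce simp: H1_graph_def)

lemma zero_H1_graph: "0 \<in> H1_graph"
  using smooth_graph_subset subspace_0[OF subspace_smooth_graph] by blast

lemma subspace_jet_space: "subspace (jet_space :: 'n::finite jet set)"
proof (rule subspaceI)
  have *: "x + c *\<^sub>R y \<in> jet_space" if "x \<in> jet_space" "y \<in> jet_space" for x y :: "'n jet" and c
  proof -
    have x: "fst x $ i \<bullet> one_l2 = 0" "(fst x $ i, snd x $ i) \<in> H1_graph" for i
      using that(1) by (auto simp: jet_space_def)
    have y: "fst y $ i \<bullet> one_l2 = 0" "(fst y $ i, snd y $ i) \<in> H1_graph" for i
      using that(2) by (auto simp: jet_space_def)
    have "(fst (x + c *\<^sub>R y) $ i, snd (x + c *\<^sub>R y) $ i) = (fst x $ i, snd x $ i) + c *\<^sub>R (fst y $ i, snd y $ i)" for i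
      by simp
    then have "(fst (x + c *\<^sub>R y) $ i, snd (x + c *\<^sub>R y) $ i) \<in> H1_graph" for i
      using H1_graph_linear[OF x(2) y(2), of i c i] by metis
    moreover have "fst (x + c *\<^sub>R y) $ i \<bullet> one_l2 = 0" for i
      using x(1)[of i] y(1)[of i] by (simp add: inner_add_left)
    ultimately show ?thesis by (simp add: jet_space_def case_prod_beta)
  qed
  show z: "(0 :: 'n jet) \<in> jet_space"
    using zero_H1_graph by (simp add: jet_space_def zero_prod_def)
  show "x + y \<in> jet_space" if "x \<in> jet_space" "y \<in> jet_space" for x y :: "'n jet"
    using *[OF that, of 1] by simp
  show "c *\<^sub>R x \<in> jet_space" if "x \<in> jet_space" for x :: "'n jet" and c
    using *[OF z that, of c] by simp
qed

lemma closed_jet_space: "closed (jet_space :: 'n::finite jet set)"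
proof -
  have "(jet_space :: 'n jet set) = (\<Inter>i. {z. fst z $ i \<bullet> one_l2 = 0} \<inter> (\<lambda>z. (fst z $ i, snd z $ i)) -` H1_graph)"
    by (auto simp: jet_space_def)
  moreover have "closed (\<Inter>i. {z :: 'n jet. fst z $ i \<bullet> one_l2 = 0} \<inter> (\<lambda>z. (fst z $ i, snd z $ i)) -` H1_graph)"
    by (intro closed_INT ballI closed_Int closed_Collect_eq closed_vimage closed_H1_graph continuous_intros)
  ultimately show ?thesis by (rule ssubst)
qed

section \<open>Coercivity\<close>

lemma norm_jet: "(norm z)\<^sup>2 = (norm (fst z))\<^sup>2 + (norm (snd z))\<^sup>2"
  for z :: "'a::real_inner \<times> 'b::real_inner"
  by (simp add: power2_norm_eq_inner inner_prod_def)

lemma norm_vec_power2: "(norm v)\<^sup>2 = (\<Sum>i\<in>UNIV. (norm (v $ i))\<^sup>2)" for v :: "'a::real_inner ^ 'n"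
  by (simp add: power2_norm_eq_inner inner_vec_def)

text \<open>The mixed product identity exchanges the two derivative indices, so each product of
  transposed entries equals a product of diagonal ones.\<close>

lemma jet_div_norm:
  assumes "(z :: 'n::finite jet) \<in> jet_space"
  shows "(\<Sum>i\<in>UNIV. \<Sum>j\<in>UNIV. snd z $ i $ j \<bullet> snd z $ j $ i) = (norm (jet_div z))\<^sup>2"
proof -
  have g: "(fst z $ i, snd z $ i) \<in> H1_graph" for i using assms by (auto simp: jet_space_def)
  have "snd z $ i $ j \<bullet> snd z $ j $ i = snd z $ i $ i \<bullet> snd z $ j $ j" for i j
    using H1_mixed_product[OF g[of i] g[of j], of j i] .
  then have "(\<Sum>i\<in>UNIV. \<Sum>j\<in>UNIV. snd z $ i $ j \<bullet> snd z $ j $ i) = (\<Sum>i\<in>UNIV. \<Sum>j\<in>UNIV. snd z $ i $ i \<bullet> snd z $ j $ j)"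
    by simp
  also have "\<dots> = (norm (jet_div z))\<^sup>2"
    unfolding power2_norm_eq_inner jet_div_def by (simp add: inner_sum_left inner_sum_right) (rule sum.swap)
  finally show ?thesis .
qed

text \<open>Half the squared curl is the squared norm of the Jacobian minus the sum of the products
  of transposed entries, which the previous identity evaluates. Since the left side is nonnegative,
  the divergence is also bounded by the Jacobian.\<close>

lemma jet_curl_norm:
  assumes "(z :: 'n::finite jet) \<in> jet_space"
  shows "1 / 2 * (jet_curl z \<bullet> jet_curl z) = (norm (snd z))\<^sup>2 - (norm (jet_div z))\<^sup>2"
proof -
  let ?M = "snd z"
  have "jet_curl z \<bullet> jet_curl z = (\<Sum>i\<in>UNIV. \<Sum>j\<in>UNIV. ?M $ i $ j \<bullet> ?M $ i $ j + ?M $ j $ i \<bullet> ?M $ j $ i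
      - 2 * (?M $ i $ j \<bullet> ?M $ j $ i))"
    unfolding jet_curl_def inner_vec_def
    by (simp add: inner_diff_left inner_diff_right inner_commute algebra_simps)
  also have "\<dots> = (\<Sum>i\<in>UNIV. \<Sum>j\<in>UNIV. ?M $ i $ j \<bullet> ?M $ i $ j) + (\<Sum>i\<in>UNIV. \<Sum>j\<in>UNIV. ?M $ j $ i \<bullet> ?M $ j $ i)
      - 2 * (\<Sum>i\<in>UNIV. \<Sum>j\<in>UNIV. ?M $ i $ j \<bullet> ?M $ j $ i)"
    by (simp add: sum.distrib sum_subtractf sum_distrib_left)
  also have "(\<Sum>i\<in>UNIV. \<Sum>j\<in>UNIV. ?M $ j $ i \<bullet> ?M $ j $ i) = (\<Sum>i\<in>UNIV. \<Sum>j\<in>UNIV. ?M $ i $ j \<bullet> ?M $ i $ j)"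
    by (rule sum.swap)
  also have "(\<Sum>i\<in>UNIV. \<Sum>j\<in>UNIV. ?M $ i $ j \<bullet> ?M $ i $ j) = (norm ?M)\<^sup>2"
    by (simp add: norm_vec_power2 power2_norm_eq_inner)
  finally show ?thesis using jet_div_norm[OF assms] by simp
qed

lemma jet_poincare:
  assumes "(z :: 'n::finite jet) \<in> jet_space"
  shows "(norm (fst z))\<^sup>2 \<le> real CARD('n) * (5 / 64) * (norm (snd z))\<^sup>2"
proof -
  have "(norm (fst z $ i))\<^sup>2 \<le> real CARD('n) * (5 / 64) * (norm (snd z $ i))\<^sup>2" for i
    using assms by (intro H1_poincare) (auto simp: jet_space_def)
  then have "(\<Sum>i\<in>UNIV. (norm (fst z $ i))\<^sup>2) \<le> (\<Sum>i\<in>UNIV. real CARD('n) * (5 / 64) * (norm (snd z $ i))\<^sup>2)"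
    by (intro sum_mono)
  then show ?thesis by (simp add: norm_vec_power2[of "fst z"] norm_vec_power2[of "snd z"] sum_distrib_left)
qed

text \<open>At almost every point the difference is the Euclidean pairing of (A - I, b) with the
  values of the Jacobian and of the field. Cauchy-Schwarz is applied pointwise, in dimension n^2 +
  n, and then integrated.\<close>

lemma jet_op_cordes:
  fixes z :: "'n::finite jet"
  assumes a: "\<And>i j. bounded_coeff (a i j)" and b: "\<And>i. bounded_coeff (b i)"
    and cordes: "AE x in lborel. (\<Sum>i\<in>UNIV. \<Sum>j\<in>UNIV. (a i j x - (if i = j then 1 else 0))\<^sup>2) + (\<Sum>i\<in>UNIV. (b i x)\<^sup>2) \<le> \<kappa>"
  shows "(norm (jet_op a b z - jet_div z))\<^sup>2 \<le> \<kappa> * (norm z)\<^sup>2"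
proof -
  have "\<forall>i. \<exists>f. sq_int f \<and> fst z $ i = l2 f" using l2_cases by metis
  then obtain f where f: "\<And>i. sq_int (f i)" "\<And>i. fst z $ i = l2 (f i)" by metis
  have "\<forall>i j. \<exists>f. sq_int f \<and> snd z $ i $ j = l2 f" using l2_cases by metis
  then obtain m where m: "\<And>i j. sq_int (m i j)" "\<And>i j. snd z $ i $ j = l2 (m i j)" by metis
  define R where "R x = (\<Sum>i\<in>UNIV. \<Sum>j\<in>UNIV. (a i j x - (if i = j then 1 else 0)) * m i j x) + (\<Sum>i\<in>UNIV. b i x * f i x)" for x
  define Q where "Q x = (\<Sum>i\<in>UNIV. \<Sum>j\<in>UNIV. (m i j x)\<^sup>2) + (\<Sum>i\<in>UNIV. (f i x)\<^sup>2)" for x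
  note sam = sq_int_bounded_mult(1)[OF a m(1)] and sbf = sq_int_bounded_mult(1)[OF b f(1)]
  have opf: "jet_op a b z = l2 (\<lambda>x. (\<Sum>i\<in>UNIV. \<Sum>j\<in>UNIV. a i j x * m i j x) + (\<Sum>i\<in>UNIV. b i x * f i x))"
    unfolding jet_op_def m(2) f(2) l2_mul_l2[OF a m(1)] l2_mul_l2[OF b f(1)]
    by (simp add: l2_add l2_sum sq_int_sum sam sbf)
  have dvf: "jet_div z = l2 (\<lambda>x. \<Sum>i\<in>UNIV. m i i x)"
    unfolding jet_div_def m(2) by (simp add: l2_sum m(1))
  have eq: "(\<Sum>i\<in>UNIV. \<Sum>j\<in>UNIV. a i j x * m i j x) + (\<Sum>i\<in>UNIV. b i x * f i x) - (\<Sum>i\<in>UNIV. m i i x) = R x" for x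
  proof -
    have "(\<Sum>i\<in>UNIV. \<Sum>j\<in>UNIV. (if i = j then 1 else 0) * m i j x) = (\<Sum>i\<in>UNIV. m i i x)"
    proof (rule sum.cong[OF refl])
      fix i
      have "(\<Sum>j\<in>UNIV. (if i = j then 1 else 0) * m i j x) = (\<Sum>j\<in>UNIV. if j = i then m i j x else 0)"
        by (intro sum.cong) auto
      then show "(\<Sum>j\<in>UNIV. (if i = j then 1 else 0) * m i j x) = m i i x" by simp
    qed
    then show ?thesis by (simp only: R_def left_diff_distrib sum_subtractf)
  qed
  have sR: "sq_int R" and lR: "jet_op a b z - jet_div z = l2 R"
  proof -
    have s1: "sq_int (\<lambda>x. (\<Sum>i\<in>UNIV. \<Sum>j\<in>UNIV. a i j x * m i j x) + (\<Sum>i\<in>UNIV. b i x * f i x))"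
      by (intro sq_int_add sq_int_sum sam sbf)
    have s2: "sq_int (\<lambda>x. \<Sum>i\<in>UNIV. m i i x)" by (intro sq_int_sum m(1))
    show "sq_int R" using sq_int_diff[OF s1 s2] unfolding eq .
    show "jet_op a b z - jet_div z = l2 R"
      unfolding opf dvf l2_diff[OF s1 s2, symmetric] eq ..
  qed
  have iQ: "set_integrable lborel (cell 0) Q" "cint Q = (norm z)\<^sup>2"
  proof -
    note mi = cint_sum[OF sq_intD(3)[OF m(1)]]
    have im: "set_integrable lborel (cell 0) (\<lambda>x. \<Sum>i\<in>UNIV. \<Sum>j\<in>UNIV. (m i j x)\<^sup>2)"
      by (rule cint_sum(1)[OF mi(1)])
    have cm: "cint (\<lambda>x. \<Sum>i\<in>UNIV. \<Sum>j\<in>UNIV. (m i j x)\<^sup>2) = (norm (snd z))\<^sup>2"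
      unfolding cint_sum(2)[OF mi(1)] mi(2) by (simp add: norm_vec_power2 m(2) norm_l2_power2[OF m(1)])
    have jf: "set_integrable lborel (cell 0) (\<lambda>x. \<Sum>i\<in>UNIV. (f i x)\<^sup>2)"
      by (rule cint_sum(1)[OF sq_intD(3)[OF f(1)]])
    have cf: "cint (\<lambda>x. \<Sum>i\<in>UNIV. (f i x)\<^sup>2) = (norm (fst z))\<^sup>2"
      unfolding cint_sum(2)[OF sq_intD(3)[OF f(1)]] by (simp add: norm_vec_power2 f(2) norm_l2_power2[OF f(1)])
    show "set_integrable lborel (cell 0) Q" unfolding Q_def[abs_def] using im jf by (rule set_integral_add(1))
    show "cint Q = (norm z)\<^sup>2"
      unfolding Q_def[abs_def] set_integral_add(2)[OF im jf] cm cf norm_jet by simp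
  qed
  have cs: "(R x)\<^sup>2 \<le> ((\<Sum>i\<in>UNIV. \<Sum>j\<in>UNIV. (a i j x - (if i = j then 1 else 0))\<^sup>2) + (\<Sum>i\<in>UNIV. (b i x)\<^sup>2)) * Q x" for x
  proof -
    let ?p = "((\<chi> i j. a i j x - (if i = j then 1 else 0)) :: real ^ 'n ^ 'n, (\<chi> i. b i x) :: real ^ 'n)"
    let ?q = "((\<chi> i j. m i j x) :: real ^ 'n ^ 'n, (\<chi> i. f i x) :: real ^ 'n)"
    have "(?p \<bullet> ?q)\<^sup>2 \<le> (?p \<bullet> ?p) * (?q \<bullet> ?q)" by (rule Cauchy_Schwarz_ineq)
    then show ?thesis by (simp only: inner_prod_def inner_vec_def fst_conv snd_conv vec_lambda_beta inner_real_def
          R_def Q_def power2_eq_square)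
  qed
  have Q0: "0 \<le> Q x" for x unfolding Q_def by (intro add_nonneg_nonneg sum_nonneg) auto
  have "cint (\<lambda>x. (R x)\<^sup>2) \<le> cint (\<lambda>x. \<kappa> * Q x)"
    unfolding set_lebesgue_integral_def
  proof (rule integral_mono_AE)
    show "integrable lborel (\<lambda>x. indicator (cell 0) x *\<^sub>R (R x)\<^sup>2)" using sq_intD(3)[OF sR] by (simp add: set_integrable_def)
    show "integrable lborel (\<lambda>x. indicator (cell 0) x *\<^sub>R (\<kappa> * Q x))"
      using set_integrable_mult_right[of \<kappa>] iQ(1) by (simp add: set_integrable_def)
    show "AE x in lborel. indicator (cell 0) x *\<^sub>R (R x)\<^sup>2 \<le> indicator (cell 0) x *\<^sub>R (\<kappa> * Q x)"
      using cordes
    proof eventually_elim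
      fix x assume "(\<Sum>i\<in>UNIV. \<Sum>j\<in>UNIV. (a i j x - (if i = j then 1 else 0))\<^sup>2) + (\<Sum>i\<in>UNIV. (b i x)\<^sup>2) \<le> \<kappa>"
      from mult_right_mono[OF this Q0[of x]] cs[of x] have "(R x)\<^sup>2 \<le> \<kappa> * Q x" by linarith
      then show "indicator (cell 0) x *\<^sub>R (R x)\<^sup>2 \<le> indicator (cell 0) x *\<^sub>R (\<kappa> * Q x)"
        by (simp add: indicator_def)
    qed
  qed
  then show ?thesis by (simp add: lR norm_l2_power2[OF sR] iQ(2))
qed

text \<open>With the curl term rewritten, the form is the squared norm of the Jacobian plus the
  pairing of the divergence with the error \<open>jet_op a b z - jet_div z\<close>. The divergence
  is at most \<open>M\<close> and the error at most \<open>s * M\<close>, where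
  \<open>s < 1\<close>.\<close>

lemma jet_form_coercive:
  fixes a :: "'n::finite \<Rightarrow> 'n \<Rightarrow> real ^ 'n \<Rightarrow> real"
  assumes cordes: "\<And>z. (norm (jet_op a b z - jet_div z))\<^sup>2 \<le> \<kappa> * (norm z)\<^sup>2"
    and \<kappa>: "0 \<le> \<kappa>" "\<kappa> * (1 + real CARD('n) * (5 / 64)) < 1"
  shows "\<exists>\<alpha>>0. \<forall>z\<in>jet_space. \<alpha> * (z \<bullet> z) \<le> jet_form a b z z"
proof -
  define C where "C = 1 + real CARD('n) * (5 / 64)"
  have C: "0 < C" by (simp add: C_def add_pos_nonneg)
  \<comment> \<open>\<open>C\<close> compares the full norm of a jet with that of its Jacobian, so
    \<open>s\<close> measures the error relative to the Jacobian alone.\<close>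
  define s where "s = sqrt (\<kappa> * C)"
  have s: "0 \<le> s" "s < 1" using \<kappa> C by (auto simp: s_def C_def)
  have "(1 - s) / C * (z \<bullet> z) \<le> jet_form a b z z" if z: "z \<in> jet_space" for z
  proof -
    define M where "M = norm (snd z)"
    define D where "D = norm (jet_div z)"
    have zz: "z \<bullet> z \<le> C * M\<^sup>2"
      using jet_poincare[OF z] norm_jet[of z] by (simp add: C_def M_def dot_square_norm distrib_right)
    have "0 \<le> 1 / 2 * (jet_curl z \<bullet> jet_curl z)" by simp
    then have "D\<^sup>2 \<le> M\<^sup>2" unfolding jet_curl_norm[OF z] by (simp add: D_def M_def)
    then have DM: "D \<le> M" by (rule power2_le_imp_le) (simp add: M_def)
    have "(norm (jet_op a b z - jet_div z))\<^sup>2 \<le> \<kappa> * (C * M\<^sup>2)"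
      using cordes[of z] mult_left_mono[OF zz \<kappa>(1)] by (simp add: dot_square_norm)
    also have "\<dots> = (s * M)\<^sup>2" using \<kappa>(1) C by (simp add: s_def power_mult_distrib)
    finally have op: "norm (jet_op a b z - jet_div z) \<le> s * M"
      by (rule power2_le_imp_le) (use s in \<open>simp add: M_def\<close>)
    have "\<bar>jet_div z \<bullet> (jet_op a b z - jet_div z)\<bar> \<le> D * norm (jet_op a b z - jet_div z)"
      unfolding D_def by (rule Cauchy_Schwarz_ineq2)
    also have "\<dots> \<le> M * (s * M)" using DM op by (intro mult_mono) (auto simp: M_def D_def)
    finally have "- (s * M\<^sup>2) \<le> jet_div z \<bullet> (jet_op a b z - jet_div z)" by (simp add: power2_eq_square mult_ac abs_le_iff)
    moreover have "jet_form a b z z = jet_div z \<bullet> (jet_op a b z - jet_div z) + M\<^sup>2"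
      unfolding jet_form_def jet_curl_norm[OF z] by (simp add: inner_diff_right M_def dot_square_norm)
    ultimately have "(1 - s) * M\<^sup>2 \<le> jet_form a b z z" by (simp add: left_diff_distrib)
    moreover have "(1 - s) / C * (z \<bullet> z) \<le> (1 - s) / C * (C * M\<^sup>2)"
      using zz s C by (intro mult_left_mono) auto
    ultimately show ?thesis using C by simp
  qed
  moreover have "0 < (1 - s) / C" using s C by simp
  ultimately show ?thesis by blast
qed

section \<open>Gradients as test fields\<close>

definition grad_jet :: "(real ^ 'n::finite \<Rightarrow> real) \<Rightarrow> 'n jet" where
  "grad_jet q = (\<chi> i. l2 (pd i q), \<chi> i j. l2 (pd j (pd i q)))"

lemma grad_jet_space:
  assumes q: "smooth_periodic q" shows "grad_jet q \<in> jet_space"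
proof -
  have "(l2 (pd i q), \<chi> j. l2 (pd j (pd i q))) \<in> H1_graph" for i
    using smooth_graph_subset smooth_periodic_pd[OF q, of i] unfolding smooth_graph_def by blast
  moreover have "l2 (pd i q) \<bullet> one_l2 = 0" for i
    by (simp add: inner_one_l2 sq_int_smooth_periodic smooth_periodic_pd q cint_pd_eq_0)
  ultimately show ?thesis by (simp add: jet_space_def grad_jet_def)
qed

lemma jet_div_grad_jet:
  assumes q: "smooth_periodic q" shows "jet_div (grad_jet q) = l2 (laplacian q)"
proof -
  have "l2 (laplacian q) = (\<Sum>i\<in>UNIV. l2 (pd i (pd i q)))"
    unfolding laplacian_def[abs_def] by (rule l2_sum) (auto intro!: sq_int_smooth_periodic smooth_periodic_pd q)
  then show ?thesis by (simp add: jet_div_def grad_jet_def)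
qed

lemma jet_curl_grad_jet:
  assumes q: "smooth_periodic q" shows "jet_curl (grad_jet q) = 0"
proof -
  have "pd j (pd i q) = pd i (pd j q)" for i j
    using pd_commute[OF smooth_periodicD(1)[OF q]] by blast
  then have "l2 (pd j (pd i q)) - l2 (pd i (pd j q)) = 0" for i j by (metis eq_iff_diff_eq_0)
  then show ?thesis by (simp add: jet_curl_def grad_jet_def vec_eq_iff)
qed

text \<open>Test with smooth \<open>q\<close> whose Laplacian approximates \<open>u\<close>: coercivity at the gradient of \<open>q\<close> forces \<open>u\<close> to be small.\<close>

lemma adjoint_kernel_trivial:
  fixes u :: "'n::finite l2"
  assumes a: "\<And>i j. bounded_coeff (a i j)" and b: "\<And>i. bounded_coeff (b i)"
    and coer: "0 < \<alpha>" "\<And>z. z \<in> jet_space \<Longrightarrow> \<alpha> * (z \<bullet> z) \<le> jet_form a b z z"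
    and mean: "u \<bullet> one_l2 = 0"
    and ker: "\<And>q. smooth_periodic q \<Longrightarrow> u \<bullet> jet_op a b (grad_jet q) = 0"
  shows "u = 0"
proof -
  obtain K where K: "0 < K" "\<And>z. norm (jet_op a b z) \<le> norm z * K"
    using bounded_linear.pos_bounded[OF bounded_linear_jet_op[of a b, OF a b]] by blast
  obtain K' where K': "0 < K'" "\<And>z :: 'n jet. norm (jet_div z) \<le> norm z * K'"
    using bounded_linear.pos_bounded[OF bounded_linear_jet_div] by blast
  \<comment> \<open>Chosen so that the two errors at the end, from approximating \<open>u\<close>
    and from bounding the Laplacian, add up to exactly \<open>e\<close>.\<close>
  define c where "c = 1 + K * K' / \<alpha>"
  have c: "0 < c" using K K' coer by (simp add: c_def add_pos_pos)
  have "norm u \<le> 0 + e" if e: "0 < e" for e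
  proof -
    obtain q where q: "smooth_periodic q" "norm (l2 (laplacian q) - u) < e / c"
      using laplacian_dense[OF mean, of "e / c"] e c by auto
    define z where "z = grad_jet q"
    have "\<alpha> * (norm z * norm z) \<le> jet_form a b z z"
      using coer(2)[OF grad_jet_space[OF q(1)]] by (simp add: z_def dot_square_norm power2_eq_square)
    \<comment> \<open>A gradient has no curl, and \<open>u\<close> annihilates the second factor, so
      it can be subtracted from the Laplacian.\<close>
    also have "\<dots> = (l2 (laplacian q) - u) \<bullet> jet_op a b z"
      using ker[OF q(1)] by (simp add: jet_form_def z_def jet_curl_grad_jet q(1) jet_div_grad_jet inner_diff_left)
    also have "\<dots> \<le> norm (l2 (laplacian q) - u) * norm (jet_op a b z)" by (rule norm_cauchy_schwarz)
    also have "\<dots> \<le> (e / c) * (norm z * K)"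
      using q(2) K e c by (intro mult_mono) (auto simp: less_imp_le)
    finally have *: "\<alpha> * (norm z * norm z) \<le> (e / c) * (norm z * K)" .
    have "\<alpha> * norm z \<le> (e / c) * K"
    proof (cases "norm z = 0")
      case True
      then show ?thesis using e c K by simp
    next
      case False
      then have pos: "0 < norm z" by simp
      have "norm z * (\<alpha> * norm z) \<le> norm z * ((e / c) * K)" using * by (simp add: mult_ac)
      then show ?thesis using pos by (rule mult_left_le_imp_le)
    qed
    then have "norm z \<le> (e / c) * K / \<alpha>" by (intro mult_imp_le_div_pos coer(1)) (simp add: mult.commute)
    then have "norm (l2 (laplacian q)) \<le> (e / c) * K / \<alpha> * K'"
      using K'(2)[of z] mult_right_mono[of "norm z" "(e / c) * K / \<alpha>" K'] K'(1)
      by (simp add: z_def jet_div_grad_jet[OF q(1)])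
    then have "norm u \<le> (e / c) * K / \<alpha> * K' + e / c"
      using q(2) norm_triangle_ineq4[of "l2 (laplacian q)" "l2 (laplacian q) - u"] by simp
    also have "\<dots> = (e / c) * (1 + K * K' / \<alpha>)" by (simp add: distrib_left mult_ac)
    also have "\<dots> = e" unfolding c_def[symmetric] using c by simp
    finally show ?thesis by simp
  qed
  then have "norm u \<le> 0" by (rule field_le_epsilon)
  then show ?thesis by simp
qed

lemma jet_form_solution:
  assumes a: "\<And>i j. bounded_coeff (a i j)" and b: "\<And>i. bounded_coeff (b i)"
    and coer: "0 < \<alpha>" "\<And>z. z \<in> jet_space \<Longrightarrow> \<alpha> * (z \<bullet> z) \<le> jet_form a b z z"
  shows "\<exists>!z. z \<in> jet_space \<and> (\<forall>z'\<in>jet_space. jet_form a b z z' = - (F \<bullet> fst z'))"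
proof (rule lax_milgram[OF subspace_jet_space closed_jet_space bounded_bilinear_jet_form[OF a b] _ coer])
  show "bounded_linear (\<lambda>z. - (F \<bullet> fst z))"
    by (intro bounded_linear_minus bounded_linear_compose[OF bounded_linear_inner_right] bounded_linear_fst)
qed

text \<open>Machin's formula with \<open>arctan (1 / 5) \<le> 1 / 5\<close> gives pi \<le> 16/5. The
  number 64/5 is the reciprocal of the 5/64 in the Poincare constant.\<close>

lemma pi_square_less: "pi\<^sup>2 < 64 / 5"
proof -
  have "pi / 4 \<le> 4 * (1 / 5)"
  proof -
    have "arctan (1 / 5) \<le> 1 / 5" by (rule arctan_le_self) simp
    moreover have "0 \<le> arctan (1 / 239)" by simp
    ultimately show ?thesis using machin by linarith
  qed
  then have "pi \<le> 16 / 5" by simp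
  then have "pi\<^sup>2 \<le> (16 / 5)\<^sup>2" by (rule power_mono) simp
  then show ?thesis by (simp add: power2_eq_square)
qed

subsection \<open>Representatives\<close>

text \<open>The bridge from the functions of the statement, which are Lebesgue measurable and
  determined up to null sets, to points of the Hilbert space, which have Borel
  representatives.\<close>

definition represents :: "(real ^ 'n::finite \<Rightarrow> real) \<Rightarrow> 'n l2 \<Rightarrow> bool" where
  "represents f u \<longleftrightarrow> (\<exists>g. sq_int g \<and> (AE x in lborel. f x = g x) \<and> u = l2 g)"

lemma representsE:
  assumes "represents f u" obtains g where "sq_int g" "AE x in lborel. f x = g x" "u = l2 g"
  using assms unfolding represents_def by blast

lemma representsI: "sq_int g \<Longrightarrow> AE x in lborel. f x = g x \<Longrightarrow> represents f (l2 g)"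
  unfolding represents_def by blast

lemma represents_l2: "sq_int f \<Longrightarrow> represents f (l2 f)"
  by (rule representsI) auto

lemma represents_exists: "\<exists>f. sq_int f \<and> represents f u"
proof -
  obtain f where "sq_int f" "u = l2 f" by (rule l2_cases)
  then show ?thesis using represents_l2 by blast
qed

lemma represents_AE_eq:
  assumes "represents f u" "represents f' u" shows "AE x in lborel. f x = f' x"
proof -
  obtain g where g: "sq_int g" "AE x in lborel. f x = g x" "u = l2 g" using assms(1) by (rule representsE)
  obtain g' where g': "sq_int g'" "AE x in lborel. f' x = g' x" "u = l2 g'" using assms(2) by (rule representsE)
  have "AE x in lborel. g x = g' x" using l2_eq_iff[OF g(1) g'(1)] g(3) g'(3) by simp
  with g(2) g'(2) show ?thesis by eventually_elim simp
qed

lemma represents_cong: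
  assumes "represents f u" and f': "AE x in lborel. f x = f' x" shows "represents f' u"
proof -
  obtain g where g: "sq_int g" "AE x in lborel. f x = g x" "u = l2 g" using assms(1) by (rule representsE)
  have "AE x in lborel. f' x = g x" using g(2) f' by eventually_elim simp
  then show ?thesis using g by (auto simp: represents_def)
qed

lemma represents_unique:
  assumes "represents f u" "represents f v" shows "u = v"
proof -
  obtain g where g: "sq_int g" "AE x in lborel. f x = g x" "u = l2 g" using assms(1) by (rule representsE)
  obtain g' where g': "sq_int g'" "AE x in lborel. f x = g' x" "v = l2 g'" using assms(2) by (rule representsE)
  have "AE x in lborel. g x = g' x" using g(2) g'(2) by eventually_elim simp
  then show ?thesis using l2_eq_iff[OF g(1) g'(1)] g(3) g'(3) by simp
qed

lemma represents_linear:
  assumes "represents f u" "represents f' v" shows "represents (\<lambda>x. f x + c * f' x) (u + c *\<^sub>R v)"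
proof -
  obtain g where g: "sq_int g" "AE x in lborel. f x = g x" "u = l2 g" using assms(1) by (rule representsE)
  obtain g' where g': "sq_int g'" "AE x in lborel. f' x = g' x" "v = l2 g'" using assms(2) by (rule representsE)
  have "AE x in lborel. f x + c * f' x = g x + c * g' x" using g(2) g'(2) by eventually_elim simp
  then have "represents (\<lambda>x. f x + c * f' x) (l2 (\<lambda>x. g x + c * g' x))"
    by (rule representsI[OF sq_int_linear_combination[OF g(1) g'(1)]])
  then show ?thesis by (simp add: g(3) g'(3) l2_add l2_scaleR sq_int_cmult g(1) g'(1))
qed

lemma represents_add: "represents f u \<Longrightarrow> represents f' v \<Longrightarrow> represents (\<lambda>x. f x + f' x) (u + v)"
  using represents_linear[of f u f' v 1] by simp

lemma represents_diff: "represents f u \<Longrightarrow> represents f' v \<Longrightarrow> represents (\<lambda>x. f x - f' x) (u - v)"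
  using represents_linear[of f u f' v "-1"] by simp

lemma represents_zero: "represents (\<lambda>x. 0) 0"
  using represents_l2[OF sq_int_const[of 0]] by (simp add: l2_zero)

lemma represents_uminus: "represents f u \<Longrightarrow> represents (\<lambda>x. - f x) (- u)"
  using represents_diff[OF represents_zero] by fastforce

lemma represents_sum: "(\<And>i. i \<in> I \<Longrightarrow> represents (f i) (u i)) \<Longrightarrow> represents (\<lambda>x. \<Sum>i\<in>I. f i x) (\<Sum>i\<in>I. u i)"
  by (induction I rule: infinite_finite_induct) (auto intro: represents_zero represents_add)

lemma represents_mult:
  assumes f: "represents f u" and a: "bounded_coeff a" "AE x in lborel. a' x = a x"
  shows "represents (\<lambda>x. a' x * f x) (l2_mul a u)"
proof -
  obtain g where g: "sq_int g" "AE x in lborel. f x = g x" "u = l2 g" using f by (rule representsE)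
  have "AE x in lborel. a' x * f x = a x * g x" using g(2) a(2) by eventually_elim simp
  then show ?thesis unfolding g(3) l2_mul_l2[OF a(1) g(1)] by (rule representsI[OF sq_int_bounded_mult(1)[OF a(1) g(1)]])
qed

section \<open>From Lebesgue to Borel measurable functions\<close>

lemma lebesgue_measurable_AE:
  fixes f h :: "real ^ 'n \<Rightarrow> real"
  assumes "AE x in lborel. f x = h x" "h \<in> borel_measurable borel"
  shows "f \<in> borel_measurable lebesgue"
proof (rule borel_measurable_AE)
  show "h \<in> borel_measurable lebesgue" using assms(2) by (intro measurable_completion) simp
  show "AE x in lebesgue. h x = f x" using assms(1) by (simp add: AE_completion_iff eq_commute)
qed

lemma lebesgue_integral_AE:
  fixes f h :: "real ^ 'n \<Rightarrow> real"
  assumes fh: "AE x in lborel. f x = h x" and h: "h \<in> borel_measurable borel"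
  shows "(LINT x|lebesgue. f x) = (LINT x|lborel. h x)" "integrable lebesgue f \<longleftrightarrow> integrable lborel h"
proof -
  have hl: "h \<in> borel_measurable lebesgue" using h by (intro measurable_completion) simp
  have ae: "AE x in lebesgue. f x = h x" using fh by (simp add: AE_completion_iff)
  have "(LINT x|lebesgue. f x) = (LINT x|lebesgue. h x)"
    by (rule integral_cong_AE[OF lebesgue_measurable_AE[OF fh h] hl ae])
  also have "\<dots> = (LINT x|lborel. h x)" by (rule integral_completion) (simp add: h)
  finally show "(LINT x|lebesgue. f x) = (LINT x|lborel. h x)" .
  have "integrable lebesgue f \<longleftrightarrow> integrable lebesgue h"
    by (rule integrable_cong_AE[OF lebesgue_measurable_AE[OF fh h] hl ae])
  also have "\<dots> \<longleftrightarrow> integrable lborel h" by (rule integrable_completion) (simp add: h)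
  finally show "integrable lebesgue f \<longleftrightarrow> integrable lborel h" .
qed

lemma cell_integral_AE:
  fixes f h :: "real ^ 'n \<Rightarrow> real"
  assumes fh: "AE x in lborel. f x = h x" and h: "h \<in> borel_measurable borel"
  shows "cell_integral f = cint h"
  unfolding cell_integral_def set_lebesgue_integral_def unit_cell_eq_cell
proof (rule lebesgue_integral_AE(1))
  show "AE x in lborel. indicator (cell 0) x *\<^sub>R f x = indicator (cell 0) x *\<^sub>R h x"
    using fh by eventually_elim simp
  show "(\<lambda>x. indicator (cell 0) x *\<^sub>R h x) \<in> borel_measurable borel" using h by measurable
qed

text \<open>The index type is left open: a single index gives scalar products, coordinates give
  products of vectors, and pairs of indices give products of matrices.\<close>

lemma cell_integral_sum_represents:
  assumes "\<And>i. represents (f i) (u i)" "\<And>i. represents (g i) (v i)"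
  shows "cell_integral (\<lambda>x. \<Sum>i\<in>I. f i x * g i x) = (\<Sum>i\<in>I. u i \<bullet> v i)"
proof (cases "finite I")
  case True
  have "\<forall>i. \<exists>h. sq_int h \<and> (AE x in lborel. f i x = h x) \<and> u i = l2 h" using assms(1) by (simp add: represents_def)
  then obtain f' where f': "\<And>i. sq_int (f' i)" "\<And>i. AE x in lborel. f i x = f' i x" "\<And>i. u i = l2 (f' i)" by metis
  have "\<forall>i. \<exists>h. sq_int h \<and> (AE x in lborel. g i x = h x) \<and> v i = l2 h" using assms(2) by (simp add: represents_def)
  then obtain g' where g': "\<And>i. sq_int (g' i)" "\<And>i. AE x in lborel. g i x = g' i x" "\<And>i. v i = l2 (g' i)" by metis
  have "AE x in lborel. \<forall>i\<in>I. f i x * g i x = f' i x * g' i x"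
  proof (rule AE_finite_allI[OF True])
    fix i assume "i \<in> I"
    show "AE x in lborel. f i x * g i x = f' i x * g' i x" using f'(2)[of i] g'(2)[of i] by eventually_elim simp
  qed
  then have "AE x in lborel. (\<Sum>i\<in>I. f i x * g i x) = (\<Sum>i\<in>I. f' i x * g' i x)"
    by eventually_elim (auto intro: sum.cong)
  moreover have "(\<lambda>x. \<Sum>i\<in>I. f' i x * g' i x) \<in> borel_measurable borel"
    using sq_intD(1)[OF f'(1)] sq_intD(1)[OF g'(1)] by measurable
  ultimately have "cell_integral (\<lambda>x. \<Sum>i\<in>I. f i x * g i x) = cint (\<lambda>x. \<Sum>i\<in>I. f' i x * g' i x)"
    by (rule cell_integral_AE)
  also have "\<dots> = (\<Sum>i\<in>I. cint (\<lambda>x. f' i x * g' i x))"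
    by (rule cint_sum(2)) (rule sq_int_mult_integrable[OF f'(1) g'(1)])
  also have "\<dots> = (\<Sum>i\<in>I. u i \<bullet> v i)" by (simp add: f'(3) g'(3) inner_l2 f'(1) g'(1))
  finally show ?thesis .
qed (simp add: cell_integral_def set_lebesgue_integral_def)

lemma cell_integral_mult_represents:
  "represents f u \<Longrightarrow> represents g v \<Longrightarrow> cell_integral (\<lambda>x. f x * g x) = u \<bullet> v"
  using cell_integral_sum_represents[of "\<lambda>_::unit. f" "\<lambda>_. u" "\<lambda>_. g" "\<lambda>_. v" UNIV] by simp

lemma cell_integral_represents: "represents f u \<Longrightarrow> cell_integral f = u \<bullet> one_l2"
  using cell_integral_mult_represents[OF _ represents_l2[OF sq_int_const[of 1]]] by (force simp: one_l2_def)

text \<open>Integrability over arbitrary compact sets follows from that over one cell by covering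
  with cells.\<close>

lemma represents_imp_L2_per:
  assumes "represents f u" shows "f \<in> L2_per"
proof -
  obtain g where g: "sq_int g" "AE x in lborel. f x = g x" "u = l2 g" using assms by (rule representsE)
  note [measurable] = sq_intD(1)[OF g(1)]
  have "periodic f"
    using periodic_AE_cong[OF sq_intD(2)[OF g(1)], of f] g(2) by (simp add: eq_commute)
  moreover have "f \<in> borel_measurable lebesgue" by (rule lebesgue_measurable_AE[OF g(2)]) measurable
  moreover have "set_integrable lebesgue K (\<lambda>x. (norm (f x))\<^sup>2)" if K: "compact K" for K
  proof -
    have K' [measurable]: "K \<in> sets borel" using K by (intro borel_closed compact_imp_closed)
    have hm: "(\<lambda>x. ennreal ((g x)\<^sup>2)) \<in> borel_measurable borel" by measurable
    have pe: "periodic (\<lambda>x. ennreal ((g x)\<^sup>2))" by (rule periodic_compose[OF sq_intD(2)[OF g(1)]])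
    obtain N :: nat where N: "(\<integral>\<^sup>+x\<in>K. ennreal ((g x)\<^sup>2) \<partial>lborel) \<le> of_nat N * (\<integral>\<^sup>+x\<in>cell 0. ennreal ((g x)\<^sup>2) \<partial>lborel)"
      using nn_integral_compact_le_cell[OF K] hm pe by blast
    have eq: "(\<integral>\<^sup>+x\<in>S. ennreal ((g x)\<^sup>2) \<partial>lborel) = (\<integral>\<^sup>+x. ennreal (norm (indicator S x *\<^sub>R (g x)\<^sup>2)) \<partial>lborel)" for S
      by (intro nn_integral_cong) (simp add: indicator_def)
    have "(\<integral>\<^sup>+x\<in>cell 0. ennreal ((g x)\<^sup>2) \<partial>lborel) < \<infinity>"
      using sq_intD(3)[OF g(1)] unfolding eq set_integrable_def integrable_iff_bounded by simp
    then have "of_nat N * (\<integral>\<^sup>+x\<in>cell 0. ennreal ((g x)\<^sup>2) \<partial>lborel) < \<infinity>"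
      by (simp add: ennreal_mult_less_top of_nat_less_top)
    then have "(\<integral>\<^sup>+x\<in>K. ennreal ((g x)\<^sup>2) \<partial>lborel) < \<infinity>" using N by (rule le_less_trans[rotated])
    then have "integrable lborel (\<lambda>x. indicator K x *\<^sub>R (g x)\<^sup>2)"
      unfolding integrable_iff_bounded eq by simp
    then show ?thesis
      unfolding set_integrable_def
      by (subst lebesgue_integral_AE(2)[of _ "\<lambda>x. indicator K x *\<^sub>R (g x)\<^sup>2"])
         (use g(2) in \<open>auto elim: eventually_mono\<close>)
  qed
  ultimately show ?thesis by (simp add: L2_per_def L2_loc_def Y_periodic_iff)
qed

lemma L2_per_imp_represents:
  fixes f :: "real ^ 'n \<Rightarrow> real"
  assumes "f \<in> L2_per" shows "\<exists>u. represents f u"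
proof -
  have f: "f \<in> borel_measurable lebesgue" "periodic f"
    "\<And>K. compact K \<Longrightarrow> set_integrable lebesgue K (\<lambda>x. (norm (f x))\<^sup>2)"
    using assms by (auto simp: L2_per_def L2_loc_def Y_periodic_iff)
  obtain g where g: "g \<in> borel_measurable lborel" "AE x in lborel. f x = g x"
    using completion_ex_borel_measurable_real[OF f(1)] by blast
  have gb [measurable]: "g \<in> borel_measurable borel" using g(1) by simp
  have "set_integrable lebesgue (cbox 0 (0 + 1)) (\<lambda>x. (norm (f x))\<^sup>2)" by (rule f(3)) (rule compact_cbox)
  then have "integrable lborel (\<lambda>x. indicator (cbox 0 (0 + 1)) x *\<^sub>R (g x)\<^sup>2)"
    unfolding set_integrable_def
    by (subst (asm) lebesgue_integral_AE(2)[of _ "\<lambda>x. indicator (cbox 0 (0 + 1)) x *\<^sub>R (g x)\<^sup>2"])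
       (use g(2) in \<open>auto elim: eventually_mono\<close>)
  then have "set_integrable lborel (cell 0) (\<lambda>x. (g x)\<^sup>2)"
    unfolding set_integrable_def[symmetric]
    by (rule set_integrable_subset) (auto simp: cell_def box_subset_cbox)
  then have "sq_int g" using gb periodic_AE_cong[OF f(2) g(2)] by (simp add: sq_int_def)
  then show ?thesis using g(2) by (auto intro: representsI)
qed

lemma represents_locally_integrable:
  assumes "represents f u" shows "locally_integrable f"
  unfolding locally_integrable_def
proof (intro allI impI)
  fix K :: "(real ^ 'a) set" assume K: "compact K"
  obtain g where g: "sq_int g" "AE x in lborel. f x = g x" "u = l2 g" using assms by (rule representsE)
  have K' [measurable]: "K \<in> sets borel" using K by (intro borel_closed compact_imp_closed)
  note [measurable] = sq_intD(1)[OF g(1)]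
  have "integrable lborel (\<lambda>x. indicator K x *\<^sub>R g x)"
    using sq_int_integrable_compact[OF g(1) K] by (simp add: set_integrable_def)
  then show "set_integrable lebesgue K f"
    unfolding set_integrable_def
    by (subst lebesgue_integral_AE(2)[of _ "\<lambda>x. indicator K x *\<^sub>R g x"])
       (use g(2) in \<open>auto elim: eventually_mono\<close>)
qed

text \<open>Local integrability directly yields measurability of the cut-offs to balls only;
  \<open>f\<close> is their pointwise limit and therefore has a Borel version.\<close>

lemma locally_integrable_borel:
  fixes f :: "real ^ 'n \<Rightarrow> real"
  assumes "locally_integrable f"
  shows "\<exists>g. g \<in> borel_measurable borel \<and> (AE x in lborel. f x = g x) \<and>
    (\<forall>K. compact K \<longrightarrow> set_integrable lborel K g)"
proof -
  have m: "(\<lambda>x. indicator (cball 0 (real k)) x *\<^sub>R f x) \<in> borel_measurable lebesgue" for k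
    using assms unfolding locally_integrable_def set_integrable_def by (meson borel_measurable_integrable compact_cball)
  have "f \<in> borel_measurable lebesgue"
  proof (rule borel_measurable_LIMSEQ_real[OF _ m])
    fix x :: "real ^ 'n"
    obtain k where k: "norm x < real k" using reals_Archimedean2 by blast
    have "\<forall>\<^sub>F j in sequentially. indicator (cball 0 (real j)) x *\<^sub>R f x = f x"
      by (rule eventually_sequentiallyI[of k]) (use k in auto)
    then show "(\<lambda>j. indicator (cball 0 (real j)) x *\<^sub>R f x) \<longlonglongrightarrow> f x" by (rule tendsto_eventually)
  qed
  then obtain g where g: "g \<in> borel_measurable lborel" "AE x in lborel. f x = g x"
    using completion_ex_borel_measurable_real by blast
  have gb [measurable]: "g \<in> borel_measurable borel" using g(1) by simp
  have "set_integrable lborel K g" if K: "compact K" for K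
  proof -
    have K' [measurable]: "K \<in> sets borel" using K by (intro borel_closed compact_imp_closed)
    have "set_integrable lebesgue K f" using assms K by (simp add: locally_integrable_def)
    then show ?thesis
      unfolding set_integrable_def
      by (subst (asm) lebesgue_integral_AE(2)[of _ "\<lambda>x. indicator K x *\<^sub>R g x"])
         (use g(2) in \<open>auto elim: eventually_mono\<close>)
  qed
  then show ?thesis using gb g(2) by blast
qed

lemma integrable_mult_test_function:
  fixes g :: "real ^ 'n \<Rightarrow> real"
  assumes "g \<in> borel_measurable borel" "\<And>K. compact K \<Longrightarrow> set_integrable lborel K g" and \<phi>: "test_function \<phi>"
  shows "integrable lborel (\<lambda>x. g x * \<phi> x)"
proof -
  obtain M where M: "0 < M" "\<And>x. norm x > M \<Longrightarrow> \<phi> x = 0" using test_function_support[OF \<phi>] by blast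
  obtain B where B: "0 < B" "\<And>x. \<bar>\<phi> x\<bar> \<le> B" using test_function_bounded[OF \<phi>] by blast
  show ?thesis
    by (rule integrable_mult_compact_support(1)[of g "cball 0 M" \<phi> B])
       (use assms B M borel_measurable_test_function[OF \<phi>] in auto)
qed

lemma lebesgue_integral_test_AE:
  fixes f g :: "real ^ 'n \<Rightarrow> real"
  assumes "AE x in lborel. f x = g x" "g \<in> borel_measurable borel" and \<phi>: "test_function \<phi>"
  shows "(LINT x|lebesgue. f x * \<phi> x) = (LINT x|lborel. g x * \<phi> x)"
proof (rule lebesgue_integral_AE(1))
  show "AE x in lborel. f x * \<phi> x = g x * \<phi> x" using assms(1) by eventually_elim simp
  show "(\<lambda>x. g x * \<phi> x) \<in> borel_measurable borel"
    using assms(2) borel_measurable_test_function[OF \<phi>] by measurable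
qed

section \<open>Weak partial derivatives and their Hilbert space counterpart\<close>

lemma has_weak_partial_unique:
  assumes "has_weak_partial i f g" "has_weak_partial i f h"
  shows "AE x in lborel. g x = h x"
proof -
  have lg: "locally_integrable g" and lh: "locally_integrable h"
    and eq: "\<And>\<phi>. test_function \<phi> \<Longrightarrow> (LINT x|lebesgue. g x * \<phi> x) = (LINT x|lebesgue. h x * \<phi> x)"
    using assms by (force simp: has_weak_partial_def)+
  obtain g' where g': "g' \<in> borel_measurable borel" "AE x in lborel. g x = g' x"
      "\<And>K. compact K \<Longrightarrow> set_integrable lborel K g'" using locally_integrable_borel[OF lg] by blast
  obtain h' where h': "h' \<in> borel_measurable borel" "AE x in lborel. h x = h' x"
      "\<And>K. compact K \<Longrightarrow> set_integrable lborel K h'" using locally_integrable_borel[OF lh] by blast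
  have "AE x in lborel. g' x - h' x = 0"
  proof (rule AE_zero_if_test_integrals_zero)
    show "(\<lambda>x. g' x - h' x) \<in> borel_measurable borel" using g'(1) h'(1) by measurable
    show "set_integrable lborel K (\<lambda>x. g' x - h' x)" if "compact K" for K
      using g'(3)[OF that] h'(3)[OF that] by (rule set_integral_diff(1))
    fix \<phi> :: "real ^ 'a \<Rightarrow> real" assume \<phi>: "test_function \<phi>"
    have "(LINT x|lborel. (g' x - h' x) * \<phi> x) = (LINT x|lborel. g' x * \<phi> x) - (LINT x|lborel. h' x * \<phi> x)"
      using Bochner_Integration.integral_diff[OF integrable_mult_test_function[OF g'(1,3) \<phi>] integrable_mult_test_function[OF h'(1,3) \<phi>]]
      by (simp add: left_diff_distrib)
    also have "\<dots> = 0"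
      using eq[OF \<phi>] lebesgue_integral_test_AE[OF g'(2,1) \<phi>] lebesgue_integral_test_AE[OF h'(2,1) \<phi>] by simp
    finally show "(LINT x|lborel. (g' x - h' x) * \<phi> x) = 0" .
  qed
  with g'(2) h'(2) show ?thesis by eventually_elim simp
qed

text \<open>A convolution at \<open>x\<close> is an integral against the test function
  \<open>\<lambda>y. \<eta> (x - y)\<close>, whose derivative supplies the minus sign of integration
  by parts. For the converse take the point 0 and the reflected test function.\<close>

lemma has_weak_partial_iff_l2_deriv:
  assumes f: "represents f u" and g: "represents g v"
  shows "has_weak_partial i f g \<longleftrightarrow> l2_deriv i u v"
proof -
  obtain f' where f': "sq_int f'" "AE x in lborel. f x = f' x" "u = l2 f'" using f by (rule representsE)
  obtain g' where g': "sq_int g'" "AE x in lborel. g x = g' x" "v = l2 g'" using g by (rule representsE)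
  have 1: "has_weak_partial i f g \<longleftrightarrow>
      (\<forall>\<phi>. test_function \<phi> \<longrightarrow> (LINT x|lborel. f' x * pd i \<phi> x) = - (LINT x|lborel. g' x * \<phi> x))"
    using represents_locally_integrable[OF f] represents_locally_integrable[OF g]
      lebesgue_integral_test_AE[OF f'(2) sq_intD(1)[OF f'(1)] test_function_pd]
      lebesgue_integral_test_AE[OF g'(2) sq_intD(1)[OF g'(1)]]
    by (simp add: has_weak_partial_def)
  have 2: "l2_deriv i u v \<longleftrightarrow> (\<forall>\<eta> x. test_function \<eta> \<longrightarrow> conv f' (pd i \<eta>) x = conv g' \<eta> x)"
    using l2_conv_l2[OF f'(1) test_function_pd] l2_conv_l2[OF g'(1)] by (simp add: l2_deriv_def f'(3) g'(3))
  show ?thesis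
    unfolding 1 2
  proof (intro iffI allI impI)
    fix \<eta> x assume *: "\<forall>\<phi>. test_function \<phi> \<longrightarrow> (LINT x|lborel. f' x * pd i \<phi> x) = - (LINT x|lborel. g' x * \<phi> x)"
      and \<eta>: "test_function (\<eta> :: real ^ 'a \<Rightarrow> real)"
    have "(LINT y|lborel. f' y * - pd i \<eta> (x - y)) = - (LINT y|lborel. g' y * \<eta> (x - y))"
      using *[rule_format, OF test_function_reflected[OF \<eta>, of x]]
      unfolding pd_reflected[OF test_functionD(1)[OF \<eta>]] .
    then show "conv f' (pd i \<eta>) x = conv g' \<eta> x" by (simp add: conv_def)
  next
    fix \<phi> assume *: "\<forall>\<eta> x. test_function \<eta> \<longrightarrow> conv f' (pd i \<eta>) x = conv g' \<eta> x"
      and \<phi>: "test_function (\<phi> :: real ^ 'a \<Rightarrow> real)"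
    have r: "test_function (\<lambda>y. \<phi> (0 - y))" by (rule test_function_reflected[OF \<phi>])
    have "conv f' (pd i (\<lambda>y. \<phi> (0 - y))) 0 = conv g' (\<lambda>y. \<phi> (0 - y)) 0" using *[rule_format, OF r] .
    then show "(LINT x|lborel. f' x * pd i \<phi> x) = - (LINT x|lborel. g' x * \<phi> x)"
      unfolding conv_def pd_reflected[OF test_functionD(1)[OF \<phi>]] by simp
  qed
qed

text \<open>\<open>H_per\<close> asks for periodicity of the function itself, so that of its
  derivatives has to be derived: shifting the test function shows that \<open>g'\<close> and its
  translate by a period have the same integrals against test functions.\<close>

lemma periodic_weak_partial:
  assumes f: "represents f u" and w: "has_weak_partial i f g" shows "periodic g"
proof -
  obtain f' where f': "sq_int f'" "AE x in lborel. f x = f' x" "u = l2 f'" using f by (rule representsE)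
  have lg: "locally_integrable g" using w by (simp add: has_weak_partial_def)
  obtain g' where g': "g' \<in> borel_measurable borel" "AE x in lborel. g x = g' x"
      "\<And>K. compact K \<Longrightarrow> set_integrable lborel K g'" using locally_integrable_borel[OF lg] by blast
  note [measurable] = g'(1) sq_intD(1)[OF f'(1)]
  have ibp: "(LINT x|lborel. f' x * pd i \<phi> x) = - (LINT x|lborel. g' x * \<phi> x)" if \<phi>: "test_function \<phi>" for \<phi>
  proof -
    have "(LINT x|lebesgue. f x * pd i \<phi> x) = - (LINT x|lebesgue. g x * \<phi> x)"
      using w \<phi> unfolding has_weak_partial_def by blast
    then show ?thesis
      unfolding lebesgue_integral_test_AE[OF f'(2) sq_intD(1)[OF f'(1)] test_function_pd[OF \<phi>]]
        lebesgue_integral_test_AE[OF g'(2,1) \<phi>] .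
  qed
  have "periodic g'"
    unfolding periodic_def
  proof
    fix k
    let ?e = "axis k 1 :: real ^ 'a"
    have int: "set_integrable lborel K (\<lambda>x. g' (?e + x))" if K: "compact K" for K
    proof -
      have "compact ((+) ?e ` K)" using K by (rule compact_translation)
      then have [measurable]: "(+) ?e ` K \<in> sets borel" by (intro borel_closed compact_imp_closed)
      from g'(3)[OF \<open>compact ((+) ?e ` K)\<close>] have "integrable (distr lborel borel ((+) ?e)) (\<lambda>x. indicator ((+) ?e ` K) x *\<^sub>R g' x)"
        by (simp add: set_integrable_def lborel_distr_plus)
      then have "integrable lborel (\<lambda>x. indicator ((+) ?e ` K) (?e + x) *\<^sub>R g' (?e + x))"
        by (subst (asm) integrable_distr_eq) measurable
      moreover have "indicator ((+) ?e ` K) (?e + x) = (indicator K x :: real)" for x by (auto simp: indicator_def)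
      ultimately show ?thesis by (simp add: set_integrable_def)
    qed
    have "AE x in lborel. g' (?e + x) - g' x = 0"
    proof (rule AE_zero_if_test_integrals_zero)
      show "(\<lambda>x. g' (?e + x) - g' x) \<in> borel_measurable borel" by measurable
      show "set_integrable lborel K (\<lambda>x. g' (?e + x) - g' x)" if "compact K" for K
        using int[OF that] g'(3)[OF that] by (rule set_integral_diff(1))
      fix \<phi> :: "real ^ 'a \<Rightarrow> real" assume \<phi>: "test_function \<phi>"
      note [measurable] = borel_measurable_test_function[OF \<phi>] borel_measurable_test_function[OF test_function_pd[OF \<phi>]]
      define \<psi> where "\<psi> x = \<phi> (- ?e + 1 *\<^sub>R x)" for x
      have \<psi>: "test_function \<psi>" unfolding \<psi>_def by (rule test_function_affine[OF \<phi>]) simp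
      note [measurable] = borel_measurable_test_function[OF \<psi>]
      have d\<psi>: "pd i \<psi> x = pd i \<phi> (- ?e + x)" for x
        using pd_affine[OF smooth_differentiable[OF test_functionD(1)[OF \<phi>]], where a = "- ?e" and s = 1 and x = x and i = i]
        by (simp add: \<psi>_def[abs_def])
      have "(LINT x|lborel. g' (?e + x) * \<phi> x) = (LINT x|lborel. g' (?e + x) * \<psi> (?e + x))" by (simp add: \<psi>_def)
      also have "\<dots> = (LINT x|lborel. g' x * \<psi> x)" by (rule integral_lborel_translate[of "\<lambda>x. g' x * \<psi> x"]) measurable
      also have "\<dots> = - (LINT x|lborel. f' x * pd i \<psi> x)" using ibp[OF \<psi>] by simp
      also have "(LINT x|lborel. f' x * pd i \<psi> x) = (LINT x|lborel. f' (?e + x) * pd i \<psi> (?e + x))"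
        by (rule integral_lborel_translate[of "\<lambda>x. f' x * pd i \<psi> x", symmetric])
           (use borel_measurable_test_function[OF test_function_pd[OF \<psi>]] in measurable)
      also have "\<dots> = (LINT x|lborel. f' x * pd i \<phi> x)"
      proof (rule integral_cong_AE)
        have "AE x in lborel. f' (x + ?e) = f' x" using sq_intD(2)[OF f'(1)] by (simp add: periodic_def)
        then show "AE x in lborel. f' (?e + x) * pd i \<psi> (?e + x) = f' x * pd i \<phi> x"
          by (rule eventually_mono) (simp add: d\<psi> add.commute[of ?e])
      qed (use borel_measurable_test_function[OF test_function_pd[OF \<psi>]] in measurable)
      also have "- \<dots> = (LINT x|lborel. g' x * \<phi> x)" using ibp[OF \<phi>] by simp
      finally have eq: "(LINT x|lborel. g' (?e + x) * \<phi> x) = (LINT x|lborel. g' x * \<phi> x)" .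
      have "integrable lborel (\<lambda>x. g' (?e + x) * \<phi> x)"
        by (rule integrable_mult_test_function[OF _ int \<phi>]) measurable
      from Bochner_Integration.integral_diff[OF this integrable_mult_test_function[OF g'(1,3) \<phi>]] eq
      show "(LINT x|lborel. (g' (?e + x) - g' x) * \<phi> x) = 0" by (simp add: left_diff_distrib)
    qed
    then show "AE x in lborel. g' (x + ?e) = g' x" by (rule eventually_mono) (simp add: add.commute)
  qed
  then show ?thesis using g'(2) periodic_AE_cong[of g' g] by (simp add: eq_commute)
qed

text \<open>\<open>weak_partial\<close> is picked by choice among locally integrable functions. By
  uniqueness it agrees almost everywhere with the square integrable \<open>g\<close> and so belongs
  to the same class.\<close>

lemma represents_weak_partial:
  assumes f: "represents f u" and w: "has_weak_partial i f g" and g: "g \<in> L2_loc"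
  obtains v where "l2_deriv i u v" "represents g v" "represents (weak_partial i f) v"
proof -
  have "g \<in> L2_per" using g periodic_weak_partial[OF f w] by (simp add: L2_per_def Y_periodic_iff)
  then obtain v where v: "represents g v" using L2_per_imp_represents by blast
  have "has_weak_partial i f (weak_partial i f)" unfolding weak_partial_def by (rule someI[of "has_weak_partial i f", OF w])
  then have "represents (weak_partial i f) v" using represents_cong[OF v] has_weak_partial_unique[OF w] by blast
  moreover have "l2_deriv i u v" using has_weak_partial_iff_l2_deriv[OF f v] w by blast
  ultimately show ?thesis using that v by blast
qed

lemma l2_deriv_imp_represents_weak_partial:
  assumes f: "represents f u" and w: "l2_deriv i u v" shows "represents (weak_partial i f) v" "has_weak_partial i f (weak_partial i f)"
proof -
  obtain g where g: "represents g v" using represents_exists by blast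
  have h: "has_weak_partial i f g" using has_weak_partial_iff_l2_deriv[OF f g] w by blast
  then show w': "has_weak_partial i f (weak_partial i f)" unfolding weak_partial_def by (rule someI[of "has_weak_partial i f"])
  show "represents (weak_partial i f) v" using represents_cong[OF g] has_weak_partial_unique[OF h w'] by blast
qed

lemma H_per_1_iff: "f \<in> H_per 1 \<longleftrightarrow> (\<exists>u v. represents f u \<and> (u, v) \<in> H1_graph)"
proof
  assume f: "f \<in> H_per 1"
  then have "f \<in> L2_per" by (simp add: H_per_def L2_per_def)
  then obtain u where u: "represents f u" using L2_per_imp_represents by blast
  have "\<exists>v. l2_deriv i u v" for i
  proof -
    obtain g where "g \<in> L2_loc" "has_weak_partial i f g" using f by (auto simp: H_per_def)
    then show ?thesis using represents_weak_partial[OF u] by metis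
  qed
  then obtain v where "\<And>i. l2_deriv i u (v i)" by metis
  then have "(u, \<chi> i. v i) \<in> H1_graph" by (simp add: H1_graph_def)
  then show "\<exists>u v. represents f u \<and> (u, v) \<in> H1_graph" using u by blast
next
  assume "\<exists>u v. represents f u \<and> (u, v) \<in> H1_graph"
  then obtain u v where u: "represents f u" and v: "(u, v) \<in> H1_graph" by blast
  have "\<exists>g\<in>L2_loc. has_weak_partial i f g" for i
  proof -
    have w: "l2_deriv i u (v $ i)" using v by (simp add: H1_graph_def)
    have "weak_partial i f \<in> L2_per" by (rule represents_imp_L2_per[OF l2_deriv_imp_represents_weak_partial(1)[OF u w]])
    then show ?thesis using l2_deriv_imp_represents_weak_partial(2)[OF u w] by (auto simp: L2_per_def)
  qed
  then show "f \<in> H_per 1" using represents_imp_L2_per[OF u] by (simp add: H_per_def L2_per_def)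
qed

lemma smooth_periodic_has_weak_partial:
  assumes "smooth_periodic q" shows "has_weak_partial i q (pd i q)"
  using has_weak_partial_iff_l2_deriv[OF represents_l2[OF sq_int_smooth_periodic[OF assms]]
      represents_l2[OF sq_int_smooth_periodic[OF smooth_periodic_pd[OF assms]]]] l2_deriv_smooth[OF assms] by blast

text \<open>Makes smooth functions admissible in the very weak formulation; the uniqueness argument
  tests with them.\<close>

lemma smooth_periodic_H_per: "smooth_periodic q \<Longrightarrow> q \<in> H_per k"
proof -
  assume q: "smooth_periodic q"
  have "q \<in> H_loc k" if "smooth_periodic q" for q
    using that
  proof (induction k arbitrary: q)
    case 0
    then show ?case using represents_imp_L2_per[OF represents_l2[OF sq_int_smooth_periodic]] by (auto simp: L2_per_def)
  next
    case (Suc k)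
    have "q \<in> L2_loc" using represents_imp_L2_per[OF represents_l2[OF sq_int_smooth_periodic[OF Suc.prems]]] by (simp add: L2_per_def)
    moreover have "\<exists>g\<in>H_loc k. has_weak_partial i q g" for i
      using Suc.IH[OF smooth_periodic_pd[OF Suc.prems]] smooth_periodic_has_weak_partial[OF Suc.prems] by blast
    ultimately show ?case by simp
  qed
  then show ?thesis using q by (simp add: H_per_def Y_periodic_iff periodic_def smooth_periodicD)
qed

subsection \<open>Jets of vector fields and of potentials\<close>

definition vector_jet :: "(real ^ 'n \<Rightarrow> real ^ 'n) \<Rightarrow> 'n::finite jet \<Rightarrow> bool" where
  "vector_jet w z \<longleftrightarrow> z \<in> jet_space \<and> (\<forall>i. represents (\<lambda>x. w x $ i) (fst z $ i)) \<and>
     (\<forall>i j. represents (weak_partial j (\<lambda>x. w x $ i)) (snd z $ i $ j))"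

lemma vector_jetI:
  assumes z: "z \<in> jet_space" and w: "\<And>i. represents (\<lambda>x. w x $ i) (fst z $ i)" shows "vector_jet w z"
proof -
  have "l2_deriv j (fst z $ i) (snd z $ i $ j)" for i j using z by (auto simp: jet_space_def H1_graph_def)
  then have "represents (weak_partial j (\<lambda>x. w x $ i)) (snd z $ i $ j)" for i j
    using l2_deriv_imp_represents_weak_partial(1)[OF w] by blast
  then show ?thesis using assms by (simp add: vector_jet_def)
qed

lemma H1_per0_vec_iff: "w \<in> H1_per0_vec \<longleftrightarrow> (\<exists>z. vector_jet w z)"
proof
  assume w: "w \<in> H1_per0_vec"
  have "\<exists>u v. represents (\<lambda>x. w x $ i) u \<and> (u, v) \<in> H1_graph" for i
    using w H_per_1_iff[of "\<lambda>x. w x $ i"] by (simp add: H1_per0_vec_def)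
  then obtain u v where uv: "\<And>i. represents (\<lambda>x. w x $ i) (u i)" "\<And>i. (u i, v i) \<in> H1_graph" by metis
  have "u i \<bullet> one_l2 = 0" for i
    using w cell_integral_represents[OF uv(1)[of i]] by (simp add: H1_per0_vec_def)
  then have "(\<chi> i. u i, \<chi> i. v i) \<in> jet_space" using uv(2) by (simp add: jet_space_def)
  then have "vector_jet w (\<chi> i. u i, \<chi> i. v i)" by (rule vector_jetI) (simp add: uv(1))
  then show "\<exists>z. vector_jet w z" by blast
next
  assume "\<exists>z. vector_jet w z"
  then obtain z where z: "z \<in> jet_space" "\<And>i. represents (\<lambda>x. w x $ i) (fst z $ i)" by (auto simp: vector_jet_def)
  have "(fst z $ i, snd z $ i) \<in> H1_graph" "fst z $ i \<bullet> one_l2 = 0" for i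
    using z(1) by (auto simp: jet_space_def)
  then show "w \<in> H1_per0_vec"
    using z(2) H_per_1_iff cell_integral_represents[OF z(2)] unfolding H1_per0_vec_def by fastforce
qed

lemma vector_jet_exists: "z \<in> jet_space \<Longrightarrow> \<exists>w. vector_jet w z"
proof -
  assume z: "z \<in> jet_space"
  have "\<forall>i. \<exists>f. represents f (fst z $ i)" using represents_exists by blast
  then obtain f where f: "\<And>i. represents (f i) (fst z $ i)" by metis
  have "vector_jet (\<lambda>x. \<chi> i. f i x) z" by (rule vector_jetI[OF z]) (simp add: f)
  then show ?thesis by blast
qed

lemma vector_jet_AE_eq:
  assumes "vector_jet w z" "vector_jet w' z" shows "AE x in lborel. w x = w' x"
proof -
  have "AE x in lborel. w x $ i = w' x $ i" for i
    using assms represents_AE_eq[of "\<lambda>x. w x $ i" "fst z $ i" "\<lambda>x. w' x $ i"] by (simp add: vector_jet_def)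
  then have "AE x in lborel. \<forall>i. w x $ i = w' x $ i" by (rule eventually_all_finite)
  then show ?thesis by (simp add: vec_eq_iff)
qed

lemma represents_weak_div: "vector_jet w z \<Longrightarrow> represents (weak_div w) (jet_div z)"
  unfolding weak_div_def[abs_def] jet_div_def by (rule represents_sum) (simp add: vector_jet_def)

text \<open>\<open>J\<close> is kept separate from \<open>w\<close>: it is the Jacobian of
  \<open>w\<close> in the bilinear form, and the Hessian of a potential with gradient
  \<open>w\<close> in the very weak formulation.\<close>

lemma represents_jet_op:
  assumes J: "\<And>i j. represents (\<lambda>x. J x $ i $ j) (snd z $ i $ j)" and w: "\<And>i. represents (\<lambda>x. w x $ i) (fst z $ i)"
    and a: "\<And>i j. bounded_coeff (a i j)" "\<And>i j. AE x in lborel. a' x $ i $ j = a i j x"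
    and b: "\<And>i. bounded_coeff (b i)" "\<And>i. AE x in lborel. b' x $ i = b i x"
  shows "represents (\<lambda>x. a' x \<bullet> J x + b' x \<bullet> w x) (jet_op a b z)"
  unfolding jet_op_def inner_vec_def inner_real_def
  by (intro represents_add represents_sum represents_mult J w a b)

lemma B2_eq_jet_form:
  assumes v: "vector_jet v z" and w: "vector_jet w z'"
    and a: "\<And>i j. bounded_coeff (a i j)" "\<And>i j. AE x in lborel. a' x $ i $ j = a i j x"
    and b: "\<And>i. bounded_coeff (b i)" "\<And>i. AE x in lborel. b' x $ i = b i x"
  shows "B2 a' b' v w = jet_form a b z z'"
proof -
  have J: "represents (\<lambda>x. weak_jacobian u x $ i $ j) (snd y $ i $ j)" if "vector_jet u y" for u y i j
    using that by (simp add: weak_jacobian_def vector_jet_def)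
  have "cell_integral (\<lambda>x. weak_div v x * (a' x \<bullet> weak_jacobian w x + b' x \<bullet> w x)) = jet_div z \<bullet> jet_op a b z'"
    by (intro cell_integral_mult_represents represents_weak_div v represents_jet_op J w a b) (use w in \<open>simp add: vector_jet_def\<close>)
  moreover have "cell_integral (\<lambda>x. (weak_jacobian v x - transpose (weak_jacobian v x))
           \<bullet> (weak_jacobian w x - transpose (weak_jacobian w x))) = jet_curl z \<bullet> jet_curl z'"
  proof -
    \<comment> \<open>The double sum over matrix entries is flattened to a sum over index pairs, so
      that one application of the rule for sums evaluates the integral.\<close>
    let ?K = "\<lambda>u p x. weak_jacobian u x $ fst p $ snd p - weak_jacobian u x $ snd p $ fst p"
    let ?c = "\<lambda>y :: 'a jet. \<lambda>p. snd y $ fst p $ snd p - snd y $ snd p $ fst p"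
    have "(weak_jacobian v x - transpose (weak_jacobian v x)) \<bullet> (weak_jacobian w x - transpose (weak_jacobian w x))
        = (\<Sum>p\<in>UNIV \<times> UNIV. ?K v p x * ?K w p x)" for x
      by (simp add: inner_vec_def transpose_def sum.cartesian_product case_prod_beta)
    then have "cell_integral (\<lambda>x. (weak_jacobian v x - transpose (weak_jacobian v x))
           \<bullet> (weak_jacobian w x - transpose (weak_jacobian w x)))
        = cell_integral (\<lambda>x. \<Sum>p\<in>UNIV \<times> UNIV. ?K v p x * ?K w p x)" by simp
    also have "\<dots> = (\<Sum>p\<in>UNIV \<times> UNIV. ?c z p \<bullet> ?c z' p)"
      by (rule cell_integral_sum_represents) (intro represents_diff J v w)+
    also have "\<dots> = jet_curl z \<bullet> jet_curl z'"
      by (simp add: inner_vec_def jet_curl_def sum.cartesian_product case_prod_beta)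
    finally show ?thesis .
  qed
  ultimately show ?thesis by (simp add: B2_def jet_form_def)
qed

lemma L2_per_component:
  fixes F :: "real ^ 'n \<Rightarrow> real ^ 'n"
  assumes F: "F \<in> L2_per" shows "(\<lambda>x. F x $ i) \<in> L2_per"
proof -
  have m: "F \<in> borel_measurable lebesgue" and per: "periodic F"
    and int: "\<And>K. compact K \<Longrightarrow> set_integrable lebesgue K (\<lambda>x. (norm (F x))\<^sup>2)"
    using F by (auto simp: L2_per_def L2_loc_def Y_periodic_iff)
  have cm: "(\<lambda>v :: real ^ 'n. v $ i) \<in> borel_measurable borel"
    by (intro borel_measurable_continuous_onI continuous_intros)
  have mi: "(\<lambda>x. F x $ i) \<in> borel_measurable lebesgue" using measurable_compose[OF m cm] .
  have "set_integrable lebesgue K (\<lambda>x. (norm (F x $ i))\<^sup>2)" if K: "compact K" for K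
    unfolding set_integrable_def
  proof (rule Bochner_Integration.integrable_bound[OF int[OF K, unfolded set_integrable_def]])
    have "K \<in> sets lebesgue" using K by (simp add: borel_closed compact_imp_closed)
    then show "(\<lambda>x. indicator K x *\<^sub>R (norm (F x $ i))\<^sup>2) \<in> borel_measurable lebesgue" using mi by measurable
    show "AE x in lebesgue. norm (indicator K x *\<^sub>R (norm (F x $ i))\<^sup>2) \<le> norm (indicator K x *\<^sub>R (norm (F x))\<^sup>2)"
    proof (rule AE_I2)
      fix x
      have "(norm (F x $ i))\<^sup>2 \<le> (norm (F x))\<^sup>2"
        by (rule power_mono) (auto simp: component_le_norm_cart)
      then show "norm (indicator K x *\<^sub>R (norm (F x $ i))\<^sup>2) \<le> norm (indicator K x *\<^sub>R (norm (F x))\<^sup>2)"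
        by (simp add: indicator_def)
    qed
  qed
  then show ?thesis using mi periodic_compose[OF per, of "\<lambda>v. v $ i"] by (simp add: L2_per_def L2_loc_def Y_periodic_iff)
qed

lemma cell_integral_inner_represents:
  assumes "\<And>i. represents (\<lambda>x. F x $ i) (F' $ i)" "\<And>i. represents (\<lambda>x. w x $ i) (w' $ i)"
  shows "cell_integral (\<lambda>x. F x \<bullet> w x) = F' \<bullet> w'"
  unfolding inner_vec_def[of "F x" for x] inner_real_def inner_vec_def[of F']
  by (rule cell_integral_sum_represents[OF assms])

text \<open>The jet of the gradient of \<open>\<phi>\<close>. The entry \<open>snd z $ i $ j\<close>
  is the j-th derivative of the i-th one, in the order of a Jacobian and opposite to
  \<open>weak_hessian\<close>; symmetry of second derivatives reconciles the two.\<close>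

definition potential_jet :: "(real ^ 'n \<Rightarrow> real) \<Rightarrow> 'n::finite jet \<Rightarrow> bool" where
  "potential_jet \<phi> z \<longleftrightarrow> (\<exists>p. represents \<phi> p \<and> (\<forall>i. l2_deriv i p (fst z $ i) \<and> (\<forall>j. l2_deriv j (fst z $ i) (snd z $ i $ j))))"

lemma potential_jet_exists:
  assumes \<phi>: "\<phi> \<in> H_per 2" shows "\<exists>z. potential_jet \<phi> z"
proof -
  have h2: "\<phi> \<in> H_loc (Suc (Suc 0))" and per: "periodic \<phi>" using \<phi> by (simp_all add: H_per_def Y_periodic_iff numeral_2_eq_2)
  have "\<phi> \<in> L2_per" using h2 per by (simp add: L2_per_def Y_periodic_iff)
  then obtain p where p: "represents \<phi> p" using L2_per_imp_represents by blast
  have "\<exists>v V. l2_deriv i p v \<and> (v, V) \<in> H1_graph" for i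
  proof -
    have "\<forall>i. \<exists>g\<in>H_loc (Suc 0). has_weak_partial i \<phi> g"
      using h2 unfolding H_loc.simps(2)[of "Suc 0"] by simp
    then obtain g where g: "g \<in> H_loc (Suc 0)" "has_weak_partial i \<phi> g" by blast
    have gl: "g \<in> L2_loc" using g(1) by simp
    obtain v where v: "l2_deriv i p v" "represents g v" by (rule represents_weak_partial[OF p g(2) gl])
    \<comment> \<open>As derivatives of periodic functions are periodic, \<open>g\<close> is a
      periodic Sobolev function itself, which supplies the second derivatives.\<close>
    have "g \<in> H_per 1" using g(1) periodic_weak_partial[OF p g(2)] by (simp add: H_per_def Y_periodic_iff)
    then obtain v' V where "represents g v'" "(v', V) \<in> H1_graph" using H_per_1_iff by blast
    then show ?thesis using v represents_unique by blast
  qed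
  then obtain v V where vV: "\<And>i. l2_deriv i p (v i)" "\<And>i. (v i, V i) \<in> H1_graph" by metis
  have "potential_jet \<phi> (\<chi> i. v i, \<chi> i. V i)"
    unfolding potential_jet_def using p vV by (auto simp: H1_graph_def)
  then show ?thesis by blast
qed

lemma potential_jet_properties:
  assumes "potential_jet \<phi> z"
  shows "z \<in> jet_space" "jet_curl z = 0" "\<And>i. represents (\<lambda>x. weak_grad \<phi> x $ i) (fst z $ i)"
    "\<And>i j. represents (\<lambda>x. weak_hessian \<phi> x $ i $ j) (snd z $ i $ j)" "vector_jet (weak_grad \<phi>) z"
proof -
  obtain p where p: "represents \<phi> p" "\<And>i. l2_deriv i p (fst z $ i)" "\<And>i j. l2_deriv j (fst z $ i) (snd z $ i $ j)"
    using assms unfolding potential_jet_def by blast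
  have "(p, fst z) \<in> H1_graph" using p(2) by (simp add: H1_graph_def)
  then have "fst z $ i \<bullet> one_l2 = 0" for i by (rule H1_mean_derivative)
  moreover have "(fst z $ i, snd z $ i) \<in> H1_graph" for i using p(3) by (simp add: H1_graph_def)
  ultimately show z: "z \<in> jet_space" by (simp add: jet_space_def case_prod_beta)
  \<comment> \<open>Weak second derivatives commute because convolution moves both of them onto the
    smooth kernel.\<close>
  have sym: "snd z $ i $ j = snd z $ j $ i" for i j
  proof -
    have "snd z $ i $ j - snd z $ j $ i = 0"
    proof (rule l2_eq_0_if_l2_conv_zero)
      fix \<eta> :: "real ^ 'a \<Rightarrow> real" assume \<eta>: "test_function \<eta>"
      have c: "l2_conv (snd z $ i $ j) \<eta> 0 = l2_conv p (pd i (pd j \<eta>)) 0" for i j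
        using p(2)[of i] p(3)[where i = i and j = j] \<eta> test_function_pd[OF \<eta>] by (simp add: l2_deriv_def)
      have "pd i (pd j \<eta>) = pd j (pd i \<eta>)" using pd_commute[OF test_functionD(1)[OF \<eta>]] by blast
      then have "l2_conv (snd z $ i $ j) \<eta> 0 = l2_conv (snd z $ j $ i) \<eta> 0" unfolding c by (rule arg_cong)
      then show "l2_conv (snd z $ i $ j - snd z $ j $ i) \<eta> 0 = 0"
        using linear_diff[OF bounded_linear.linear[OF bounded_linear_l2_conv[OF \<eta>, of 0]]] by simp
    qed
    then show ?thesis by simp
  qed
  show "jet_curl z = 0" using sym by (simp add: jet_curl_def vec_eq_iff)
  have g: "represents (weak_partial i \<phi>) (fst z $ i)" for i by (rule l2_deriv_imp_represents_weak_partial(1)[OF p(1,2)])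
  then show g': "represents (\<lambda>x. weak_grad \<phi> x $ i) (fst z $ i)" for i by (simp add: weak_grad_def)
  have "represents (weak_partial j (weak_partial i \<phi>)) (snd z $ i $ j)" for i j
    by (rule l2_deriv_imp_represents_weak_partial(1)[OF g p(3)])
  then show "represents (\<lambda>x. weak_hessian \<phi> x $ i $ j) (snd z $ i $ j)" for i j
    unfolding sym[of i j] by (simp add: weak_hessian_def)
  show "vector_jet (weak_grad \<phi>) z" by (rule vector_jetI[OF z g'])
qed

lemma potential_jet_smooth:
  assumes q: "smooth_periodic q" and z: "potential_jet q z" shows "z = grad_jet q"
proof -
  obtain p where p: "represents q p" "\<And>i. l2_deriv i p (fst z $ i)" "\<And>i j. l2_deriv j (fst z $ i) (snd z $ i $ j)"
    using z unfolding potential_jet_def by blast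
  have "p = l2 q" using represents_unique[OF p(1) represents_l2[OF sq_int_smooth_periodic[OF q]]] .
  then have 1: "fst z $ i = l2 (pd i q)" for i using l2_deriv_unique[OF p(2)] l2_deriv_smooth[OF q] by blast
  have "snd z $ i $ j = l2 (pd j (pd i q))" for i j
    using l2_deriv_unique[OF p(3)[where i = i and j = j]] l2_deriv_smooth[OF smooth_periodic_pd[OF q, of i], of j] unfolding 1 by blast
  then show ?thesis using 1 by (simp add: grad_jet_def prod_eq_iff vec_eq_iff)
qed

subsection \<open>The Cordes condition\<close>

text \<open>With N = |A|^2 + |b|^2 and a free factor g in place of \<open>\<gamma>\<close>, the left
  side is g^2 N - 2 g tr A + n. Its minimiser is \<open>\<gamma>\<close>, and the minimum n - (tr
  A)^2/N is at most 1 - delta by the assumption.\<close>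

lemma cordes_pointwise:
  fixes A :: "real ^ 'n ^ 'n" and b :: "real ^ 'n"
  defines "\<gamma> \<equiv> trace A / ((norm A)\<^sup>2 + (norm b)\<^sup>2)"
  assumes l: "0 < l" "\<And>\<xi>. l * (\<xi> \<bullet> \<xi>) \<le> \<xi> \<bullet> (A *v \<xi>)"
    and \<delta>: "0 < \<delta>" "((norm A)\<^sup>2 + (norm b)\<^sup>2) / (trace A)\<^sup>2 \<le> 1 / (real CARD('n) - 1 + \<delta>)"
  shows "(\<Sum>i\<in>UNIV. \<Sum>j\<in>UNIV. (\<gamma> * A $ i $ j - (if i = j then 1 else 0))\<^sup>2) + (\<Sum>i\<in>UNIV. (\<gamma> * b $ i)\<^sup>2) \<le> 1 - \<delta>"
proof -
  define N where "N = (norm A)\<^sup>2 + (norm b)\<^sup>2"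
  \<comment> \<open>Ellipticity at the unit vectors makes the trace positive. With trace 0 the
    quotient in the condition would be 0 by the convention for division, and the condition would say
    nothing.\<close>
  have "l \<le> A $ i $ i" for i
  proof -
    have "axis i 1 \<bullet> (A *v axis i 1) = A $ i $ i"
      by (simp add: matrix_vector_mult_basis column_def inner_axis')
    then show ?thesis using l(2)[of "axis i 1"] by (simp add: inner_axis_axis)
  qed
  then have "(\<Sum>i\<in>(UNIV :: 'n set). l) \<le> (\<Sum>i\<in>UNIV. A $ i $ i)" by (rule sum_mono)
  then have "real CARD('n) * l \<le> trace A" by (simp add: trace_def)
  moreover have "0 < real CARD('n) * l" using l(1) by simp
  ultimately have tr: "0 < trace A" by linarith
  have "A \<noteq> 0" using tr by (auto simp: trace_def)
  then have N: "0 < N" unfolding N_def by (simp add: add_pos_nonneg)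
  have "1 \<le> real CARD('n)" by (simp add: Suc_leI)
  then have n: "0 < real CARD('n) - 1 + \<delta>" using \<delta>(1) by linarith
  have "N * (real CARD('n) - 1 + \<delta>) \<le> (trace A)\<^sup>2"
    using \<delta>(2) n tr by (simp add: N_def[symmetric] divide_simps mult.commute split: if_splits)
  then have key: "real CARD('n) - 1 + \<delta> \<le> (trace A)\<^sup>2 / N" using N by (simp add: pos_le_divide_eq mult.commute)
  have nA: "(\<Sum>i\<in>UNIV. \<Sum>j\<in>UNIV. (A $ i $ j)\<^sup>2) = (norm A)\<^sup>2" by (simp add: norm_vec_power2)
  have nb: "(\<Sum>i\<in>UNIV. (b $ i)\<^sup>2) = (norm b)\<^sup>2" by (simp add: norm_vec_power2)
  have diag: "(\<Sum>j\<in>UNIV. (\<gamma> * A $ i $ j - (if i = j then 1 else 0))\<^sup>2)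
      = \<gamma>\<^sup>2 * (\<Sum>j\<in>UNIV. (A $ i $ j)\<^sup>2) - 2 * \<gamma> * A $ i $ i + 1" for i
  proof -
    have "(\<Sum>j\<in>UNIV. (\<gamma> * A $ i $ j - (if i = j then 1 else 0))\<^sup>2)
        = (\<Sum>j\<in>UNIV. \<gamma>\<^sup>2 * (A $ i $ j)\<^sup>2 + (if j = i then 1 - 2 * \<gamma> * A $ i $ j else 0))"
      by (intro sum.cong) (auto simp: power2_eq_square algebra_simps)
    also have "\<dots> = \<gamma>\<^sup>2 * (\<Sum>j\<in>UNIV. (A $ i $ j)\<^sup>2) + (1 - 2 * \<gamma> * A $ i $ i)"
      by (simp add: sum.distrib sum_distrib_left)
    finally show ?thesis by simp
  qed
  have "(\<Sum>i\<in>UNIV. \<Sum>j\<in>UNIV. (\<gamma> * A $ i $ j - (if i = j then 1 else 0))\<^sup>2) + (\<Sum>i\<in>UNIV. (\<gamma> * b $ i)\<^sup>2)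
      = \<gamma>\<^sup>2 * N - 2 * \<gamma> * trace A + real CARD('n)"
    unfolding diag
    by (simp add: sum.distrib sum_subtractf sum_distrib_left[symmetric] nA nb power_mult_distrib trace_def N_def distrib_left)
  also have "\<dots> = real CARD('n) - (trace A)\<^sup>2 / N"
    using N unfolding \<gamma>_def N_def[symmetric] by (simp add: power2_eq_square field_simps)
  finally show ?thesis using key by simp
qed

text \<open>Provides Borel versions of the scaled coefficients, with \<open>\<kappa>\<close> equal
  to 1 - delta. Their boundedness comes out of the Cordes estimate itself: the entries of
  \<open>A_tilde\<close> are within 1 of those of the identity matrix, those of
  \<open>b_tilde\<close> within 1 of 0.\<close>

lemma setting_B_coefficients:
  fixes A :: "real ^ 'n \<Rightarrow> real ^ 'n ^ 'n" and b :: "real ^ 'n \<Rightarrow> real ^ 'n"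
  assumes "setting_B A b"
  shows "\<exists>a \<beta> \<kappa>. (\<forall>i j. bounded_coeff (a i j) \<and> (AE x in lborel. A_tilde A b x $ i $ j = a i j x)) \<and>
    (\<forall>i. bounded_coeff (\<beta> i) \<and> (AE x in lborel. b_tilde A b x $ i = \<beta> i x)) \<and>
    (AE x in lborel. (\<Sum>i\<in>UNIV. \<Sum>j\<in>UNIV. (a i j x - (if i = j then 1 else 0))\<^sup>2) + (\<Sum>i\<in>UNIV. (\<beta> i x)\<^sup>2) \<le> \<kappa>) \<and>
    0 \<le> \<kappa> \<and> \<kappa> * (1 + real CARD('n) * (5 / 64)) < 1"
proof -
  have mA: "A \<in> borel_measurable lebesgue" and pA: "periodic A" and mb: "b \<in> borel_measurable lebesgue" and pb: "periodic b"
    using assms by (auto simp: setting_B_def Linf_per_def Y_periodic_iff)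
  obtain l L where l: "0 < l" "AE x in lborel. \<forall>\<xi>. l * (\<xi> \<bullet> \<xi>) \<le> \<xi> \<bullet> (A x *v \<xi>) \<and> \<xi> \<bullet> (A x *v \<xi>) \<le> L * (\<xi> \<bullet> \<xi>)"
    using assms unfolding setting_B_def AE_completion_iff by blast
  obtain \<delta> where \<delta>: "real CARD('n) / (real CARD('n) + pi\<^sup>2) < \<delta>" "\<delta> \<le> 1"
    "AE x in lborel. ((norm (A x))\<^sup>2 + (norm (b x))\<^sup>2) / (trace (A x))\<^sup>2 \<le> 1 / (real CARD('n) - 1 + \<delta>)"
    using assms unfolding setting_B_def AE_completion_iff by blast
  have "0 \<le> real CARD('n) / (real CARD('n) + pi\<^sup>2)" by simp
  then have \<delta>0: "0 < \<delta>" using \<delta>(1) by linarith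
  have sums: "AE x in lborel. (\<Sum>i\<in>UNIV. \<Sum>j\<in>UNIV. (A_tilde A b x $ i $ j - (if i = j then 1 else 0))\<^sup>2)
      + (\<Sum>i\<in>UNIV. (b_tilde A b x $ i)\<^sup>2) \<le> 1 - \<delta>"
    using l(2) \<delta>(3)
  proof eventually_elim
    fix x assume 1: "\<forall>\<xi>. l * (\<xi> \<bullet> \<xi>) \<le> \<xi> \<bullet> (A x *v \<xi>) \<and> \<xi> \<bullet> (A x *v \<xi>) \<le> L * (\<xi> \<bullet> \<xi>)"
      and 2: "((norm (A x))\<^sup>2 + (norm (b x))\<^sup>2) / (trace (A x))\<^sup>2 \<le> 1 / (real CARD('n) - 1 + \<delta>)"
    show "(\<Sum>i\<in>UNIV. \<Sum>j\<in>UNIV. (A_tilde A b x $ i $ j - (if i = j then 1 else 0))\<^sup>2)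
      + (\<Sum>i\<in>UNIV. (b_tilde A b x $ i)\<^sup>2) \<le> 1 - \<delta>"
      using cordes_pointwise[OF l(1) _ \<delta>0 2] 1 by (simp add: A_tilde_def b_tilde_def gamma_fun_def)
  qed
  have boundA: "AE x in lborel. \<bar>A_tilde A b x $ i $ j\<bar> \<le> 2" for i j
    using sums
  proof eventually_elim
    fix x assume *: "(\<Sum>i\<in>UNIV. \<Sum>j\<in>UNIV. (A_tilde A b x $ i $ j - (if i = j then 1 else 0))\<^sup>2)
      + (\<Sum>i\<in>UNIV. (b_tilde A b x $ i)\<^sup>2) \<le> 1 - \<delta>"
    let ?t = "\<lambda>i j. (A_tilde A b x $ i $ j - (if i = j then 1 else 0))\<^sup>2"
    have "?t i j \<le> (\<Sum>j\<in>UNIV. ?t i j)" by (rule member_le_sum) auto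
    also have "\<dots> \<le> (\<Sum>i\<in>UNIV. \<Sum>j\<in>UNIV. ?t i j)" by (rule member_le_sum) (auto intro: sum_nonneg)
    finally have "?t i j \<le> 1\<^sup>2" using * \<delta>0 sum_nonneg[of UNIV "\<lambda>i. (b_tilde A b x $ i)\<^sup>2"] by simp
    then have "\<bar>A_tilde A b x $ i $ j - (if i = j then 1 else 0)\<bar> \<le> 1" by (simp only: abs_le_square_iff[symmetric] abs_one)
    then show "\<bar>A_tilde A b x $ i $ j\<bar> \<le> 2" by (auto split: if_splits)
  qed
  have boundb: "AE x in lborel. \<bar>b_tilde A b x $ i\<bar> \<le> 1" for i
    using sums
  proof eventually_elim
    fix x assume *: "(\<Sum>i\<in>UNIV. \<Sum>j\<in>UNIV. (A_tilde A b x $ i $ j - (if i = j then 1 else 0))\<^sup>2)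
      + (\<Sum>i\<in>UNIV. (b_tilde A b x $ i)\<^sup>2) \<le> 1 - \<delta>"
    have "(b_tilde A b x $ i)\<^sup>2 \<le> (\<Sum>i\<in>UNIV. (b_tilde A b x $ i)\<^sup>2)" by (rule member_le_sum) auto
    moreover have "0 \<le> (\<Sum>i\<in>UNIV. \<Sum>j\<in>UNIV. (A_tilde A b x $ i $ j - (if i = j then 1 else 0))\<^sup>2)"
      by (intro sum_nonneg) auto
    ultimately have "(b_tilde A b x $ i)\<^sup>2 \<le> 1\<^sup>2" using * \<delta>0 by simp
    then show "\<bar>b_tilde A b x $ i\<bar> \<le> 1" by (simp only: abs_le_square_iff[symmetric] abs_one)
  qed
  have comp: "(\<lambda>v :: real ^ 'n. v $ i) \<in> borel_measurable borel" for i
    by (intro borel_measurable_continuous_onI continuous_intros)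
  have comp2: "(\<lambda>M :: real ^ 'n ^ 'n. M $ i $ j) \<in> borel_measurable borel" for i j
    by (intro borel_measurable_continuous_onI continuous_intros)
  have mAc: "(\<lambda>x. A x $ i $ j) \<in> borel_measurable lebesgue" for i j using measurable_compose[OF mA comp2] .
  have mbc: "(\<lambda>x. b x $ i) \<in> borel_measurable lebesgue" for i using measurable_compose[OF mb comp] .
  have m\<gamma>: "gamma_fun A b \<in> borel_measurable lebesgue"
    unfolding gamma_fun_def[abs_def] trace_def using mA mb mAc by measurable
  have repr: "\<exists>h. bounded_coeff h \<and> (AE x in lborel. f x = h x)"
    if f: "f \<in> borel_measurable lebesgue" "periodic f" "AE x in lborel. \<bar>f x\<bar> \<le> M" for f :: "real ^ 'n \<Rightarrow> real" and M
  proof -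
    obtain h where h: "h \<in> borel_measurable lborel" "AE x in lborel. f x = h x"
      using completion_ex_borel_measurable_real[OF f(1)] by blast
    have "AE x in lborel. \<bar>h x\<bar> \<le> M" using f(3) h(2) by eventually_elim simp
    then have "bounded_coeff h" using h periodic_AE_cong[OF f(2) h(2)] by (auto simp: bounded_coeff_def)
    then show ?thesis using h(2) by blast
  qed
  have "\<exists>h. bounded_coeff h \<and> (AE x in lborel. A_tilde A b x $ i $ j = h x)" for i j
  proof (rule repr[OF _ _ boundA])
    show "(\<lambda>x. A_tilde A b x $ i $ j) \<in> borel_measurable lebesgue"
      unfolding A_tilde_def using m\<gamma> mAc by simp
    show "periodic (\<lambda>x. A_tilde A b x $ i $ j)"
      unfolding A_tilde_def gamma_fun_def by (rule periodic_compose2[OF pA pb])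
  qed
  then obtain a where a: "\<And>i j. bounded_coeff (a i j)" "\<And>i j. AE x in lborel. A_tilde A b x $ i $ j = a i j x" by metis
  have "\<exists>h. bounded_coeff h \<and> (AE x in lborel. b_tilde A b x $ i = h x)" for i
  proof (rule repr[OF _ _ boundb])
    show "(\<lambda>x. b_tilde A b x $ i) \<in> borel_measurable lebesgue"
      unfolding b_tilde_def using m\<gamma> mbc by simp
    show "periodic (\<lambda>x. b_tilde A b x $ i)"
      unfolding b_tilde_def gamma_fun_def by (rule periodic_compose2[OF pA pb])
  qed
  then obtain \<beta> where \<beta>: "\<And>i. bounded_coeff (\<beta> i)" "\<And>i. AE x in lborel. b_tilde A b x $ i = \<beta> i x" by metis
  have "AE x in lborel. \<forall>i j. A_tilde A b x $ i $ j = a i j x"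
    by (intro eventually_all_finite a)
  moreover have "AE x in lborel. \<forall>i. b_tilde A b x $ i = \<beta> i x"
    by (intro eventually_all_finite \<beta>)
  ultimately have "AE x in lborel. (\<Sum>i\<in>UNIV. \<Sum>j\<in>UNIV. (a i j x - (if i = j then 1 else 0))\<^sup>2) + (\<Sum>i\<in>UNIV. (\<beta> i x)\<^sup>2) \<le> 1 - \<delta>"
    using sums by eventually_elim simp
  \<comment> \<open>The lower bound on delta says (1 - delta) (n + pi^2) < pi^2. Multiplying the
    claim by pi^2 reduces it to this and to 5 pi^2/64 \<le> 1.\<close>
  moreover have "(1 - \<delta>) * (1 + real CARD('n) * (5 / 64)) < 1"
  proof -
    define n where "n = real CARD('n)"
    have n: "0 < n" by (simp add: n_def)
    have "n < \<delta> * (n + pi\<^sup>2)"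
      using \<delta>(1) n by (simp add: n_def[symmetric] pos_divide_less_eq add_pos_nonneg)
    then have 1: "(1 - \<delta>) * (n + pi\<^sup>2) < pi\<^sup>2" by (simp add: algebra_simps)
    have "n * (5 / 64 * pi\<^sup>2) \<le> n * 1" using pi_square_less n by (intro mult_left_mono) auto
    then have 2: "(1 - \<delta>) * (pi\<^sup>2 + n * (5 / 64 * pi\<^sup>2)) \<le> (1 - \<delta>) * (n + pi\<^sup>2)"
      using \<delta>(2) by (intro mult_left_mono) auto
    have "pi\<^sup>2 * ((1 - \<delta>) * (1 + n * (5 / 64))) = (1 - \<delta>) * (pi\<^sup>2 + n * (5 / 64 * pi\<^sup>2))"
      by (simp add: algebra_simps)
    then have "pi\<^sup>2 * ((1 - \<delta>) * (1 + n * (5 / 64))) < pi\<^sup>2 * 1" using 1 2 by linarith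
    then show ?thesis unfolding n_def[symmetric] by (rule mult_left_less_imp_less) simp
  qed
  ultimately show ?thesis using a \<beta> \<delta>(2) by (intro exI[of _ a] exI[of _ \<beta>] exI[of _ "1 - \<delta>"]) simp
qed

subsection \<open>Very weak solutions\<close>

text \<open>Test functions enter only through the jets of their gradients, so the very weak problem
  becomes a family of linear equations for \<open>U\<close>.\<close>

lemma very_weak_solution_iff:
  assumes a: "\<And>i j. bounded_coeff (a i j)" "\<And>i j. AE x in lborel. a' x $ i $ j = a i j x"
    and b: "\<And>i. bounded_coeff (b i)" "\<And>i. AE x in lborel. b' x $ i = b i x"
    and F: "\<And>i. represents (\<lambda>x. F x $ i) (F' $ i)" and u: "represents u U"
  shows "very_weak_solution a' b' F u \<longleftrightarrow>
    (\<forall>\<phi> z. \<phi> \<in> H_per 2 \<longrightarrow> potential_jet \<phi> z \<longrightarrow> U \<bullet> jet_op a b z = F' \<bullet> fst z)"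
proof -
  have eq: "cell_integral (\<lambda>x. u x * (a' x \<bullet> weak_hessian \<phi> x + b' x \<bullet> weak_grad \<phi> x)) = U \<bullet> jet_op a b z"
      "cell_integral (\<lambda>x. F x \<bullet> weak_grad \<phi> x) = F' \<bullet> fst z" if z: "potential_jet \<phi> z" for \<phi> z
  proof -
    note pj = potential_jet_properties[OF z]
    show "cell_integral (\<lambda>x. u x * (a' x \<bullet> weak_hessian \<phi> x + b' x \<bullet> weak_grad \<phi> x)) = U \<bullet> jet_op a b z"
      by (rule cell_integral_mult_represents[OF u represents_jet_op[OF pj(4,3) a b]])
    show "cell_integral (\<lambda>x. F x \<bullet> weak_grad \<phi> x) = F' \<bullet> fst z"
      by (rule cell_integral_inner_represents[OF F pj(3)])
  qed
  show ?thesis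
  proof
    assume "very_weak_solution a' b' F u"
    then have "U \<bullet> jet_op a b z = F' \<bullet> fst z" if \<phi>: "\<phi> \<in> H_per 2" and z: "potential_jet \<phi> z" for \<phi> z
      unfolding very_weak_solution_def eq[OF z, symmetric] using \<phi> by blast
    then show "\<forall>\<phi> z. \<phi> \<in> H_per 2 \<longrightarrow> potential_jet \<phi> z \<longrightarrow> U \<bullet> jet_op a b z = F' \<bullet> fst z"
      by blast
  next
    assume *: "\<forall>\<phi> z. \<phi> \<in> H_per 2 \<longrightarrow> potential_jet \<phi> z \<longrightarrow> U \<bullet> jet_op a b z = F' \<bullet> fst z"
    have "cell_integral (\<lambda>x. u x * (a' x \<bullet> weak_hessian \<phi> x + b' x \<bullet> weak_grad \<phi> x)) = cell_integral (\<lambda>x. F x \<bullet> weak_grad \<phi> x)"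
      if \<phi>: "\<phi> \<in> H_per 2" for \<phi>
    proof -
      obtain z where z: "potential_jet \<phi> z" using potential_jet_exists[OF \<phi>] by blast
      show ?thesis unfolding eq[OF z] using * \<phi> z by blast
    qed
    then show "very_weak_solution a' b' F u"
      using represents_imp_L2_per[OF u] by (simp add: very_weak_solution_def)
  qed
qed

theorem theorem3p2:
  fixes A :: "real ^ 'n \<Rightarrow> real ^ 'n ^ 'n"
    and b F :: "real ^ 'n \<Rightarrow> real ^ 'n"
  assumes "setting_B A b"
    and "F \<in> L2_per"
  shows
    "(\<exists>\<rho>0. solves_B2 (A_tilde A b) (b_tilde A b) F \<rho>0 \<and>
        (\<forall>\<rho>. solves_B2 (A_tilde A b) (b_tilde A b) F \<rho> \<longrightarrow> (AE x in lebesgue. \<rho> x = \<rho>0 x)))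
     \<and>
     (\<forall>\<rho>0 u0. solves_B2 (A_tilde A b) (b_tilde A b) F \<rho>0 \<longrightarrow>
        u0 = (\<lambda>x. - weak_div \<rho>0 x) \<longrightarrow>
        (very_weak_solution (A_tilde A b) (b_tilde A b) F u0 \<and> cell_integral u0 = 0 \<and>
         (\<forall>u. very_weak_solution (A_tilde A b) (b_tilde A b) F u \<and> cell_integral u = 0 \<longrightarrow>
              (AE x in lebesgue. u x = u0 x)))
        \<and>
        (\<forall>r. very_weak_solution (A_tilde A b) (b_tilde A b) (\<lambda>x. 0) r \<and> cell_integral r = 1 \<longrightarrow>
           (\<forall>u \<in> L2_per. very_weak_solution (A_tilde A b) (b_tilde A b) F u \<longleftrightarrow>
              (\<exists>c::real. AE x in lebesgue. u x = u0 x + c * r x))))"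
proof -
  obtain a \<beta> \<kappa> where
    a: "\<And>i j. bounded_coeff (a i j)" "\<And>i j. AE x in lborel. A_tilde A b x $ i $ j = a i j x"
    and \<beta>: "\<And>i. bounded_coeff (\<beta> i)" "\<And>i. AE x in lborel. b_tilde A b x $ i = \<beta> i x"
    and cordes: "AE x in lborel. (\<Sum>i\<in>UNIV. \<Sum>j\<in>UNIV. (a i j x - (if i = j then 1 else 0))\<^sup>2) + (\<Sum>i\<in>UNIV. (\<beta> i x)\<^sup>2) \<le> \<kappa>"
    and \<kappa>: "0 \<le> \<kappa>" "\<kappa> * (1 + real CARD('n) * (5 / 64)) < 1"
    using setting_B_coefficients[OF assms(1)] by blast
  obtain \<alpha> where \<alpha>: "0 < \<alpha>" "\<And>z. z \<in> jet_space \<Longrightarrow> \<alpha> * (z \<bullet> z) \<le> jet_form a \<beta> z z"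
    using jet_form_coercive[OF jet_op_cordes[OF a(1) \<beta>(1) cordes] \<kappa>] by blast
  have "\<forall>i. \<exists>v. represents (\<lambda>x. F x $ i) v" using L2_per_imp_represents[OF L2_per_component[OF assms(2)]] by blast
  then obtain G where "\<And>i. represents (\<lambda>x. F x $ i) (G i)" by metis
  then have F: "represents (\<lambda>x. F x $ i) ((\<chi> i. G i) $ i)" for i by simp
  define F' where "F' = (\<chi> i. G i)"
  have F': "represents (\<lambda>x. F x $ i) (F' $ i)" for i unfolding F'_def by (rule F)
  let ?sol = "\<lambda>z. z \<in> jet_space \<and> (\<forall>z'\<in>jet_space. jet_form a \<beta> z z' = - (F' \<bullet> fst z'))"
  \<comment> \<open>Every jet of the solution space is the jet of some field, and every admissible
    field has a jet, so testing with fields and testing with jets amount to the same.\<close>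
  have B2_sol: "solves_B2 (A_tilde A b) (b_tilde A b) F \<rho> \<longleftrightarrow> ?sol z" if \<rho>: "vector_jet \<rho> z" for \<rho> z
  proof -
    have eq: "B2 (A_tilde A b) (b_tilde A b) \<rho> w = - cell_integral (\<lambda>x. F x \<bullet> w x)
        \<longleftrightarrow> jet_form a \<beta> z z' = - (F' \<bullet> fst z')" if w: "vector_jet w z'" for w z'
    proof -
      have "cell_integral (\<lambda>x. F x \<bullet> w x) = F' \<bullet> fst z'"
        by (rule cell_integral_inner_represents[OF F']) (use w in \<open>simp add: vector_jet_def\<close>)
      then show ?thesis by (simp only: B2_eq_jet_form[OF \<rho> w a \<beta>])
    qed
    have zJ: "z \<in> jet_space" using \<rho> by (simp add: vector_jet_def)
    show ?thesis
    proof
      assume s: "solves_B2 (A_tilde A b) (b_tilde A b) F \<rho>"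
      show "?sol z"
      proof (intro conjI zJ ballI)
        fix z' :: "'n jet" assume "z' \<in> jet_space"
        then obtain w where w: "vector_jet w z'" using vector_jet_exists by blast
        then have "w \<in> H1_per0_vec" using H1_per0_vec_iff by blast
        then show "jet_form a \<beta> z z' = - (F' \<bullet> fst z')" using s eq[OF w] by (simp add: solves_B2_def)
      qed
    next
      assume s: "?sol z"
      show "solves_B2 (A_tilde A b) (b_tilde A b) F \<rho>"
        unfolding solves_B2_def
      proof (intro conjI ballI)
        show "\<rho> \<in> H1_per0_vec" using \<rho> H1_per0_vec_iff by blast
        fix w :: "real ^ 'n \<Rightarrow> real ^ 'n" assume "w \<in> H1_per0_vec"
        then obtain z' where w: "vector_jet w z'" using H1_per0_vec_iff by blast
        then have "z' \<in> jet_space" by (simp add: vector_jet_def)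
        then show "B2 (A_tilde A b) (b_tilde A b) \<rho> w = - cell_integral (\<lambda>x. F x \<bullet> w x)"
          using s eq[OF w] by blast
      qed
    qed
  qed
  have uniq: "\<exists>!z. ?sol z" by (rule jet_form_solution[OF a(1) \<beta>(1) \<alpha>])
  note vws = very_weak_solution_iff[OF a \<beta> F']
  have F0: "represents (\<lambda>x. (\<lambda>x. 0 :: real ^ 'n) x $ i) ((0 :: 'n l2 ^ 'n) $ i)" for i by (simp add: represents_zero)
  note vws0 = very_weak_solution_iff[OF a \<beta> F0]
  \<comment> \<open>The common core of uniqueness in (ii) and (iii): differences of solutions,
    corrected to mean zero, are tested with smooth potentials, whose jets are the gradient
    jets.\<close>
  have kernel: "U = 0"
    if "U \<bullet> one_l2 = 0" "\<And>\<phi> z. \<phi> \<in> H_per 2 \<Longrightarrow> potential_jet \<phi> z \<Longrightarrow> U \<bullet> jet_op a \<beta> z = 0" for U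
  proof (rule adjoint_kernel_trivial[OF a(1) \<beta>(1) \<alpha> that(1)])
    fix q :: "real ^ 'n \<Rightarrow> real" assume q: "smooth_periodic q"
    have h: "q \<in> H_per 2" by (rule smooth_periodic_H_per[OF q])
    obtain z where z: "potential_jet q z" using potential_jet_exists[OF h] by blast
    show "U \<bullet> jet_op a \<beta> (grad_jet q) = 0"
      using that(2)[OF h z] unfolding potential_jet_smooth[OF q z] .
  qed
  have i: "\<exists>\<rho>0. solves_B2 (A_tilde A b) (b_tilde A b) F \<rho>0 \<and>
        (\<forall>\<rho>. solves_B2 (A_tilde A b) (b_tilde A b) F \<rho> \<longrightarrow> (AE x in lebesgue. \<rho> x = \<rho>0 x))"
  proof -
    obtain z where z: "?sol z" using uniq by blast
    then obtain \<rho>0 where \<rho>0: "vector_jet \<rho>0 z" using vector_jet_exists by blast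
    have "AE x in lebesgue. \<rho> x = \<rho>0 x" if s: "solves_B2 (A_tilde A b) (b_tilde A b) F \<rho>" for \<rho>
    proof -
      obtain z' where z': "vector_jet \<rho> z'" using s H1_per0_vec_iff unfolding solves_B2_def by blast
      have "?sol z'" using s B2_sol[OF z'] by blast
      then have "z' = z" using z uniq by blast
      then show ?thesis using vector_jet_AE_eq[of \<rho> z \<rho>0] z' \<rho>0 by (simp add: AE_completion_iff)
    qed
    moreover have "solves_B2 (A_tilde A b) (b_tilde A b) F \<rho>0" using B2_sol[OF \<rho>0] z by blast
    ultimately show ?thesis by blast
  qed
  have ii_iii: "(very_weak_solution (A_tilde A b) (b_tilde A b) F u0 \<and> cell_integral u0 = 0 \<and>
         (\<forall>u. very_weak_solution (A_tilde A b) (b_tilde A b) F u \<and> cell_integral u = 0 \<longrightarrow>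
              (AE x in lebesgue. u x = u0 x)))
        \<and>
        (\<forall>r. very_weak_solution (A_tilde A b) (b_tilde A b) (\<lambda>x. 0) r \<and> cell_integral r = 1 \<longrightarrow>
           (\<forall>u \<in> L2_per. very_weak_solution (A_tilde A b) (b_tilde A b) F u \<longleftrightarrow>
              (\<exists>c::real. AE x in lebesgue. u x = u0 x + c * r x)))"
    if s: "solves_B2 (A_tilde A b) (b_tilde A b) F \<rho>0" and u0_def: "u0 = (\<lambda>x. - weak_div \<rho>0 x)" for \<rho>0 u0
  proof -
    obtain z where z: "vector_jet \<rho>0 z" using s H1_per0_vec_iff unfolding solves_B2_def by blast
    have sol: "?sol z" using s B2_sol[OF z] by blast
    define U0 where "U0 = - jet_div z"
    have u0: "represents u0 U0" unfolding u0_def U0_def by (rule represents_uminus[OF represents_weak_div[OF z]])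
    have mean0: "U0 \<bullet> one_l2 = 0"
    proof -
      have "snd z $ i $ i \<bullet> one_l2 = 0" for i
        using sol H1_mean_derivative[of "fst z $ i" "snd z $ i" i] by (auto simp: jet_space_def)
      then show ?thesis by (simp add: U0_def jet_div_def inner_sum_left)
    qed
    \<comment> \<open>Jets of potentials lie in the solution space and have no curl, so the equation
      for \<open>z\<close> reduces to its divergence term; the two minus signs cancel.\<close>
    have eq0: "U0 \<bullet> jet_op a \<beta> y = F' \<bullet> fst y" if y: "potential_jet \<phi> y" for \<phi> y
    proof -
      note pj = potential_jet_properties[OF y]
      have "jet_form a \<beta> z y = - (F' \<bullet> fst y)" using sol pj(1) by blast
      then show ?thesis by (simp add: jet_form_def pj(2) U0_def)
    qed
    have solu0: "very_weak_solution (A_tilde A b) (b_tilde A b) F u0" using vws[OF u0] eq0 by blast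
    have AE_eq: "AE x in lebesgue. u x = v x" if "represents u U" "represents v U" for u v U
      using represents_AE_eq[OF that] by (simp add: AE_completion_iff)
    have ii: "AE x in lebesgue. u x = u0 x"
      if u: "very_weak_solution (A_tilde A b) (b_tilde A b) F u" "cell_integral u = 0" for u
    proof -
      obtain U where U: "represents u U" using u(1) L2_per_imp_represents unfolding very_weak_solution_def by blast
      have "U - U0 = 0"
      proof (rule kernel)
        show "(U - U0) \<bullet> one_l2 = 0" using mean0 u(2) cell_integral_represents[OF U] by (simp add: inner_diff_left)
        fix \<phi> :: "real ^ 'n \<Rightarrow> real" and y :: "'n jet" assume y: "\<phi> \<in> H_per 2" "potential_jet \<phi> y"
        have "U \<bullet> jet_op a \<beta> y = F' \<bullet> fst y" using vws[OF U] u(1) y by blast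
        then show "(U - U0) \<bullet> jet_op a \<beta> y = 0" using eq0[OF y(2)] by (simp add: inner_diff_left)
      qed
      then show ?thesis using AE_eq[OF U] u0 by simp
    qed
    have iii: "very_weak_solution (A_tilde A b) (b_tilde A b) F u \<longleftrightarrow> (\<exists>c::real. AE x in lebesgue. u x = u0 x + c * r x)"
      if r: "very_weak_solution (A_tilde A b) (b_tilde A b) (\<lambda>x. 0) r" "cell_integral r = 1" and uL: "u \<in> L2_per" for r u
    proof -
      obtain R where R: "represents r R" using r(1) L2_per_imp_represents unfolding very_weak_solution_def by blast
      have Rk: "R \<bullet> jet_op a \<beta> y = 0" if "\<phi> \<in> H_per 2" "potential_jet \<phi> y" for \<phi> y
      proof -
        have "R \<bullet> jet_op a \<beta> y = 0 \<bullet> fst y" using vws0[OF R] r(1) that by blast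
        then show ?thesis by simp
      qed
      have R1: "R \<bullet> one_l2 = 1" using cell_integral_represents[OF R] r(2) by simp
      obtain U where U: "represents u U" using uL L2_per_imp_represents by blast
      show ?thesis
      proof
        assume u: "very_weak_solution (A_tilde A b) (b_tilde A b) F u"
        \<comment> \<open>Since \<open>u0\<close> has mean 0 and \<open>r\<close> has mean 1, the
          constant can only be the mean of \<open>u\<close>.\<close>
        define c where "c = U \<bullet> one_l2"
        have "U - U0 - c *\<^sub>R R = 0"
        proof (rule kernel)
          show "(U - U0 - c *\<^sub>R R) \<bullet> one_l2 = 0" by (simp add: inner_diff_left mean0 R1 c_def)
          fix \<phi> :: "real ^ 'n \<Rightarrow> real" and y :: "'n jet" assume y: "\<phi> \<in> H_per 2" "potential_jet \<phi> y"
          have "U \<bullet> jet_op a \<beta> y = F' \<bullet> fst y" using vws[OF U] u y by blast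
          then show "(U - U0 - c *\<^sub>R R) \<bullet> jet_op a \<beta> y = 0"
            using eq0[OF y(2)] Rk[OF y] by (simp add: inner_diff_left)
        qed
        then have "U = U0 + c *\<^sub>R R" by (simp add: algebra_simps)
        then have "represents (\<lambda>x. u0 x + c * r x) U" using represents_linear[OF u0 R, of c] by simp
        then show "\<exists>c::real. AE x in lebesgue. u x = u0 x + c * r x" using AE_eq[OF U] by blast
      next
        assume "\<exists>c::real. AE x in lebesgue. u x = u0 x + c * r x"
        then obtain c where c: "AE x in lborel. u x = u0 x + c * r x" by (auto simp: AE_completion_iff)
        have "represents u (U0 + c *\<^sub>R R)"
          by (rule represents_cong[OF represents_linear[OF u0 R, of c]]) (use c in \<open>simp add: eq_commute\<close>)
        moreover have "(U0 + c *\<^sub>R R) \<bullet> jet_op a \<beta> y = F' \<bullet> fst y" if y: "\<phi> \<in> H_per 2" "potential_jet \<phi> y" for \<phi> y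
          using eq0[OF y(2)] Rk[OF y] by (simp add: inner_add_left)
        ultimately show "very_weak_solution (A_tilde A b) (b_tilde A b) F u" using vws by blast
      qed
    qed
    have "cell_integral u0 = 0" using cell_integral_represents[OF u0] mean0 by simp
    then show ?thesis using solu0 ii iii by blast
  qed
  show ?thesis using i ii_iii by blast
qed

end
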